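(* Let $(M,g)$ be a complete Riemannian manifold and let $\mathcal{F}$ be a collection of open $4$-proper geodesic balls in $(M,g)$ such that the set $A$ of the centers of the balls in $\mathcal{F}$ is bounded. Then one can find $N\in\mathbb{N}^+$ and subcollections $\mathcal{F}_1,\dots,\mathcal{F}_N\subset\mathcal{F}$, each of which consists of at most countably many (pairwise) disjoint balls, such that $A$ is covered by the balls from $\mathcal{F}_1\cup\dots\cup\mathcal{F}_N$, i.e. $A\subset\bigcup_{j=1}^{N}\bigcup_{D\in\mathcal{F}_j}D$.
   Context: Riemannian manifolds are finite dimensional. For $x\in M$ and $r>0$, $D_r(x)$ denotes the open geodesic ball of radius $r$ in $M$ with center $x$, with respect to the Riemannian distance $\rho_g$. The ball $D_r(x)$ is called $4$-proper if $4r$ is at most the injectivity radius of $(M,g)$ at $x$ (i.e. $r$ is at most $1/4$ of the injectivity radius at its center). Boundedness is with respect to $\rho_g$. *)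

theory Defs
  imports "HOL-Analysis.Analysis"
begin

section \<open>Smooth maps between open subsets of Euclidean spaces\<close>

text \<open>For open \<open>S\<close>, \<open>Ck_on k S f\<close> says that all iterated directional derivatives of \<open>f\<close> of order
  at most \<open>k\<close> exist and are continuous on \<open>S\<close>.\<close>

fun Ck_on :: "nat \<Rightarrow> 'e::euclidean_space set \<Rightarrow> ('e \<Rightarrow> 'f::real_normed_vector) \<Rightarrow> bool" where
  "Ck_on 0 S f \<longleftrightarrow> continuous_on S f"
| "Ck_on (Suc k) S f \<longleftrightarrow>
     (\<forall>x\<in>S. f differentiable (at x)) \<and> (\<forall>v. Ck_on k S (\<lambda>x. frechet_derivative f (at x) v))"

text \<open>Openness of the domain is part of \<open>smooth_on\<close>.\<close>

definition smooth_on :: "'e::euclidean_space set \<Rightarrow> ('e \<Rightarrow> 'f::real_normed_vector) \<Rightarrow> bool" where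
  "smooth_on S f \<longleftrightarrow> open S \<and> (\<forall>k. Ck_on k S f)"


section \<open>Smooth manifolds and tangent vectors\<close>

text \<open>A chart is its domain together with its coordinate map; the values of the coordinate map
  outside the domain are irrelevant.\<close>

type_synonym ('a, 'e) chart = "'a set \<times> ('a \<Rightarrow> 'e)"

definition chart_image :: "('a, 'e) chart \<Rightarrow> 'e set" where
  "chart_image c = snd c ` fst c"

definition chart_inv :: "('a, 'e) chart \<Rightarrow> 'e \<Rightarrow> 'a" where
  "chart_inv c = inv_into (fst c) (snd c)"

definition transition :: "('a, 'e) chart \<Rightarrow> ('a, 'e) chart \<Rightarrow> 'e \<Rightarrow> 'e" where
  "transition c d = snd d \<circ> chart_inv c"

definition smooth_atlas :: "'a topology \<Rightarrow> ('a, 'e::euclidean_space) chart set \<Rightarrow> bool" where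
  "smooth_atlas T \<A> \<longleftrightarrow>
     (\<Union>c\<in>\<A>. fst c) = topspace T \<and>
     (\<forall>c\<in>\<A>. openin T (fst c) \<and> open (chart_image c) \<and>
        homeomorphic_map (subtopology T (fst c)) (top_of_set (chart_image c)) (snd c)) \<and>
     (\<forall>c\<in>\<A>. \<forall>d\<in>\<A>. smooth_on (snd c ` (fst c \<inter> fst d)) (transition c d))"

text \<open>A tangent vector at \<open>p\<close> is given by its components in all charts around \<open>p\<close>, which are
  related by the derivatives of the coordinate changes. For all other charts the value is fixed
  to be 0, so that equality of tangent vectors is equality of functions; the vector space
  operations are pointwise.\<close>

type_synonym ('a, 'e) tvec = "('a, 'e) chart \<Rightarrow> 'e"

text \<open>The metric maps a point and two tangent vectors at that point to their inner product.\<close>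

record ('a, 'e) riemannian =
  mtop :: "'a topology"
  atlas :: "('a, 'e) chart set"
  metric :: "'a \<Rightarrow> ('a, 'e) tvec \<Rightarrow> ('a, 'e) tvec \<Rightarrow> real"

definition charts_at :: "('a, 'e) riemannian \<Rightarrow> 'a \<Rightarrow> ('a, 'e) chart set" where
  "charts_at M p = {c \<in> atlas M. p \<in> fst c}"

definition tangent_space :: "('a, 'e::euclidean_space) riemannian \<Rightarrow> 'a \<Rightarrow> ('a, 'e) tvec set" where
  "tangent_space M p =
     {v. (\<forall>c\<in>charts_at M p. \<forall>d\<in>charts_at M p.
            v d = frechet_derivative (transition c d) (at (snd c p)) (v c)) \<and>
         (\<forall>c. c \<notin> charts_at M p \<longrightarrow> v c = 0)}"

text \<open>The tangent vector at \<open>p\<close> whose component in the chart \<open>c\<close> is \<open>a\<close>.\<close>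

definition chart_vec ::
  "('a, 'e::euclidean_space) riemannian \<Rightarrow> ('a, 'e) chart \<Rightarrow> 'a \<Rightarrow> 'e \<Rightarrow> ('a, 'e) tvec" where
  "chart_vec M c p a =
     (\<lambda>d. if d \<in> charts_at M p then frechet_derivative (transition c d) (at (snd c p)) a else 0)"


section \<open>Riemannian manifolds\<close>

definition metric_coeff ::
  "('a, 'e::euclidean_space) riemannian \<Rightarrow> ('a, 'e) chart \<Rightarrow> 'e \<Rightarrow> 'e \<Rightarrow> 'e \<Rightarrow> real" where
  "metric_coeff M c x a b =
     (let p = chart_inv c x in metric M p (chart_vec M c p a) (chart_vec M c p b))"

definition inner_product_on_tangent_space ::
  "('a, 'e::euclidean_space) riemannian \<Rightarrow> 'a \<Rightarrow> bool" where
  "inner_product_on_tangent_space M p \<longleftrightarrow>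
     (\<forall>u\<in>tangent_space M p. \<forall>v\<in>tangent_space M p.
        metric M p u v = metric M p v u \<and>
        (\<forall>w\<in>tangent_space M p.
           metric M p (\<lambda>c. u c + v c) w = metric M p u w + metric M p v w) \<and>
        (\<forall>r. metric M p (\<lambda>c. r *\<^sub>R u c) v = r * metric M p u v)) \<and>
     (\<forall>u\<in>tangent_space M p. u \<noteq> (\<lambda>c. 0) \<longrightarrow> metric M p u u > 0)"

definition riemannian_manifold :: "('a, 'e::euclidean_space) riemannian \<Rightarrow> bool" where
  "riemannian_manifold M \<longleftrightarrow>
     Hausdorff_space (mtop M) \<and> second_countable (mtop M) \<and>
     smooth_atlas (mtop M) (atlas M) \<and>
     (\<forall>p\<in>topspace (mtop M). inner_product_on_tangent_space M p) \<and>
     (\<forall>c\<in>atlas M. \<forall>a b. smooth_on (chart_image c) (\<lambda>x. metric_coeff M c x a b))"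

definition tnorm :: "('a, 'e) riemannian \<Rightarrow> 'a \<Rightarrow> ('a, 'e) tvec \<Rightarrow> real" where
  "tnorm M p v = sqrt (metric M p v v)"


section \<open>Curves, length and the Riemannian distance\<close>

text \<open>The derivatives of curves are taken within the parameter interval \<open>I\<close>, i.e. they are one-sided
  at its end points.\<close>

definition velocity ::
  "('a, 'e::euclidean_space) riemannian \<Rightarrow> real set \<Rightarrow> (real \<Rightarrow> 'a) \<Rightarrow> real \<Rightarrow> ('a, 'e) tvec" where
  "velocity M I \<gamma> t =
     (\<lambda>c. if c \<in> charts_at M (\<gamma> t) then vector_derivative (snd c \<circ> \<gamma>) (at t within I) else 0)"

definition C1_curve ::
  "('a, 'e::euclidean_space) riemannian \<Rightarrow> real set \<Rightarrow> (real \<Rightarrow> 'a) \<Rightarrow> bool" where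
  "C1_curve M I \<gamma> \<longleftrightarrow>
     continuous_map (top_of_set I) (mtop M) \<gamma> \<and>
     (\<forall>c\<in>atlas M. let J = {t\<in>I. \<gamma> t \<in> fst c} in
        (\<forall>t\<in>J. (snd c \<circ> \<gamma>) differentiable (at t within I)) \<and>
        continuous_on J (\<lambda>t. vector_derivative (snd c \<circ> \<gamma>) (at t within I)))"

definition piecewise_C1_curve ::
  "('a, 'e::euclidean_space) riemannian \<Rightarrow> (real \<Rightarrow> 'a) \<Rightarrow> bool" where
  "piecewise_C1_curve M \<gamma> \<longleftrightarrow>
     (\<exists>S. finite S \<and>
        (\<forall>a b. 0 \<le> a \<and> a < b \<and> b \<le> 1 \<and> {a<..<b} \<inter> S = {} \<longrightarrow> C1_curve M {a..b} \<gamma>))"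

text \<open>At the finitely many break points the integrand is a junk value, which does not matter for
  the integral.\<close>

definition curve_length :: "('a, 'e::euclidean_space) riemannian \<Rightarrow> (real \<Rightarrow> 'a) \<Rightarrow> real" where
  "curve_length M \<gamma> = integral {0..1} (\<lambda>t. tnorm M (\<gamma> t) (velocity M {0..1} \<gamma> t))"

text \<open>The distance is infinite between points of different connected components.\<close>

definition rdist :: "('a, 'e::euclidean_space) riemannian \<Rightarrow> 'a \<Rightarrow> 'a \<Rightarrow> ereal" where
  "rdist M x y =
     Inf {ereal (curve_length M \<gamma>) |\<gamma>. piecewise_C1_curve M \<gamma> \<and> \<gamma> 0 = x \<and> \<gamma> 1 = y}"

definition geodesic_ball :: "('a, 'e::euclidean_space) riemannian \<Rightarrow> 'a \<Rightarrow> real \<Rightarrow> 'a set" where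
  "geodesic_ball M x r = {y \<in> topspace (mtop M). rdist M x y < ereal r}"

definition rbounded :: "('a, 'e::euclidean_space) riemannian \<Rightarrow> 'a set \<Rightarrow> bool" where
  "rbounded M A \<longleftrightarrow>
     A \<subseteq> topspace (mtop M) \<and> (\<exists>C::real. \<forall>x\<in>A. \<forall>y\<in>A. rdist M x y \<le> ereal C)"

definition complete_riemannian :: "('a, 'e::euclidean_space) riemannian \<Rightarrow> bool" where
  "complete_riemannian M \<longleftrightarrow>
     (\<forall>s::nat \<Rightarrow> 'a.
        range s \<subseteq> topspace (mtop M) \<and>
        (\<forall>\<epsilon>>0. \<exists>K. \<forall>m\<ge>K. \<forall>n\<ge>K. rdist M (s m) (s n) < ereal \<epsilon>) \<longrightarrow>
        (\<exists>x\<in>topspace (mtop M). (\<lambda>n. rdist M (s n) x) \<longlonglongrightarrow> 0))"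


section \<open>Geodesics, the exponential map and the injectivity radius\<close>

text \<open>The Christoffel symbols of the first kind: by the Koszul formula for coordinate vector fields,
  \<open>g (\<nabla>\<^sub>u v, w) = (\<partial>\<^sub>u g(v,w) + \<partial>\<^sub>v g(u,w) - \<partial>\<^sub>w g(u,v)) / 2\<close>.\<close>

definition christoffel ::
  "('a, 'e::euclidean_space) riemannian \<Rightarrow> ('a, 'e) chart \<Rightarrow> 'e \<Rightarrow> 'e \<Rightarrow> 'e \<Rightarrow> 'e \<Rightarrow> real" where
  "christoffel M c x u v w =
     (frechet_derivative (\<lambda>y. metric_coeff M c y v w) (at x) u
      + frechet_derivative (\<lambda>y. metric_coeff M c y u w) (at x) v
      - frechet_derivative (\<lambda>y. metric_coeff M c y u v) (at x) w) / 2"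

text \<open>The equation says that the covariant derivative of the velocity along the curve, paired with
  an arbitrary vector \<open>w\<close>, vanishes.\<close>

definition geodesic_on ::
  "('a, 'e::euclidean_space) riemannian \<Rightarrow> real set \<Rightarrow> (real \<Rightarrow> 'a) \<Rightarrow> bool" where
  "geodesic_on M I \<gamma> \<longleftrightarrow>
     C1_curve M I \<gamma> \<and>
     (\<forall>c\<in>atlas M. \<forall>t\<in>I. \<gamma> t \<in> fst c \<longrightarrow>
        (let x = snd c \<circ> \<gamma>; x' = (\<lambda>s. vector_derivative x (at s within I)) in
         \<exists>x''. (x' has_vector_derivative x'') (at t within I) \<and>
           (\<forall>w. metric_coeff M c (x t) x'' w + christoffel M c (x t) (x' t) (x' t) w = 0)))"

definition geodesic_from ::
  "('a, 'e::euclidean_space) riemannian \<Rightarrow> 'a \<Rightarrow> ('a, 'e) tvec \<Rightarrow> (real \<Rightarrow> 'a) \<Rightarrow> bool" where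
  "geodesic_from M p v \<gamma> \<longleftrightarrow>
     geodesic_on M {0..1} \<gamma> \<and> \<gamma> 0 = p \<and> velocity M {0..1} \<gamma> 0 = v"

definition exp_domain :: "('a, 'e::euclidean_space) riemannian \<Rightarrow> 'a \<Rightarrow> ('a, 'e) tvec set" where
  "exp_domain M p = {v \<in> tangent_space M p. \<exists>\<gamma>. geodesic_from M p v \<gamma>}"

definition riem_exp :: "('a, 'e::euclidean_space) riemannian \<Rightarrow> 'a \<Rightarrow> ('a, 'e) tvec \<Rightarrow> 'a" where
  "riem_exp M p v = (THE q. \<exists>\<gamma>. geodesic_from M p v \<gamma> \<and> \<gamma> 1 = q)"

definition tangent_ball ::
  "('a, 'e::euclidean_space) riemannian \<Rightarrow> 'a \<Rightarrow> real \<Rightarrow> ('a, 'e) tvec set" where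
  "tangent_ball M p r = {v \<in> tangent_space M p. tnorm M p v < r}"

text \<open>\<open>f\<close> is a diffeomorphism from the subset \<open>B\<close> of the tangent space at \<open>p\<close> onto an open subset of
  the manifold; the smooth structure of the tangent space is the one given by the linear
  isomorphisms with the Euclidean model space induced by the charts around \<open>p\<close>.\<close>

definition tangent_diffeo ::
  "('a, 'e::euclidean_space) riemannian \<Rightarrow> 'a \<Rightarrow> ('a, 'e) tvec set \<Rightarrow> (('a, 'e) tvec \<Rightarrow> 'a) \<Rightarrow> bool" where
  "tangent_diffeo M p B f \<longleftrightarrow>
     inj_on f B \<and> openin (mtop M) (f ` B) \<and>
     (\<forall>c\<in>charts_at M p. \<forall>d\<in>atlas M.
        smooth_on {a. chart_vec M c p a \<in> B \<and> f (chart_vec M c p a) \<in> fst d}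
          (\<lambda>a. snd d (f (chart_vec M c p a))) \<and>
        smooth_on (snd d ` (fst d \<inter> f ` B)) (\<lambda>y. inv_into B f (chart_inv d y) c))"

definition injectivity_radius :: "('a, 'e::euclidean_space) riemannian \<Rightarrow> 'a \<Rightarrow> ereal" where
  "injectivity_radius M p =
     Sup {ereal r |r. r > 0 \<and> tangent_ball M p r \<subseteq> exp_domain M p \<and>
            tangent_diffeo M p (tangent_ball M p r) (riem_exp M p)}"

text \<open>A geodesic ball is represented by its centre and radius, so that the collection of centres of
  a family of balls is unambiguous.\<close>

definition four_proper :: "('a, 'e::euclidean_space) riemannian \<Rightarrow> 'a \<times> real \<Rightarrow> bool" where
  "four_proper M = (\<lambda>(x, r). x \<in> topspace (mtop M) \<and> r > 0 \<and>
     ereal (4 * r) \<le> injectivity_radius M x)"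

end

theory Submission
  imports Defs
begin

text \<open>
  The statement is a covering theorem of Besicovitch type. It is proved for complete length spaces
  that look like an inner product space to first order at every point, and then transferred to the
  connected component of the manifold that contains the centres.

  In such a space bounded sets are totally bounded (\<open>Hopf_Rinow\<close>), so the set of centres splits into
  finitely many pieces. Balls whose radius is bounded below are disposed of at once: by total
  boundedness finitely many of them cover all their centres. What is left are families of small
  balls with centres in one small coordinate neighbourhood. From such a family balls are picked
  greedily, each with almost the largest radius among those whose centre is not covered yet; the
  picked balls cover all centres. If every picked ball meets at most \<open>N\<close> of those picked before it,
  a greedy colouring with \<open>N + 1\<close> colours distributes them into disjoint families.

  The heart is therefore the bound \<open>N\<close> (\<open>overlap_bound\<close>). Consider a picked ball with centre \<open>a\<close> and
  radius \<open>\<epsilon>\<close>, and the earlier balls that meet it. Those of radius at most \<open>6 * \<epsilon>\<close> have centres that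
  are separated on the scale \<open>\<epsilon>\<close> and stay within distance \<open>7 * \<epsilon>\<close> of \<open>a\<close>, so a packing argument bounds
  their number. For the larger ones the directions in which their centres are seen from \<open>a\<close> must be
  separated. This rests on the estimate \<open>directional\<close>: if \<open>p\<close> and \<open>q\<close> are seen from \<open>a\<close> in nearby
  directions and \<open>q\<close> is the closer one, then \<open>d p q \<le> d a p - 2/3 * d a q\<close>, no matter how much
  smaller \<open>d a q\<close> is than \<open>d a p\<close>. A bilipschitz comparison with a Euclidean metric cannot yield
  this, because the scales of \<open>p\<close> and \<open>q\<close> may be arbitrarily far apart. Instead one walks from \<open>p\<close>
  towards \<open>a\<close> along approximate midpoints. At distance \<open>s\<close> from \<open>a\<close> the distance function agrees with
  the inner product norm at \<open>a\<close> up to a factor \<open>1 + O(s)\<close>, and by the parallelogram identity one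
  halving step turns the direction by at most \<open>O(sqrt s)\<close> (\<open>halving\<close>). These errors form a geometric
  series, so the point reached at the scale of \<open>q\<close> is still almost in the direction
  of \<open>p\<close>.

  For a Riemannian manifold the required first order approximation (\<open>rdist_near_inner_norm\<close>) follows
  from the Lipschitz continuity of the metric coefficients in a chart: the upper bound is the length
  of a coordinate segment, and the lower bound holds because a curve that is too short to leave the
  region where the coefficients are almost constant is almost as long as its coordinate displacement.
\<close>

section \<open>Positive semidefinite forms\<close>

definition inner_form :: "('e::real_vector \<Rightarrow> 'e \<Rightarrow> real) \<Rightarrow> bool" where
  "inner_form g \<longleftrightarrow> (\<forall>x y. g x y = g y x) \<and> (\<forall>x y z. g (x + y) z = g x z + g y z) \<and>
     (\<forall>r x y. g (r *\<^sub>R x) y = r * g x y) \<and> (\<forall>x. 0 \<le> g x x)"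

definition form_norm :: "('e::real_vector \<Rightarrow> 'e \<Rightarrow> real) \<Rightarrow> 'e \<Rightarrow> real" where
  "form_norm g x = sqrt (g x x)"

context
  fixes g :: "'e::real_vector \<Rightarrow> 'e \<Rightarrow> real"
  assumes g: "inner_form g"
begin

lemma form_sym: "g x y = g y x"
  and form_add_left: "g (x + y) z = g x z + g y z"
  and form_scale_left: "g (r *\<^sub>R x) y = r * g x y"
  and form_nonneg: "0 \<le> g x x"
  using g unfolding inner_form_def by blast+

lemma form_add_right: "g z (x + y) = g z x + g z y"
  and form_scale_right: "g y (r *\<^sub>R x) = r * g y x"
  using form_sym form_add_left form_scale_left by metis+

lemma form_minus_left: "g (- x) y = - g x y"
  and form_minus_right: "g y (- x) = - g y x"
  using form_scale_left[of "-1" x y] form_scale_right[of y "-1" x] by auto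

lemma form_diff_left: "g (x - y) z = g x z - g y z"
  and form_diff_right: "g z (x - y) = g z x - g z y"
  using form_add_left[of x "-y" z] form_add_right[of z x "-y"]
  by (auto simp: form_minus_left form_minus_right)

lemmas form_simps = form_add_left form_add_right form_scale_left form_scale_right
  form_minus_left form_minus_right form_diff_left form_diff_right

lemma form_norm_nonneg: "0 \<le> form_norm g x"
  by (simp add: form_norm_def form_nonneg)

lemma form_norm_square: "(form_norm g x)\<^sup>2 = g x x"
  by (simp add: form_norm_def form_nonneg)

lemma form_norm_scale: "form_norm g (r *\<^sub>R x) = \<bar>r\<bar> * form_norm g x"
proof -
  have "g (r *\<^sub>R x) (r *\<^sub>R x) = r\<^sup>2 * g x x"
    by (simp add: form_scale_left form_scale_right power2_eq_square)
  then show ?thesis by (simp add: form_norm_def real_sqrt_mult)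
qed

lemma form_norm_minus_commute: "form_norm g (x - y) = form_norm g (y - x)"
  using form_norm_scale[of "-1" "x - y"] by simp

text \<open>In this form the identity measures how far \<open>y\<close> is from the midpoint of \<open>0\<close> and \<open>x\<close>.\<close>

lemma form_parallelogram:
  "(form_norm g (2 *\<^sub>R y - x))\<^sup>2 = 2 * (form_norm g y)\<^sup>2 + 2 * (form_norm g (y - x))\<^sup>2 - (form_norm g x)\<^sup>2"
  by (simp add: form_norm_square form_simps form_sym[of y x] algebra_simps)

lemma form_Cauchy_Schwarz: "g x y \<le> form_norm g x * form_norm g y"
proof -
  have D: "0 \<le> g x x - 2 * t * g x y + t\<^sup>2 * g y y" for t
    using form_nonneg[of "x - t *\<^sub>R y"]
    by (simp add: form_simps form_sym[of y x] algebra_simps power2_eq_square)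
  have "(g x y)\<^sup>2 \<le> g x x * g y y"
  proof (cases "g y y = 0")
    case True
    have "g x y = 0"
    proof (rule ccontr)
      assume "g x y \<noteq> 0"
      with D[of "(g x x + 1) / (2 * g x y)"] True show False by simp
    qed
    with True show ?thesis by simp
  next
    case False
    then have "g y y > 0" using form_nonneg[of y] by linarith
    then show ?thesis
      using D[of "g x y / g y y"] by (simp add: field_simps power2_eq_square)
  qed
  then have "\<bar>g x y\<bar> \<le> sqrt (g x x * g y y)"
    by (metis real_sqrt_abs real_sqrt_le_mono)
  then show ?thesis by (simp add: form_norm_def real_sqrt_mult)
qed

lemma form_norm_triangle: "form_norm g (x + y) \<le> form_norm g x + form_norm g y"
proof -
  have "(form_norm g (x + y))\<^sup>2 \<le> (form_norm g x + form_norm g y)\<^sup>2"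
    using form_Cauchy_Schwarz[of x y] by (simp add: form_norm_square form_simps form_sym[of y x] power2_sum)
  then show ?thesis
    by (rule power2_le_imp_le) (simp add: form_norm_nonneg)
qed

lemma form_norm_triangle_diff: "form_norm g (x - z) \<le> form_norm g (x - y) + form_norm g (y - z)"
  using form_norm_triangle[of "x - y" "y - z"] by simp

end

section \<open>Complete length spaces\<close>

text \<open>The condition \<open>between\<close> is what curves of almost minimal length provide.\<close>

locale length_space = Metric_space X d for X :: "'a set" and d +
  assumes between: "\<lbrakk>x \<in> X; y \<in> X; 0 \<le> t; t \<le> d x y; 0 < e\<rbrakk>
      \<Longrightarrow> \<exists>z\<in>X. d x z \<le> t + e \<and> d z y \<le> d x y - t + e"
  and complete: mcomplete
begin

text \<open>Otherwise there are points of \<open>A\<close> for which smaller and smaller balls fail to fit; a subsequence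
  of them converges to some \<open>l\<close>, and the ball of radius \<open>\<rho> l\<close> gives a contradiction.\<close>

lemma Lebesgue_number:
  assumes A: "mtotally_bounded A" and \<rho>: "\<And>p. p \<in> X \<Longrightarrow> 0 < \<rho> p"
  shows "\<exists>\<delta>>0. \<forall>x\<in>A. \<exists>p\<in>X. mball x \<delta> \<subseteq> mball p (\<rho> p)"
proof (rule ccontr)
  assume neg: "\<not> ?thesis"
  have "\<exists>x\<in>A. \<forall>p\<in>X. \<not> mball x (inverse (Suc n)) \<subseteq> mball p (\<rho> p)" for n
    using neg by (metis inverse_positive_iff_positive of_nat_0_less_iff zero_less_Suc)
  then obtain s where sA: "\<And>n. s n \<in> A"
    and s: "\<And>n p. p \<in> X \<Longrightarrow> \<not> mball (s n) (inverse (Suc n)) \<subseteq> mball p (\<rho> p)"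
    by metis
  then obtain r where r: "strict_mono r" "MCauchy (s \<circ> r)"
    using A unfolding mtotally_bounded_sequentially by blast
  then obtain l where l: "limitin mtopology (s \<circ> r) l sequentially"
    using complete unfolding mcomplete_def by blast
  then have lX: "l \<in> X" by (simp add: limitin_metric)
  have "\<forall>\<^sub>F n in sequentially. (s \<circ> r) n \<in> X \<and> d ((s \<circ> r) n) l < \<rho> l / 2"
    using l \<rho>[OF lX] unfolding limitin_metric by (meson half_gt_zero)
  moreover have "\<forall>\<^sub>F n in sequentially. inverse (real (Suc n)) < \<rho> l / 2"
    using \<rho>[OF lX] Archimedean_eventually_inverse half_gt_zero by blast
  ultimately have "\<forall>\<^sub>F n in sequentially. ((s \<circ> r) n \<in> X \<and> d ((s \<circ> r) n) l < \<rho> l / 2) \<and> inverse (real (Suc n)) < \<rho> l / 2"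
    by (rule eventually_conj)
  then obtain n where "((s \<circ> r) n \<in> X \<and> d ((s \<circ> r) n) l < \<rho> l / 2) \<and> inverse (real (Suc n)) < \<rho> l / 2"
    using eventually_happens'[OF sequentially_bot] by blast
  then have n: "s (r n) \<in> X" "d (s (r n)) l < \<rho> l / 2" "inverse (real (Suc n)) < \<rho> l / 2"
    by (simp_all del: of_nat_Suc)
  have "n \<le> r n" using r(1) by (rule strict_mono_imp_increasing)
  then have "inverse (real (Suc (r n))) \<le> inverse (real (Suc n))" by simp
  then have "d (s (r n)) l + inverse (real (Suc (r n))) \<le> \<rho> l"
    using n by linarith
  then have "mball (s (r n)) (inverse (Suc (r n))) \<subseteq> mball l (\<rho> l)"
    using lX by (intro mball_subset) (simp_all del: of_nat_Suc)
  with s lX show False by blast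
qed

text \<open>The centres of the covering balls may lie outside of \<open>S\<close>; replacing them by points of \<open>S\<close> doubles the
  radius.\<close>

lemma mtotally_bounded_outer:
  assumes "S \<subseteq> X" "\<And>e. e > 0 \<Longrightarrow> \<exists>K. finite K \<and> K \<subseteq> X \<and> S \<subseteq> (\<Union>x\<in>K. mball x e)"
  shows "mtotally_bounded S"
  unfolding mtotally_bounded_def
proof (intro strip)
  fix e :: real assume "e > 0"
  then obtain K where K: "finite K" "K \<subseteq> X" "S \<subseteq> (\<Union>x\<in>K. mball x (e/2))"
    using assms(2)[of "e/2"] by auto
  define f where "f x = (SOME y. y \<in> S \<and> y \<in> mball x (e/2))" for x
  have f: "f x \<in> S \<and> f x \<in> mball x (e/2)" if "y \<in> S" "y \<in> mball x (e/2)" for x y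
    unfolding f_def by (rule someI[of "\<lambda>y. y \<in> S \<and> y \<in> mball x (e/2)" y]) (use that in blast)
  define K' where "K' = f ` {x\<in>K. S \<inter> mball x (e/2) \<noteq> {}}"
  have "K' \<subseteq> S" using f unfolding K'_def by blast
  moreover have "S \<subseteq> (\<Union>x\<in>K'. mball x e)"
  proof
    fix y assume y: "y \<in> S"
    then obtain x where x: "x \<in> K" "y \<in> mball x (e/2)" using K by blast
    then have fx: "f x \<in> S" "f x \<in> mball x (e/2)" using f y by auto
    have "f x \<in> K'" using x y unfolding K'_def by (intro imageI) blast
    moreover have "y \<in> mball (f x) e"
      using fx x(2) triangle''[of "f x" x y] triangle[of "f x" x y] by (auto simp: commute)
    ultimately show "y \<in> (\<Union>x\<in>K'. mball x e)" by blast
  qed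
  ultimately show "\<exists>K. finite K \<and> K \<subseteq> S \<and> S \<subseteq> (\<Union>x\<in>K. mball x e)"
    using K(1) unfolding K'_def by (intro exI[of _ "f ` {x\<in>K. S \<inter> mball x (e/2) \<noteq> {}}"]) auto
qed

text \<open>The metric form of the Hopf--Rinow theorem. Let \<open>R\<close> be the supremum of the radii for which the ball
  around \<open>a\<close> is totally bounded. By the intermediate points the ball of radius \<open>R\<close> lies close to
  slightly smaller balls and is totally bounded as well; a Lebesgue number of its cover by small
  totally bounded balls then allows to enlarge \<open>R\<close>.\<close>

lemma Hopf_Rinow:
  assumes loc: "\<And>p. p \<in> X \<Longrightarrow> \<exists>r>0. mtotally_bounded (mball p r)"
    and a: "a \<in> X"
  shows "mtotally_bounded (mball a r)"
proof -
  obtain \<rho> where \<rho>: "\<And>p. p \<in> X \<Longrightarrow> 0 < \<rho> p \<and> mtotally_bounded (mball p (\<rho> p))"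
    using loc by metis
  define T where "T = {r. mtotally_bounded (mball a r)}"
  have T_mono: "r \<in> T" if "s \<in> T" "r \<le> s" for r s
    using that mtotally_bounded_subset mball_subset_concentric unfolding T_def by blast
  have "T = UNIV"
  proof (rule ccontr)
    assume "T \<noteq> UNIV"
    then obtain b where b: "b \<notin> T" by blast
    have T_le: "r \<le> b" if "r \<in> T" for r
      using T_mono[OF that, of b] b by linarith
    then have bdd: "bdd_above T" by (rule bdd_aboveI)
    have "0 \<in> T" unfolding T_def by (simp add: mball_eq_empty[THEN iffD2])
    define R where "R = Sup T"
    have below: "r \<in> T" if "r < R" for r
      using that T_mono less_cSupE[of r T] \<open>0 \<in> T\<close> unfolding R_def by (metis empty_iff less_imp_le)
    have above: "r \<le> R" if "r \<in> T" for r
      using that bdd unfolding R_def by (simp add: cSup_upper)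
    (* the slack m absorbs the inexactness of intermediate points, so that they lie in the open ball *)
    have near: "mball a (s + h) \<subseteq> (\<Union>x\<in>mball a s. mball x (h + k))"
      if "0 < s" "0 < h" "0 < k" for s h k
    proof
      fix y assume y: "y \<in> mball a (s + h)"
      show "y \<in> (\<Union>x\<in>mball a s. mball x (h + k))"
      proof (cases "d a y < s")
        case True
        with y that a show ?thesis by (intro UN_I[of y]) auto
      next
        case False
        define m where "m = (min s k) / 3"
        have m: "0 < m" "m < s" "m \<le> k / 3" "m \<le> s / 3" using that unfolding m_def by auto
        obtain z where z: "z \<in> X" "d a z \<le> (s - 2 * m) + m" "d z y \<le> d a y - (s - 2 * m) + m"
          using between[of a y "s - 2 * m" m] a y m False by auto
        then have "z \<in> mball a s" "y \<in> mball z (h + k)"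
          using m a y by (auto)
        then show ?thesis by blast
      qed
    qed
    obtain r1 where r1: "r1 > 0" "r1 \<in> T" using \<rho>[OF a] unfolding T_def by blast
    then have Rpos: "0 < R" using above by fastforce
    have "mtotally_bounded (mball a R)"
    proof (rule mtotally_bounded_outer)
      fix e :: real assume e: "e > 0"
      define h where "h = min (R/2) (e/4)"
      have h: "0 < h" "h < R" "h \<le> e/4" using e Rpos unfolding h_def by auto
      have "mtotally_bounded (mball a (R - h))" using below[of "R - h"] h unfolding T_def by auto
      then obtain K where K: "finite K" "K \<subseteq> mball a (R-h)" "mball a (R-h) \<subseteq> (\<Union>x\<in>K. mball x (e/4))"
        using e unfolding mtotally_bounded_def by (meson divide_pos_pos zero_less_numeral)
      have "mball a R \<subseteq> (\<Union>x\<in>K. mball x e)"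
      proof
        fix y assume "y \<in> mball a R"
        then obtain x where x: "x \<in> mball a (R-h)" "y \<in> mball x (h + h)"
          using near[of "R-h" h h] h by auto
        then obtain w where w: "w \<in> K" "x \<in> mball w (e/4)" using K by blast
        have "y \<in> mball w e" using x w h triangle[of w x y] by (auto)
        with w show "y \<in> (\<Union>x\<in>K. mball x e)" by blast
      qed
      moreover have "K \<subseteq> X" using K by auto
      ultimately show "\<exists>K. finite K \<and> K \<subseteq> X \<and> mball a R \<subseteq> (\<Union>x\<in>K. mball x e)"
        using K(1) by blast
    qed auto
    then obtain \<delta> where \<delta>: "\<delta> > 0" "\<And>x. x \<in> mball a R \<Longrightarrow> \<exists>p\<in>X. mball x \<delta> \<subseteq> mball p (\<rho> p)"
      using Lebesgue_number[of "mball a R" \<rho>] \<rho> by auto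
    have tb: "mtotally_bounded (mball x \<delta>)" if "x \<in> mball a R" for x
      using \<delta>(2)[OF that] \<rho> mtotally_bounded_subset by meson
    obtain K where K: "finite K" "K \<subseteq> mball a R" "mball a R \<subseteq> (\<Union>x\<in>K. mball x (\<delta>/4))"
      using \<open>mtotally_bounded (mball a R)\<close> \<delta>(1) unfolding mtotally_bounded_def
      by (meson divide_pos_pos zero_less_numeral)
    have "mball a (R + \<delta>/4) \<subseteq> (\<Union>x\<in>K. mball x \<delta>)"
    proof
      fix y assume "y \<in> mball a (R + \<delta>/4)"
      then obtain x where x: "x \<in> mball a R" "y \<in> mball x (\<delta>/4 + \<delta>/4)"
        using near[of R "\<delta>/4" "\<delta>/4"] \<delta>(1) Rpos by auto
      then obtain w where w: "w \<in> K" "x \<in> mball w (\<delta>/4)" using K by blast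
      have "y \<in> mball w \<delta>" using x w \<delta>(1) triangle[of w x y] by (auto)
      with w show "y \<in> (\<Union>x\<in>K. mball x \<delta>)" by blast
    qed
    moreover have "mtotally_bounded (\<Union>x\<in>K. mball x \<delta>)"
      using K tb by (intro mtotally_bounded_Union) auto
    ultimately have "R + \<delta>/4 \<in> T"
      unfolding T_def using mtotally_bounded_subset by blast
    then show False using above \<delta>(1) by fastforce
  qed
  then show ?thesis unfolding T_def by blast
qed

end

section \<open>Packing, greedy selection and greedy colouring\<close>

text \<open>A family separated by \<open>\<eta>\<close> has at most one member in each ball of a finite cover by balls of radius
  \<open>\<eta>/2\<close>. Families indexed by numbers fit the greedy selection, where separation is known for \<open>i < j\<close>.\<close>

lemma packing_bound:
  fixes R \<eta> :: real
  assumes "\<eta> > 0"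
  shows "\<exists>N. \<forall>(J::nat set) (v::nat \<Rightarrow> 'e::euclidean_space).
      finite J \<and> (\<forall>i\<in>J. norm (v i) \<le> R) \<and> (\<forall>i\<in>J. \<forall>j\<in>J. i < j \<longrightarrow> \<eta> \<le> norm (v i - v j)) \<longrightarrow> card J \<le> N"
proof -
  have "compact (cball (0::'e) R)" by simp
  then obtain K where K: "finite K" "cball (0::'e) R \<subseteq> (\<Union>x\<in>K. ball x (\<eta>/2))"
    using assms compact_eq_totally_bounded by (metis half_gt_zero)
  show ?thesis
  proof (intro exI[of _ "card K"] allI impI)
    fix J :: "nat set" and v :: "nat \<Rightarrow> 'e"
    assume *: "finite J \<and> (\<forall>i\<in>J. norm (v i) \<le> R) \<and> (\<forall>i\<in>J. \<forall>j\<in>J. i < j \<longrightarrow> \<eta> \<le> norm (v i - v j))"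
    then have "\<forall>i\<in>J. \<exists>x\<in>K. v i \<in> ball x (\<eta>/2)" using K(2) by (force simp: subset_iff)
    then obtain h where h: "\<And>i. i \<in> J \<Longrightarrow> h i \<in> K \<and> v i \<in> ball (h i) (\<eta>/2)" by metis
    have "inj_on h J"
    proof (rule linorder_inj_onI)
      fix i j assume ij: "i < j" "i \<in> J" "j \<in> J"
      show "h i \<noteq> h j"
      proof
        assume "h i = h j"
        then have "dist (v i) (v j) < \<eta>"
          using h[OF ij(2)] h[OF ij(3)] dist_triangle_half_r[of "h j" "v i" \<eta> "v j"] by simp
        moreover have "\<eta> \<le> norm (v i - v j)" using * ij by blast
        ultimately show False by (simp add: dist_norm)
      qed
    qed auto
    then show "card J \<le> card K"
      using h K(1) by (metis card_inj_on_le image_subsetI)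
  qed
qed

text \<open>Each \<open>n\<close> takes the least colour that none of its at most \<open>N\<close> earlier neighbours has.\<close>

lemma greedy_colouring:
  fixes E :: "nat \<Rightarrow> nat \<Rightarrow> bool"
  assumes "\<And>n. card {i. i < n \<and> E i n} \<le> N"
  shows "\<exists>c. \<forall>n. c n \<le> N \<and> (\<forall>i<n. E i n \<longrightarrow> c i \<noteq> c n)"
proof -
  define c :: "nat \<Rightarrow> nat" where "c \<equiv> wfrec less_than (\<lambda>f n. LEAST k. k \<notin> f ` {i. i < n \<and> E i n})"
  have cut: "cut f less_than n ` {i. i < n \<and> E i n} = f ` {i. i < n \<and> E i n}" for f :: "nat \<Rightarrow> nat" and n
    by (intro image_cong) (auto simp: cut_apply)
  have c: "c n = (LEAST k. k \<notin> c ` {i. i < n \<and> E i n})" for n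
    using def_wfrec[OF c_def wf_less_than, of n] by (simp only: cut)
  have "c n \<le> N \<and> (\<forall>i<n. E i n \<longrightarrow> c i \<noteq> c n)" for n
  proof -
    let ?U = "c ` {i. i < n \<and> E i n}"
    have "card ?U < card {..N}" using assms[of n] card_image_le[of "{i. i < n \<and> E i n}" c] by simp
    then have "\<not> {..N} \<subseteq> ?U" using card_mono[of ?U "{..N}"] by fastforce
    then obtain k where k: "k \<le> N" "k \<notin> ?U" by blast
    then have "c n \<notin> ?U" using LeastI[of "\<lambda>k. k \<notin> ?U" k] c[of n] by simp
    moreover have "c n \<le> k" using Least_le[of "\<lambda>k. k \<notin> ?U" k] k c[of n] by simp
    ultimately show ?thesis using k(1) by (metis (mono_tags, lifting) imageI le_trans mem_Collect_eq)
  qed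
  then show ?thesis by blast
qed

text \<open>The selection either stops after finitely many steps, and then \<open>I\<close> is an initial segment and
  everything is covered, or it goes on for ever. In the second case an uncovered \<open>b\<close> was a candidate
  at every step, so that all selected sizes are comparable to that of \<open>b\<close> or larger.\<close>

lemma greedy_selection:
  fixes F :: "'b set" and rad :: "'b \<Rightarrow> real" and cov :: "'b \<Rightarrow> 'b \<Rightarrow> bool"
  assumes rad: "\<forall>b\<in>F. 0 < rad b \<and> rad b < R"
  shows "\<exists>(f::nat \<Rightarrow> 'b) I.
     (\<forall>n\<in>I. f n \<in> F \<and> (\<forall>i<n. i \<in> I \<and> \<not> cov (f i) (f n) \<and> rad (f n) < 4/3 * rad (f i))) \<and>
     (\<forall>b\<in>F. (\<exists>i\<in>I. cov (f i) b) \<or> (I = UNIV \<and> (\<forall>n. rad b < 4/3 * rad (f n))))"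
proof -
  define U where "U S = {b\<in>F. \<forall>s\<in>S. \<not> cov s b}" for S
  have ex: "\<exists>b. b \<in> U S \<and> (\<forall>c\<in>U S. rad c < 4/3 * rad b)" if ne: "U S \<noteq> {}" for S
  proof -
    have UF: "U S \<subseteq> F" unfolding U_def by blast
    have bdd: "bdd_above (rad ` U S)" using rad UF by (intro bdd_aboveI[of _ R]) force
    obtain b0 where b0: "b0 \<in> U S" using ne by blast
    then have "0 < rad b0" using UF rad by blast
    also have "rad b0 \<le> Sup (rad ` U S)" using b0 bdd by (simp add: cSUP_upper)
    finally have pos: "0 < Sup (rad ` U S)" .
    then have "3/4 * Sup (rad ` U S) < Sup (rad ` U S)" by simp
    then obtain b where b: "b \<in> U S" "3/4 * Sup (rad ` U S) < rad b"
      using less_cSUP_iff[OF ne bdd] by blast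
    have "rad c < 4/3 * rad b" if "c \<in> U S" for c
      using cSUP_upper[OF that bdd] b by linarith
    with b show ?thesis by blast
  qed
  define sel where "sel S = (SOME b. b \<in> U S \<and> (\<forall>c\<in>U S. rad c < 4/3 * rad b))" for S
  have sel: "sel S \<in> U S" "\<And>c. c \<in> U S \<Longrightarrow> rad c < 4/3 * rad (sel S)" if "U S \<noteq> {}" for S
    using someI_ex[OF ex[OF that]] unfolding sel_def by auto
  define f where "f \<equiv> wfrec less_than (\<lambda>h n. sel (h ` {..<n}))"
  have cut: "cut h less_than n ` {..<n} = h ` {..<n}" for h :: "nat \<Rightarrow> 'b" and n
    by (intro image_cong) (auto simp: cut_apply)
  have f: "f n = sel (f ` {..<n})" for n
    using def_wfrec[OF f_def wf_less_than, of n] by (simp only: cut)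
  define I where "I = {n. U (f ` {..<n}) \<noteq> {}}"
  have U_anti: "U T \<subseteq> U S" if "S \<subseteq> T" for S T using that unfolding U_def by blast
  have fU: "f n \<in> U (f ` {..<n})" "\<And>c. c \<in> U (f ` {..<n}) \<Longrightarrow> rad c < 4/3 * rad (f n)" if "n \<in> I" for n
    using sel[of "f ` {..<n}"] that f[of n] unfolding I_def by auto
  have I_down: "i \<in> I" if "n \<in> I" "i < n" for i n
    using that U_anti[of "f ` {..<i}" "f ` {..<n}"] unfolding I_def by fastforce
  have A: "f n \<in> F \<and> (\<forall>i<n. i \<in> I \<and> \<not> cov (f i) (f n) \<and> rad (f n) < 4/3 * rad (f i))" if n: "n \<in> I" for n
  proof (intro conjI allI impI)
    show "f n \<in> F" using fU(1)[OF n] unfolding U_def by blast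
    fix i assume i: "i < n"
    show "i \<in> I" using I_down n i by blast
    show "\<not> cov (f i) (f n)" using fU(1)[OF n] i unfolding U_def by blast
    have "f n \<in> U (f ` {..<i})" using fU(1)[OF n] U_anti[of "f ` {..<i}" "f ` {..<n}"] i by force
    then show "rad (f n) < 4/3 * rad (f i)" using fU(2)[OF \<open>i \<in> I\<close>] by blast
  qed
  have B: "(\<exists>i\<in>I. cov (f i) b) \<or> (I = UNIV \<and> (\<forall>n. rad b < 4/3 * rad (f n)))" if b: "b \<in> F" for b
  proof (cases "\<exists>i\<in>I. cov (f i) b")
    case False
    have "n \<in> I \<and> b \<in> U (f ` {..<n})" for n
    proof (induction n rule: less_induct)
      case (less n)
      then have "b \<in> U (f ` {..<n})" using False b unfolding U_def by blast
      then show ?case unfolding I_def by blast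
    qed
    then have "I = UNIV" by blast
    moreover have "rad b < 4/3 * rad (f n)" for n
      using fU(2)[of n b] \<open>\<And>n. n \<in> I \<and> b \<in> U (f ` {..<n})\<close> by blast
    ultimately show ?thesis by blast
  qed blast
  show ?thesis
    by (rule exI[of _ f], rule exI[of _ I]) (intro conjI ballI A B)
qed

section \<open>Directions in infinitesimally Euclidean length spaces\<close>

text \<open>\<open>G a\<close> plays the role of the metric tensor at \<open>a\<close> in the coordinates \<open>\<phi>\<close>. Within distance \<open>s\<close> of \<open>a\<close>
  the distance is compared with the norm of \<open>G a\<close> up to the relative error \<open>C * s\<close>, which vanishes
  as \<open>s\<close> tends to 0.\<close>

locale infinitesimal_chart = length_space X d for X :: "'a set" and d +
  fixes \<phi> :: "'a \<Rightarrow> 'e::euclidean_space" and G :: "'a \<Rightarrow> 'e \<Rightarrow> 'e \<Rightarrow> real"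
    and p0 :: 'a and \<rho> C lam Lam :: real
  assumes pos: "0 < \<rho>" "0 < C" "0 < lam" "0 < Lam"
    and inner: "a \<in> mball p0 \<rho> \<Longrightarrow> inner_form (G a)"
    and lower: "a \<in> mball p0 \<rho> \<Longrightarrow> lam * norm v \<le> form_norm (G a) v"
    and upper: "a \<in> mball p0 \<rho> \<Longrightarrow> form_norm (G a) v \<le> Lam * norm v"
    and close_lower: "\<lbrakk>a \<in> mball p0 \<rho>; 0 < s; s \<le> \<rho>; x \<in> X; y \<in> X; d a x \<le> s; d a y \<le> s\<rbrakk>
       \<Longrightarrow> (1 - C * s) * form_norm (G a) (\<phi> x - \<phi> y) \<le> d x y"
    and close_upper: "\<lbrakk>a \<in> mball p0 \<rho>; 0 < s; s \<le> \<rho>; x \<in> X; y \<in> X; d a x \<le> s; d a y \<le> s\<rbrakk>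
       \<Longrightarrow> d x y \<le> (1 + C * s) * form_norm (G a) (\<phi> x - \<phi> y)"
begin

text \<open>The direction of \<open>p\<close> seen from \<open>a\<close>. It is normalised by the distance, hence a unit vector only
  approximately.\<close>

definition dir :: "'a \<Rightarrow> 'a \<Rightarrow> 'e" where "dir a p = (\<phi> p - \<phi> a) /\<^sub>R d a p"

lemma form_upper:
  assumes "a \<in> mball p0 \<rho>" "0 < s" "s \<le> \<rho>" "C * s \<le> 1/2" "x \<in> X" "y \<in> X" "d a x \<le> s" "d a y \<le> s"
  shows "form_norm (G a) (\<phi> x - \<phi> y) \<le> (1 + 2 * C * s) * d x y"
proof -
  let ?n = "form_norm (G a) (\<phi> x - \<phi> y)"
  have n0: "0 \<le> ?n" using inner[OF assms(1)] by (rule form_norm_nonneg)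
  have "?n * 1 \<le> ?n * ((1 + 2 * (C * s)) * (1 - C * s))"
  proof (rule mult_left_mono[OF _ n0])
    have "(C * s) * (C * s) \<le> (C * s) * (1/2)" using assms pos by (intro mult_left_mono) auto
    then show "1 \<le> (1 + 2 * (C * s)) * (1 - C * s)" by (simp add: algebra_simps)
  qed
  also have "\<dots> = (1 + 2 * (C * s)) * ((1 - C * s) * ?n)" by (simp add: algebra_simps)
  also have "\<dots> \<le> (1 + 2 * (C * s)) * d x y"
    using close_lower[of a s x y] assms pos by (intro mult_left_mono) auto
  finally show ?thesis by (simp add: mult.assoc)
qed

text \<open>Let \<open>A\<close>, \<open>B\<close> be the coordinates of \<open>p\<close> and of an approximate midpoint \<open>q\<close> relative to \<open>a\<close>. Up to
  relative errors of order \<open>u = C * L\<close>, the vector \<open>A\<close> has norm at least \<open>L\<close>, while \<open>B\<close> and \<open>B - A\<close> have norm at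
  most \<open>L / 2\<close>. The parallelogram identity then forces \<open>2 B - A\<close> to have squared norm \<open>O(u) L\<^sup>2\<close>.\<close>

lemma halving:
  assumes a: "a \<in> mball p0 \<rho>" and p: "p \<in> X"
    and L: "d a p = L" "0 < L" "L \<le> \<rho>" "C * L \<le> 1/16" and e: "0 < e"
  shows "\<exists>q\<in>X. 7/16 * L \<le> d a q \<and> d a q \<le> 9/16 * L \<and> d q p \<le> L - d a q + e
     \<and> form_norm (G a) (dir a p - dir a q) \<le> 5 * sqrt (C * L)"
proof -
  let ?n = "form_norm (G a)"
  have aX: "a \<in> X" using a by simp
  note g = inner[OF a]
  (* an error of order C * L^2 in the midpoint is no worse than the metric distortion at scale L *)
  define e' where "e' = min (e/2) (C * L\<^sup>2)"
  have e': "0 < e'" "2 * e' \<le> e" "e' \<le> C * L\<^sup>2"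
    using e pos L unfolding e'_def by (auto simp: min_def)
  have CL2: "C * L\<^sup>2 \<le> L / 16"
    using L mult_right_mono[of "C * L" "1/16" L] by (simp add: power2_eq_square algebra_simps)
  obtain q where q: "q \<in> X" "d a q \<le> L/2 + e'" "d q p \<le> L/2 + e'"
    using between[of a p "L/2" e'] aX p e' L by auto
  have tri: "L \<le> d a q + d q p" using triangle[of a q p] aX p q L by simp
  define A where "A = \<phi> p - \<phi> a"
  define B where "B = \<phi> q - \<phi> a"
  define u where "u = C * L"
  have u: "0 < u" "u \<le> 1/16" using pos L unfolding u_def by auto
  have CLu: "C * L\<^sup>2 = u * L" unfolding u_def by (simp add: power2_eq_square)
  have nA: "(1 - u) * L \<le> ?n A"
  proof -
    have "L \<le> (1 + u) * ?n A"
      using close_upper[of a L p a] a p aX L unfolding A_def u_def by (simp add: commute)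
    then have "(1 - u) * L \<le> (1 - u) * ((1 + u) * ?n A)" using u by (intro mult_left_mono) auto
    also have "\<dots> = (1 - u\<^sup>2) * ?n A" by (simp add: algebra_simps power2_eq_square)
    also have "\<dots> \<le> ?n A" using form_norm_nonneg[OF g, of A] by (simp add: algebra_simps)
    finally show ?thesis .
  qed
  have half: "L/2 + e' \<le> (1 + 2*u) * (L/2)" using e' CLu by (simp add: algebra_simps)
  have nB: "?n B \<le> (1 + 2*u) * d a q"
    using form_upper[of a L q a] a aX q L e' CL2 unfolding B_def u_def by (simp add: commute mult.assoc)
  have nB': "?n B \<le> (1 + 2*u)\<^sup>2 * (L/2)"
    using order_trans[OF nB mult_left_mono[OF order_trans[OF q(2) half], of "1 + 2*u"]] u
    unfolding power2_eq_square mult.assoc by linarith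
  have "?n (B - A) \<le> (1 + 2*u) * d q p"
    using form_upper[of a L q p] a p aX q L e' CL2 unfolding B_def A_def u_def
    by (simp add: commute mult.assoc)
  from order_trans[OF this mult_left_mono[OF order_trans[OF q(3) half], of "1 + 2*u"]]
  have nBA: "?n (B - A) \<le> (1 + 2*u)\<^sup>2 * (L/2)"
    using u unfolding power2_eq_square mult.assoc by linarith
  have "(?n (2 *\<^sub>R B - A))\<^sup>2 = 2 * (?n B)\<^sup>2 + 2 * (?n (B - A))\<^sup>2 - (?n A)\<^sup>2"
    by (rule form_parallelogram[OF g])
  also have "\<dots> \<le> 2 * ((1 + 2*u)\<^sup>2 * (L/2))\<^sup>2 + 2 * ((1 + 2*u)\<^sup>2 * (L/2))\<^sup>2 - ((1 - u) * L)\<^sup>2"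
    using nA nB' nBA u L form_norm_nonneg[OF g] by (intro add_mono diff_mono mult_left_mono power_mono) auto
  also have "\<dots> = L\<^sup>2 * ((1 + 2*u)^4 - (1 - u)\<^sup>2)" by (simp add: power2_eq_square power4_eq_xxxx algebra_simps)
  also have "\<dots> \<le> L\<^sup>2 * (16 * u)"
  proof (rule mult_left_mono)
    have u2: "u^2 \<le> u/16"
      using mult_left_mono[OF u(2), of u] u unfolding power2_eq_square by linarith
    then have "u^2 \<le> 1/16" using u by linarith
    from mult_left_mono[OF this, of u] have u3: "u^3 \<le> u/16"
      using u unfolding power2_eq_square power3_eq_cube by linarith
    then have "u^3 \<le> 1/16" using u by linarith
    from mult_left_mono[OF this, of u] have u4: "u^4 \<le> u/16"
      using u unfolding power3_eq_cube power4_eq_xxxx mult.assoc by linarith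
    have "(1 + 2*u)^4 - (1 - u)\<^sup>2 = 10*u + 23*u^2 + 32*u^3 + 16*u^4"
      by (simp add: power2_eq_square power3_eq_cube power4_eq_xxxx algebra_simps)
    then show "(1 + 2*u)^4 - (1 - u)\<^sup>2 \<le> 16 * u" using u2 u3 u4 u by linarith
  qed simp
  also have "\<dots> = (4 * sqrt u * L)\<^sup>2" using u by (simp add: power_mult_distrib)
  finally have "?n (2 *\<^sub>R B - A) \<le> 4 * sqrt u * L"
    by (rule power2_le_imp_le) (use u L in auto)
  moreover have "?n ((2 *\<^sub>R B - A) /\<^sub>R L) = ?n (2 *\<^sub>R B - A) / L"
    unfolding form_norm_scale[OF g] using L(2) by (simp add: divide_inverse)
  ultimately have n1: "?n ((2 *\<^sub>R B - A) /\<^sub>R L) \<le> 4 * sqrt u"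
    by (simp only: pos_divide_le_eq[OF L(2)])
  have daq: "7/16 * L \<le> d a q" "d a q \<le> 9/16 * L" using tri q e' CL2 by auto
  define s where "s = d a q"
  have s: "7/16 * L \<le> s" "s \<le> 9/16 * L" "0 < s" using daq L unfolding s_def by auto
  have "\<bar>1/s - 2/L\<bar> = \<bar>L - 2 * s\<bar> / (s * L)" using s L by (simp add: field_simps abs_divide)
  also have "\<dots> \<le> (2 * (u * L)) / (s * L)"
    using q(2) tri q(3) e' CLu s L unfolding s_def[symmetric] by (intro divide_right_mono) (auto simp: abs_le_iff)
  also have "\<dots> = 2 * u / s" using L by simp
  finally have inv: "\<bar>1/s - 2/L\<bar> \<le> 2 * u / s" .
  have "?n ((1/s - 2/L) *\<^sub>R B) \<le> (2 * u / s) * ((1 + 2*u) * s)"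
    unfolding form_norm_scale[OF g] using inv nB s u form_norm_nonneg[OF g, of B] unfolding s_def[symmetric]
    by (intro mult_mono) auto
  also have "\<dots> = 2 * u * (1 + 2*u)" using s by simp
  also have "\<dots> \<le> sqrt u"
  proof -
    have "sqrt u \<le> 1/4" using u real_sqrt_le_mono[of u "1/16"] by (simp add: real_sqrt_divide)
    then have "sqrt u * sqrt u \<le> 1/4 * sqrt u" using u by (intro mult_right_mono) auto
    then have "4 * u \<le> sqrt u" using u by simp
    moreover have "2 * u * (1 + 2 * u) \<le> 2 * u * 2" using u by (intro mult_left_mono) auto
    ultimately show ?thesis by linarith
  qed
  finally have n2: "?n ((1/s - 2/L) *\<^sub>R B) \<le> sqrt u" .
  have "dir a q - dir a p = (1/s - 2/L) *\<^sub>R B + (2 *\<^sub>R B - A) /\<^sub>R L"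
    unfolding dir_def A_def[symmetric] B_def[symmetric] s_def[symmetric] L(1)
    by (simp add: algebra_simps divide_inverse)
  then have "?n (dir a q - dir a p) \<le> 5 * sqrt u"
    using form_norm_triangle[OF g, of "(1/s - 2/L) *\<^sub>R B" "(2 *\<^sub>R B - A) /\<^sub>R L"] n1 n2 by simp
  then have "?n (dir a p - dir a q) \<le> 5 * sqrt (C * L)"
    unfolding u_def form_norm_minus_commute[OF g, of "dir a p"] .
  moreover have "d q p \<le> L - d a q + e" using q e' by linarith
  ultimately show ?thesis using daq q(1) by blast
qed

text \<open>Repeated halving from \<open>p\<close> down to the scale \<open>t\<close>. Every step replaces \<open>d a p\<close> by at most \<open>9/16\<close> of it,
  so the turning angle \<open>5 * sqrt (C * L)\<close> shrinks by the factor \<open>3/4\<close> and the angles sum to at most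
  \<open>5 / (1 - 3/4) = 20\<close> times \<open>sqrt (C * L)\<close>. The walk stops below \<open>4 * t\<close> because from there a further step
  could end below \<open>t\<close>.\<close>

lemma descend:
  assumes a: "a \<in> mball p0 \<rho>" and t: "0 < t"
  shows "\<lbrakk>p \<in> X; t \<le> d a p; d a p \<le> 4 * t * (16/9)^k; d a p \<le> \<rho>; C * d a p \<le> 1/16; 0 < e\<rbrakk>
    \<Longrightarrow> \<exists>z\<in>X. t \<le> d a z \<and> d a z \<le> 4 * t \<and> d z p \<le> d a p - d a z + e
     \<and> form_norm (G a) (dir a p - dir a z) \<le> 20 * sqrt (C * d a p)"
proof (induction k arbitrary: p e)
  note g = inner[OF a]
  have n0: "form_norm (G a) 0 = 0" using form_norm_scale[OF g, of 0 0] by simp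
  have base: "\<exists>z\<in>X. t \<le> d a z \<and> d a z \<le> 4 * t \<and> d z p \<le> d a p - d a z + e
     \<and> form_norm (G a) (dir a p - dir a z) \<le> 20 * sqrt (C * d a p)"
    if "p \<in> X" "t \<le> d a p" "d a p \<le> 4 * t" "0 < e" for p e
    using that t pos n0 by (intro bexI[of _ p]) auto
  {
    case 0
    then show ?case using base by simp
  next
    case (Suc k)
    show ?case
    proof (cases "d a p \<le> 4 * t")
      case True
      with Suc.prems base show ?thesis by blast
    next
      case False
      define L where "L = d a p"
      have L: "0 < L" "4 * t < L" using False t unfolding L_def by auto
      obtain q where q: "q \<in> X" "7/16 * L \<le> d a q" "d a q \<le> 9/16 * L" "d q p \<le> L - d a q + e/2"
        "form_norm (G a) (dir a p - dir a q) \<le> 5 * sqrt (C * L)"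
        using halving[of a p L "e/2"] a Suc.prems L unfolding L_def by auto
      have "C * d a q \<le> C * L" using q L pos by (intro mult_left_mono) auto
      then have CL: "C * d a q \<le> 1/16" using Suc.prems unfolding L_def by linarith
      have "d a q \<le> 9/16 * (4 * t * (16/9)^Suc k)" using q(3) Suc.prems(3) unfolding L_def by linarith
      then have "d a q \<le> 4 * t * (16/9)^k" by simp
      then obtain z where z: "z \<in> X" "t \<le> d a z" "d a z \<le> 4 * t" "d z q \<le> d a q - d a z + e/2"
        "form_norm (G a) (dir a q - dir a z) \<le> 20 * sqrt (C * d a q)"
        using Suc.IH[of q "e/2"] q L Suc.prems CL unfolding L_def[symmetric] by auto
      have "sqrt (C * d a q) \<le> sqrt (C * L * (9/16))"
        using q pos by (intro real_sqrt_le_mono) (simp add: mult.assoc)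
      also have "\<dots> = 3/4 * sqrt (C * L)"
        unfolding real_sqrt_mult[of "C * L"] by (simp add: real_sqrt_divide)
      finally have "form_norm (G a) (dir a p - dir a z) \<le> 20 * sqrt (C * L)"
        using form_norm_triangle_diff[OF g, of "dir a p" "dir a z" "dir a q"] q(5) z(5) by linarith
      moreover have "d z p \<le> L - d a z + e"
        using triangle[of z q p] z q Suc.prems(1) by auto
      ultimately show ?thesis using z unfolding L_def by blast
    qed
  }
qed

text \<open>The walk from \<open>p\<close> towards \<open>a\<close> passes a point \<open>z\<close> at a distance \<open>s\<close> from \<open>a\<close> comparable to \<open>d a q\<close>. There
  \<open>z\<close> and \<open>q\<close> lie almost on one ray, so \<open>d z q\<close> is at most \<open>s - d a q\<close> plus a small multiple of \<open>d a q\<close>, and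
  \<open>d p z\<close> is almost \<open>d a p - s\<close>.\<close>

lemma directional:
  "\<exists>\<delta>>0. \<exists>\<eta>>0. \<forall>a\<in>mball p0 \<rho>. \<forall>p\<in>X. \<forall>q\<in>X.
     0 < d a q \<and> d a q \<le> d a p \<and> d a p < \<delta> \<and> norm (dir a p - dir a q) < \<eta>
     \<longrightarrow> d p q \<le> d a p - 2/3 * d a q"
proof -
  (* 102400 = 320^2, which makes the total turning angle 20 * sqrt (C * \<delta>) at most 1/16 *)
  define \<delta> where "\<delta> = min (\<rho>/4) (1 / (102400 * C))"
  define \<eta> where "\<eta> = 1 / (16 * Lam)"
  have \<delta>: "0 < \<delta>" "4 * \<delta> \<le> \<rho>" "C * \<delta> \<le> 1/102400"
    using pos unfolding \<delta>_def by (auto simp: min_def field_simps)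
  have \<eta>: "0 < \<eta>" "Lam * \<eta> = 1/16" using pos unfolding \<eta>_def by auto
  have "d p q \<le> d a p - 2/3 * d a q"
    if a: "a \<in> mball p0 \<rho>" and p: "p \<in> X" and q: "q \<in> X" and t: "0 < d a q" "d a q \<le> d a p" "d a p < \<delta>"
      and dirs: "norm (dir a p - dir a q) < \<eta>" for a p q
  proof -
    note g = inner[OF a]
    let ?n = "form_norm (G a)"
    have aX: "a \<in> X" using a by simp
    define t where "t = d a q"
    define L where "L = d a p"
    have tL: "0 < t" "t \<le> L" "L < \<delta>" using t unfolding t_def L_def by auto
    have CL: "C * L \<le> 1/102400" using \<delta>(3) tL pos mult_left_mono[of L \<delta> C] by linarith
    have Ct: "C * t \<le> 1/102400" using CL tL pos mult_left_mono[of t L C] by linarith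
    obtain k where "L / (4 * t) < (16/9::real)^k"
      using real_arch_pow[of "16/9" "L / (4 * t)"] by auto
    then have "L \<le> 4 * t * (16/9)^k" using tL by (simp add: field_simps)
    then obtain z where z: "z \<in> X" "t \<le> d a z" "d a z \<le> 4 * t" "d z p \<le> L - d a z + t/12"
      "?n (dir a p - dir a z) \<le> 20 * sqrt (C * L)"
      using descend[OF a tL(1) p, of k "t/12"] tL CL \<delta> unfolding L_def by auto
    define s where "s = d a z"
    have s: "t \<le> s" "s \<le> 4 * t" using z unfolding s_def by auto
    have "sqrt (C * L) \<le> 1/320"
      using real_sqrt_le_mono[OF CL] by (simp add: real_sqrt_divide)
    then have n1: "?n (dir a z - dir a p) \<le> 1/16"
      using z(5) form_norm_minus_commute[OF g, of "dir a p" "dir a z"] by linarith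
    have "?n (dir a p - dir a q) \<le> Lam * \<eta>"
      using upper[OF a, of "dir a p - dir a q"] dirs pos mult_left_mono[of "norm (dir a p - dir a q)" \<eta> Lam] by linarith
    then have n2: "?n (dir a z - dir a q) \<le> 1/8"
      using n1 \<eta> form_norm_triangle_diff[OF g, of "dir a z" "dir a q" "dir a p"] by linarith
    have s4: "0 < 4 * t" "4 * t \<le> \<rho>" "C * (4 * t) \<le> 1/2" using tL \<delta> Ct by auto
    have "?n (\<phi> z - \<phi> a) \<le> (1 + 2 * C * (4 * t)) * d z a"
      by (rule form_upper[OF a s4 z(1) aX]) (use s tL in \<open>auto simp: s_def aX\<close>)
    also have "\<dots> \<le> (101/100) * s"
      unfolding s_def commute[of z a] using Ct by (intro mult_right_mono) auto
    finally have "?n (\<phi> z - \<phi> a) \<le> (101/100) * s" .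
    moreover have "?n (dir a z) = ?n (\<phi> z - \<phi> a) / s"
      unfolding dir_def s_def[symmetric] form_norm_scale[OF g] using s tL by (simp add: divide_inverse)
    moreover have "0 < s" using s tL by linarith
    ultimately have "?n (dir a z) \<le> 101/100"
      by (simp add: pos_divide_le_eq)
    then have n3: "?n ((s - t) *\<^sub>R dir a z) \<le> (s - t) * (101/100)"
      unfolding form_norm_scale[OF g] using s mult_left_mono[of "?n (dir a z)" "101/100" "s - t"] by simp
    have n4: "?n (t *\<^sub>R (dir a z - dir a q)) \<le> t * (1/8)"
      using n2 tL by (simp add: form_norm_scale[OF g])
    have "\<phi> z - \<phi> q = (s - t) *\<^sub>R dir a z + t *\<^sub>R (dir a z - dir a q)"
    proof -
      have "s *\<^sub>R dir a z = \<phi> z - \<phi> a" "t *\<^sub>R dir a q = \<phi> q - \<phi> a"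
        using s tL unfolding dir_def s_def[symmetric] t_def[symmetric] by auto
      moreover have "(s - t) *\<^sub>R dir a z + t *\<^sub>R (dir a z - dir a q) = s *\<^sub>R dir a z - t *\<^sub>R dir a q"
        by (simp add: algebra_simps)
      ultimately show ?thesis by simp
    qed
    then have "?n (\<phi> z - \<phi> q) \<le> ?n ((s - t) *\<^sub>R dir a z) + ?n (t *\<^sub>R (dir a z - dir a q))"
      by (simp only: form_norm_triangle[OF g])
    then have n5: "?n (\<phi> z - \<phi> q) \<le> (s - t) * (101/100) + t/8"
      using n3 n4 by linarith
    have "d z q \<le> (1 + C * (4 * t)) * ?n (\<phi> z - \<phi> q)"
      by (rule close_upper[OF a s4(1,2) z(1) q]) (use s tL in \<open>auto simp: s_def t_def\<close>)
    also have "\<dots> \<le> (101/100) * ((s - t) * (101/100) + t/8)"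
      using n5 Ct form_norm_nonneg[OF g] by (intro mult_mono) auto
    also have "\<dots> = 10201/10000 * s - 17877/20000 * t"
      by (simp add: field_simps)
    finally have "d z q \<le> 10201/10000 * s - 17877/20000 * t" .
    moreover have "d p q \<le> d z p + d z q"
      using triangle[OF p z(1) q] by (simp add: commute[of p z])
    moreover have "d z p \<le> L - s + t/12" using z(4) unfolding s_def .
    ultimately show ?thesis
      using s tL unfolding t_def[symmetric] L_def[symmetric] by linarith
  qed
  then show ?thesis using \<delta>(1) \<eta>(1) by blast
qed

end

section \<open>The covering theorem in length spaces\<close>

context length_space
begin

text \<open>The conclusion of the covering theorem, with the set \<open>A\<close> to be covered independent of the balls
  used, so that covers of different pieces can be put together.\<close>

definition coverable :: "('a \<times> real) set \<Rightarrow> 'a set \<Rightarrow> bool" where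
  "coverable F A \<longleftrightarrow> (\<exists>(N::nat)\<ge>1. \<exists>G :: nat \<Rightarrow> ('a \<times> real) set.
     (\<forall>j\<in>{1..N}. G j \<subseteq> F \<and> countable (G j) \<and> disjoint_family_on (\<lambda>(x, r). mball x r) (G j)) \<and>
     A \<subseteq> (\<Union>j\<in>{1..N}. \<Union>(x, r)\<in>G j. mball x r))"

lemma coverable_mono: "\<lbrakk>coverable F A; F \<subseteq> F'; A' \<subseteq> A\<rbrakk> \<Longrightarrow> coverable F' A'"
  unfolding coverable_def by (meson subset_trans)

lemma coverable_mball:
  assumes "(x, r) \<in> F"
  shows "coverable F (mball x r)"
  unfolding coverable_def using assms
  by (intro exI[of _ 1] conjI exI[of _ "\<lambda>_. {(x, r)}"]) (auto simp: disjoint_family_on_def)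

lemma coverable_Un:
  assumes "coverable F A" "coverable F B"
  shows "coverable F (A \<union> B)"
proof -
  obtain N G where N: "(N::nat) \<ge> 1"
    and G: "\<forall>j\<in>{1..N}. G j \<subseteq> F \<and> countable (G j) \<and> disjoint_family_on (\<lambda>(x, r). mball x r) (G j)"
    and A: "A \<subseteq> (\<Union>j\<in>{1..N}. \<Union>(x, r)\<in>G j. mball x r)"
    using assms(1) unfolding coverable_def by blast
  obtain N' G' where N': "(N'::nat) \<ge> 1"
    and G': "\<forall>j\<in>{1..N'}. G' j \<subseteq> F \<and> countable (G' j) \<and> disjoint_family_on (\<lambda>(x, r). mball x r) (G' j)"
    and B: "B \<subseteq> (\<Union>j\<in>{1..N'}. \<Union>(x, r)\<in>G' j. mball x r)"
    using assms(2) unfolding coverable_def by blast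
  define H where "H j = (if j \<le> N then G j else G' (j - N))" for j
  have "A \<subseteq> (\<Union>j\<in>{1..N+N'}. \<Union>(x, r)\<in>H j. mball x r)"
  proof
    fix a assume "a \<in> A"
    then obtain j b where "j \<in> {1..N}" "b \<in> G j" "a \<in> (case b of (x, r) \<Rightarrow> mball x r)" using A by blast
    then have "j \<in> {1..N+N'}" "b \<in> H j" "a \<in> (case b of (x, r) \<Rightarrow> mball x r)" unfolding H_def by auto
    then show "a \<in> (\<Union>j\<in>{1..N+N'}. \<Union>(x, r)\<in>H j. mball x r)" by blast
  qed
  moreover have "B \<subseteq> (\<Union>j\<in>{1..N+N'}. \<Union>(x, r)\<in>H j. mball x r)"
  proof
    fix a assume "a \<in> B"
    then obtain j b where "j \<in> {1..N'}" "b \<in> G' j" "a \<in> (case b of (x, r) \<Rightarrow> mball x r)" using B by blast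
    then have "N + j \<in> {1..N+N'}" "b \<in> H (N + j)" "a \<in> (case b of (x, r) \<Rightarrow> mball x r)" unfolding H_def by auto
    then show "a \<in> (\<Union>j\<in>{1..N+N'}. \<Union>(x, r)\<in>H j. mball x r)" by blast
  qed
  moreover have "H j \<subseteq> F \<and> countable (H j) \<and> disjoint_family_on (\<lambda>(x, r). mball x r) (H j)"
    if "j \<in> {1..N+N'}" for j
  proof (cases "j \<le> N")
    case True
    then have "H j = G j" "j \<in> {1..N}" using that unfolding H_def by auto
    then show ?thesis using G by presburger
  next
    case False
    then have "H j = G' (j - N)" "j - N \<in> {1..N'}" using that unfolding H_def by auto
    then show ?thesis using G' by presburger
  qed
  ultimately show ?thesis
    unfolding coverable_def using N by (intro exI[of _ "N + N'"] conjI exI[of _ H]) auto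
qed

lemma coverable_UN:
  assumes "finite K" "\<And>k. k \<in> K \<Longrightarrow> coverable F (A k)"
  shows "coverable F (\<Union>k\<in>K. A k)"
  using assms
proof (induction K rule: finite_induct)
  case empty
  show ?case unfolding coverable_def by (intro exI[of _ 1] conjI exI[of _ "\<lambda>_. {}"]) (auto simp: disjoint_family_on_def)
qed (simp add: coverable_Un)

end

context infinitesimal_chart
begin

text \<open>The index order is that of the greedy selection: centres avoid the earlier balls, and later radii
  are at most \<open>4/3\<close> of earlier ones. For two large balls \<open>i < j\<close> whose centres are seen from \<open>a = x n\<close> in
  nearby directions, the directional estimate is contradictory in either order of their distances.
  If \<open>x i\<close> is farther, then \<open>d (x i) (x j) < r i + \<epsilon> - 2/3 * r j < r i\<close>; if \<open>x j\<close> is farther, then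
  \<open>d (x i) (x j) < r j + \<epsilon> - 2/3 * r i < (4/3 + 1/6 - 2/3) * r i < r i\<close>. Both say that \<open>x j\<close> lies in the
  earlier ball around \<open>x i\<close>.\<close>

lemma overlap_bound:
  obtains \<delta> :: real and N :: nat where "0 < \<delta>"
    "\<And>(x::nat \<Rightarrow> 'a) (r::nat \<Rightarrow> real) J n.
     \<lbrakk>\<forall>i\<in>J. i < n \<and> d (x i) (x n) < r i + r n;
     \<forall>i\<in>insert n J. x i \<in> mball p0 \<rho> \<and> 0 < r i \<and> r i < \<delta>;
     \<forall>i\<in>insert n J. \<forall>j\<in>insert n J. i < j \<longrightarrow> r i \<le> d (x i) (x j) \<and> r j < 4/3 * r i\<rbrakk>
     \<Longrightarrow> card J \<le> N"
proof -
  obtain \<delta>0 \<eta> where \<delta>0: "0 < \<delta>0" and \<eta>: "0 < \<eta>" and directional':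
    "\<And>a p q. \<lbrakk>a \<in> mball p0 \<rho>; p \<in> X; q \<in> X; 0 < d a q; d a q \<le> d a p; d a p < \<delta>0; norm (dir a p - dir a q) < \<eta>\<rbrakk>
       \<Longrightarrow> d p q \<le> d a p - 2/3 * d a q"
    using directional by blast
  define \<delta> where "\<delta> = min (\<delta>0 / 2) (min (\<rho> / 7) (1 / (14 * C)))"
  have \<delta>: "0 < \<delta>" "2 * \<delta> \<le> \<delta>0" "7 * \<delta> \<le> \<rho>" "C * (7 * \<delta>) \<le> 1/2"
  proof -
    show "0 < \<delta>" using pos \<delta>0 unfolding \<delta>_def by simp
    show "2 * \<delta> \<le> \<delta>0" "7 * \<delta> \<le> \<rho>" unfolding \<delta>_def by linarith+
    have "\<delta> \<le> 1 / (14 * C)" unfolding \<delta>_def by simp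
    then show "C * (7 * \<delta>) \<le> 1/2" using pos by (simp add: field_simps)
  qed
  have sep_pos: "0 < 1 / (2 * Lam)" using pos by simp
  obtain N1 where N1: "\<forall>J (v::nat \<Rightarrow> 'e). finite J \<and> (\<forall>i\<in>J. norm (v i) \<le> 14 / lam) \<and>
      (\<forall>i\<in>J. \<forall>j\<in>J. i < j \<longrightarrow> 1 / (2 * Lam) \<le> norm (v i - v j)) \<longrightarrow> card J \<le> N1"
    using packing_bound[OF sep_pos, of "14 / lam"] by (rule exE)
  obtain N2 where N2: "\<forall>J (v::nat \<Rightarrow> 'e). finite J \<and> (\<forall>i\<in>J. norm (v i) \<le> 2 / lam) \<and>
      (\<forall>i\<in>J. \<forall>j\<in>J. i < j \<longrightarrow> \<eta> \<le> norm (v i - v j)) \<longrightarrow> card J \<le> N2"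
    using packing_bound[OF \<eta>, of "2 / lam"] by (rule exE)
  have "card J \<le> N1 + N2"
    if J: "\<forall>i\<in>J. i < n \<and> d (x i) (x n) < r i + r n"
      and x: "\<forall>i\<in>insert n J. x i \<in> mball p0 \<rho> \<and> 0 < r i \<and> r i < \<delta>"
      and sep: "\<forall>i\<in>insert n J. \<forall>j\<in>insert n J. i < j \<longrightarrow> r i \<le> d (x i) (x j) \<and> r j < 4/3 * r i"
    for x :: "nat \<Rightarrow> 'a" and r n J
  proof -
    define a where "a = x n"
    define \<epsilon> where "\<epsilon> = r n"
    have a: "a \<in> mball p0 \<rho>" and aX: "a \<in> X" and \<epsilon>: "0 < \<epsilon>" "\<epsilon> < \<delta>"
      using x unfolding a_def \<epsilon>_def by auto
    note g = inner[OF a]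
    have fin: "finite J" using J by (meson finite_nat_set_iff_bounded)
    have xX: "x i \<in> X" if "i \<in> J" for i using x that by auto
    have r: "0 < r i" "r i < \<delta>" if "i \<in> J" for i using x that by auto
    have da: "d a (x i) < r i + \<epsilon>" "r i \<le> d a (x i)" "\<epsilon> < 4/3 * r i" if "i \<in> J" for i
    proof -
      have "i < n" "d (x i) (x n) < r i + r n" using J that by auto
      moreover have "r i \<le> d (x i) (x n)" "r n < 4/3 * r i" using sep that \<open>i < n\<close> by auto
      ultimately show "d a (x i) < r i + \<epsilon>" "r i \<le> d a (x i)" "\<epsilon> < 4/3 * r i"
        unfolding a_def \<epsilon>_def commute[of "x n"] by auto
    qed
    have sep': "r i \<le> d (x i) (x j)" "r j < 4/3 * r i" if "i \<in> J" "j \<in> J" "i < j" for i j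
      using sep that by auto
    define J1 where "J1 = {i\<in>J. r i \<le> 6 * \<epsilon>}"
    define J2 where "J2 = {i\<in>J. 6 * \<epsilon> < r i}"
    have norm_bound: "lam * norm (\<phi> (x i) - \<phi> a) \<le> 2 * d a (x i)"
      if i: "i \<in> J" and s: "0 < s" "s \<le> 7 * \<delta>" "d a (x i) \<le> s" for i s
    proof -
      have "C * s \<le> C * (7 * \<delta>)" using s pos by (intro mult_left_mono) auto
      then have Cs: "C * s \<le> 1/2" using \<delta> by linarith
      have "lam * norm (\<phi> (x i) - \<phi> a) \<le> form_norm (G a) (\<phi> (x i) - \<phi> a)" by (rule lower[OF a])
      also have "\<dots> \<le> (1 + 2 * C * s) * d (x i) a"
        using form_upper[OF a s(1) _ Cs xX[OF i] aX s(3)] s \<delta> aX by simp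
      also have "\<dots> \<le> 2 * d (x i) a" using Cs by (intro mult_right_mono) auto
      finally show ?thesis by (simp add: commute)
    qed
    have "card J1 \<le> N1"
    proof (rule N1[THEN spec, THEN spec[of _ "\<lambda>i. (\<phi> (x i) - \<phi> a) /\<^sub>R \<epsilon>"], THEN mp], intro conjI)
      show "finite J1" using fin unfolding J1_def by simp
      have s: "0 < 7 * \<epsilon>" "7 * \<epsilon> \<le> 7 * \<delta>" using \<epsilon> by auto
      have C7: "C * (7 * \<epsilon>) \<le> 1/2" using mult_left_mono[OF s(2), of C] pos \<delta> by linarith
      have d7: "d a (x i) \<le> 7 * \<epsilon>" if "i \<in> J1" for i using da[of i] that unfolding J1_def by auto
      show "\<forall>i\<in>J1. norm ((\<phi> (x i) - \<phi> a) /\<^sub>R \<epsilon>) \<le> 14 / lam"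
      proof
        fix i assume i: "i \<in> J1"
        then have "lam * norm (\<phi> (x i) - \<phi> a) \<le> 14 * \<epsilon>"
          using norm_bound[of i "7 * \<epsilon>"] s d7[OF i] unfolding J1_def by auto
        then show "norm ((\<phi> (x i) - \<phi> a) /\<^sub>R \<epsilon>) \<le> 14 / lam"
          using pos(3) \<epsilon>(1) unfolding norm_scaleR by (simp add: field_simps)
      qed
      show "\<forall>i\<in>J1. \<forall>j\<in>J1. i < j \<longrightarrow> 1 / (2 * Lam) \<le> norm ((\<phi> (x i) - \<phi> a) /\<^sub>R \<epsilon> - (\<phi> (x j) - \<phi> a) /\<^sub>R \<epsilon>)"
      proof (intro ballI impI)
        fix i j assume ij: "i \<in> J1" "j \<in> J1" "i < j"
        then have ijJ: "i \<in> J" "j \<in> J" unfolding J1_def by auto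
        let ?v = "\<phi> (x i) - \<phi> (x j)"
        have "3/4 * \<epsilon> \<le> r i" using da[OF ijJ(1)] by linarith
        also have "r i \<le> d (x i) (x j)" using sep' ij ijJ by auto
        also have "\<dots> \<le> (1 + C * (7 * \<epsilon>)) * form_norm (G a) ?v"
          using close_upper[OF a s(1) _ xX[OF ijJ(1)] xX[OF ijJ(2)] d7[OF ij(1)] d7[OF ij(2)]] s \<delta> by linarith
        also have "\<dots> \<le> (3/2) * (Lam * norm ?v)"
          using C7 upper[OF a, of ?v] form_norm_nonneg[OF g] by (intro mult_mono) auto
        finally have "\<epsilon> \<le> 2 * Lam * norm ?v" by simp
        moreover have "norm ((\<phi> (x i) - \<phi> a) /\<^sub>R \<epsilon> - (\<phi> (x j) - \<phi> a) /\<^sub>R \<epsilon>) = norm ?v / \<epsilon>"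
          using \<epsilon> by (simp add: divide_inverse flip: scaleR_diff_right)
        ultimately show "1 / (2 * Lam) \<le> norm ((\<phi> (x i) - \<phi> a) /\<^sub>R \<epsilon> - (\<phi> (x j) - \<phi> a) /\<^sub>R \<epsilon>)"
          using \<epsilon>(1) pos(4) by (simp only:) (simp add: field_simps)
      qed
    qed
    moreover have "card J2 \<le> N2"
    proof (rule N2[THEN spec, THEN spec[of _ "\<lambda>i. dir a (x i)"], THEN mp], intro conjI)
      show "finite J2" using fin unfolding J2_def by simp
      show "\<forall>i\<in>J2. norm (dir a (x i)) \<le> 2 / lam"
      proof
        fix i assume "i \<in> J2"
        then have i: "i \<in> J" unfolding J2_def by auto
        have "lam * norm (\<phi> (x i) - \<phi> a) \<le> 2 * d a (x i)"
          by (rule norm_bound[OF i, of "2 * \<delta>"]) (use da[OF i] r[OF i] \<epsilon> \<delta> in auto)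
        moreover have "0 < d a (x i)" using da[OF i] r[OF i] by linarith
        moreover have "norm (dir a (x i)) = norm (\<phi> (x i) - \<phi> a) / d a (x i)"
          unfolding dir_def by (simp add: divide_inverse)
        ultimately show "norm (dir a (x i)) \<le> 2 / lam" using pos(3) by (simp only:) (simp add: field_simps)
      qed
      show "\<forall>i\<in>J2. \<forall>j\<in>J2. i < j \<longrightarrow> \<eta> \<le> norm (dir a (x i) - dir a (x j))"
      proof (intro ballI impI)
        fix i j assume ij: "i \<in> J2" "j \<in> J2" "i < j"
        then have ijJ: "i \<in> J" "j \<in> J" and big: "6 * \<epsilon> < r i" "6 * \<epsilon> < r j" unfolding J2_def by auto
        note D = da[OF ijJ(1)] da[OF ijJ(2)] r[OF ijJ(1)] r[OF ijJ(2)] sep'[OF ijJ ij(3)] big \<epsilon> \<delta>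
        show "\<eta> \<le> norm (dir a (x i) - dir a (x j))"
        proof (rule ccontr)
          assume "\<not> ?thesis"
          then have close: "norm (dir a (x i) - dir a (x j)) < \<eta>" by simp
          show False
          proof (cases "d a (x j) \<le> d a (x i)")
            case True
            have "d (x i) (x j) \<le> d a (x i) - 2/3 * d a (x j)"
              by (rule directional'[OF a xX[OF ijJ(1)] xX[OF ijJ(2)] _ True _ close]) (use D in linarith)+
            then show False using D by linarith
          next
            case False
            have close': "norm (dir a (x j) - dir a (x i)) < \<eta>"
              using close by (simp add: norm_minus_commute)
            have "d (x j) (x i) \<le> d a (x j) - 2/3 * d a (x i)"
              by (rule directional'[OF a xX[OF ijJ(2)] xX[OF ijJ(1)] _ _ _ close']) (use D False in linarith)+
            then show False using D commute[of "x j" "x i"] by linarith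
          qed
        qed
      qed
    qed
    moreover have "J = J1 \<union> J2" unfolding J1_def J2_def by auto
    ultimately show ?thesis using card_Un_le[of J1 J2] by simp
  qed
  then show ?thesis by (rule that[OF \<delta>(1)])
qed

text \<open>If the greedy selection does not stop, its centres form a sequence in a totally bounded set, and a
  centre left uncovered would keep them separated by a fixed distance.\<close>

lemma small_balls_coverable:
  "\<exists>\<delta>>0. \<forall>F. (\<forall>(x, r)\<in>F. x \<in> mball p0 \<rho> \<and> 0 < r \<and> r < \<delta>) \<and> mtotally_bounded (fst ` F) \<longrightarrow> coverable F (fst ` F)"
proof (rule overlap_bound)
  fix \<delta> :: real and N :: nat
  assume \<delta>: "0 < \<delta>" and N: "\<And>(x::nat \<Rightarrow> 'a) (r::nat \<Rightarrow> real) J n.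
     \<lbrakk>\<forall>i\<in>J. i < n \<and> d (x i) (x n) < r i + r n;
     \<forall>i\<in>insert n J. x i \<in> mball p0 \<rho> \<and> 0 < r i \<and> r i < \<delta>;
     \<forall>i\<in>insert n J. \<forall>j\<in>insert n J. i < j \<longrightarrow> r i \<le> d (x i) (x j) \<and> r j < 4/3 * r i\<rbrakk>
     \<Longrightarrow> card J \<le> N"
  have "coverable F (fst ` F)"
    if F: "\<forall>(x, r)\<in>F. x \<in> mball p0 \<rho> \<and> 0 < r \<and> r < \<delta>" and tb: "mtotally_bounded (fst ` F)" for F
  proof -
    have FD: "fst b \<in> mball p0 \<rho>" "fst b \<in> X" "0 < snd b" "snd b < \<delta>" if "b \<in> F" for b
      using F that by (auto simp: split_beta)
    have rad: "\<forall>b\<in>F. 0 < snd b \<and> snd b < \<delta>" using FD by blast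
    obtain f :: "nat \<Rightarrow> 'a \<times> real" and I where
      f: "\<forall>n\<in>I. f n \<in> F \<and> (\<forall>i<n. i \<in> I \<and> \<not> d (fst (f i)) (fst (f n)) < snd (f i) \<and> snd (f n) < 4/3 * snd (f i))"
      and cov: "\<forall>b\<in>F. (\<exists>i\<in>I. d (fst (f i)) (fst b) < snd (f i)) \<or> (I = UNIV \<and> (\<forall>n. snd b < 4/3 * snd (f n)))"
      using greedy_selection[OF rad, where cov="\<lambda>b c. d (fst b) (fst c) < snd b"] by (elim exE conjE) simp
    define B where "B = (\<lambda>(x, r). mball x r)"
    have fF: "f n \<in> F" if "n \<in> I" for n using f that by blast
    have sep: "snd (f i) \<le> d (fst (f i)) (fst (f j)) \<and> snd (f j) < 4/3 * snd (f i)" "i \<in> I" if "j \<in> I" "i < j" for i j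
      using f that by force+
    define E where "E i n \<longleftrightarrow> n \<in> I \<and> B (f i) \<inter> B (f n) \<noteq> {}" for i n
    have "card {i. i < n \<and> E i n} \<le> N" for n
    proof (cases "n \<in> I")
      case True
      show ?thesis
      proof (rule N[of _ n "\<lambda>i. fst (f i)" "\<lambda>i. snd (f i)"])
        show "\<forall>i\<in>{i. i < n \<and> E i n}. i < n \<and> d (fst (f i)) (fst (f n)) < snd (f i) + snd (f n)"
        proof safe
          fix i assume i: "i < n" "E i n"
          then obtain z where z: "z \<in> B (f i)" "z \<in> B (f n)" unfolding E_def by blast
          then show "d (fst (f i)) (fst (f n)) < snd (f i) + snd (f n)"
            unfolding B_def using triangle[of "fst (f i)" z "fst (f n)"] by (auto simp: split_beta commute)
        qed
        show "\<forall>i\<in>insert n {i. i < n \<and> E i n}. fst (f i) \<in> mball p0 \<rho> \<and> 0 < snd (f i) \<and> snd (f i) < \<delta>"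
          using FD fF sep(2) True by blast
        show "\<forall>i\<in>insert n {i. i < n \<and> E i n}. \<forall>j\<in>insert n {i. i < n \<and> E i n}. i < j \<longrightarrow>
          snd (f i) \<le> d (fst (f i)) (fst (f j)) \<and> snd (f j) < 4/3 * snd (f i)"
          using sep True by blast
      qed
    qed (simp add: E_def)
    then obtain c where c: "\<And>n. c n \<le> N" "\<And>n i. i < n \<Longrightarrow> E i n \<Longrightarrow> c i \<noteq> c n"
      using greedy_colouring[of E N] by blast
    define G where "G j = f ` {n\<in>I. c n + 1 = j}" for j
    have disj: "disjoint_family_on B (G j)" for j
    proof -
      have "B (f m) \<inter> B (f n) = {}" if "m \<in> I" "n \<in> I" "c m = c n" "m \<noteq> n" for m n
        using that c(2)[of m n] c(2)[of n m] unfolding E_def by (metis Int_commute nat_neq_iff)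
      then have "B (f m) \<inter> B (f n) = {}" if "m \<in> {n\<in>I. c n + 1 = j}" "n \<in> {n\<in>I. c n + 1 = j}" "f m \<noteq> f n" for m n
        using that by auto
      then show ?thesis unfolding disjoint_family_on_def G_def by blast
    qed
    have covered: "\<exists>i\<in>I. fst b \<in> B (f i)" if b: "b \<in> F" for b
    proof -
      have "\<exists>i\<in>I. d (fst (f i)) (fst b) < snd (f i)"
      proof (rule ccontr)
        assume "\<not> ?thesis"
        then have IU: "I = UNIV" and big: "\<And>n. snd b < 4/3 * snd (f n)" using cov b by auto
        have "range (\<lambda>n. fst (f n)) \<subseteq> fst ` F" using fF IU by auto
        then obtain k where k: "strict_mono (k :: nat \<Rightarrow> nat)" "MCauchy ((\<lambda>n. fst (f n)) \<circ> k)"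
          using tb unfolding mtotally_bounded_sequentially by blast
        have "0 < 3/4 * snd b" using FD[OF b] by simp
        then obtain M where M: "\<And>m n. M \<le> m \<Longrightarrow> M \<le> n \<Longrightarrow> d (fst (f (k m))) (fst (f (k n))) < 3/4 * snd b"
          using k(2) unfolding MCauchy_def o_def by blast
        have "k M < k (Suc M)" using k(1) by (simp add: strict_mono_def)
        then have "snd (f (k M)) \<le> d (fst (f (k M))) (fst (f (k (Suc M))))"
          using sep(1)[of "k (Suc M)" "k M"] IU by auto
        then show False using M[of M "Suc M"] big[of "k M"] by auto
      qed
      then obtain i where i: "i \<in> I" "d (fst (f i)) (fst b) < snd (f i)" by blast
      then have "fst b \<in> B (f i)" unfolding B_def using FD(2)[OF b] FD(2)[OF fF[OF i(1)]] by (simp add: split_beta)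
      with i show ?thesis by blast
    qed
    have "fst ` F \<subseteq> (\<Union>j\<in>{1..N+1}. \<Union>b\<in>G j. B b)"
    proof
      fix y assume "y \<in> fst ` F"
      then obtain i where i: "i \<in> I" "y \<in> B (f i)" using covered by blast
      then have "f i \<in> G (c i + 1)" "c i + 1 \<in> {1..N+1}" using c(1)[of i] unfolding G_def by auto
      with i show "y \<in> (\<Union>j\<in>{1..N+1}. \<Union>b\<in>G j. B b)" by blast
    qed
    moreover have "G j \<subseteq> F" "countable (G j)" for j
      using fF unfolding G_def by auto
    ultimately show ?thesis
      unfolding coverable_def B_def[symmetric] using disj
      by (intro exI[of _ "N + 1"] conjI exI[of _ G]) auto
  qed
  then show ?thesis using \<delta> by blast
qed

text \<open>The coordinates are bilipschitz on a small ball, so a sequence in it has a Cauchy subsequence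
  because its image in the Euclidean space does.\<close>

lemma locally_totally_bounded: "\<exists>r>0. mtotally_bounded (mball p0 r)"
proof (cases "p0 \<in> X")
  case True
  define r where "r = min \<rho> (1 / (2 * C))"
  have r: "0 < r" "r \<le> \<rho>" "C * r \<le> 1/2" using pos unfolding r_def by (auto simp: min_def field_simps)
  have p0: "p0 \<in> mball p0 \<rho>" using True pos by simp
  have "mtotally_bounded (mball p0 r)"
    unfolding mtotally_bounded_sequentially
  proof (intro conjI allI impI)
    fix \<sigma> :: "nat \<Rightarrow> 'a" assume "range \<sigma> \<subseteq> mball p0 r"
    then have \<sigma>: "\<sigma> n \<in> X" "d p0 (\<sigma> n) \<le> r" for n by (auto simp: image_subset_iff less_imp_le)
    have "norm (\<phi> (\<sigma> n) - \<phi> p0) \<le> 2 * r / lam" for n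
    proof -
      have "lam * norm (\<phi> (\<sigma> n) - \<phi> p0) \<le> (1 + 2 * C * r) * d (\<sigma> n) p0"
        using lower[OF p0] form_upper[OF p0 r \<sigma>(1) True \<sigma>(2)] True r(1) order_trans by fastforce
      also have "\<dots> \<le> 2 * r" using r \<sigma>(2)[of n] by (intro mult_mono) (auto simp: commute)
      finally show ?thesis using pos by (simp add: field_simps)
    qed
    then have "\<phi> (\<sigma> n) \<in> cball (\<phi> p0) (2 * r / lam)" for n
      by (simp add: dist_norm norm_minus_commute)
    then obtain l k where k: "strict_mono (k :: nat \<Rightarrow> nat)" "((\<lambda>n. \<phi> (\<sigma> n)) \<circ> k) \<longlonglongrightarrow> l"
      using compact_cball[of "\<phi> p0" "2 * r / lam"] unfolding compact_def by metis
    then have C: "Cauchy (\<lambda>n. \<phi> (\<sigma> (k n)))" using LIMSEQ_imp_Cauchy by (auto simp: o_def)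
    have "MCauchy (\<sigma> \<circ> k)"
      unfolding MCauchy_def
    proof (intro conjI allI impI)
      fix e :: real assume e: "0 < e"
      then have "0 < e / (2 * Lam)" using pos by simp
      then obtain M where M: "\<And>m n. M \<le> m \<Longrightarrow> M \<le> n \<Longrightarrow> norm (\<phi> (\<sigma> (k m)) - \<phi> (\<sigma> (k n))) < e / (2 * Lam)"
        using C unfolding Cauchy_iff by meson
      have "d (\<sigma> (k m)) (\<sigma> (k n)) < e" if mn: "M \<le> m" "M \<le> n" for m n
      proof -
        have "d (\<sigma> (k m)) (\<sigma> (k n)) \<le> (1 + C * r) * form_norm (G p0) (\<phi> (\<sigma> (k m)) - \<phi> (\<sigma> (k n)))"
          by (rule close_upper[OF p0 r(1,2) \<sigma>(1) \<sigma>(1) \<sigma>(2) \<sigma>(2)])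
        also have "\<dots> \<le> 2 * (Lam * norm (\<phi> (\<sigma> (k m)) - \<phi> (\<sigma> (k n))))"
          using r upper[OF p0] form_norm_nonneg[OF inner[OF p0]] by (intro mult_mono) auto
        also have "\<dots> < e" using M[OF mn] pos by (simp add: field_simps)
        finally show ?thesis .
      qed
      then show "\<exists>N. \<forall>n n'. N \<le> n \<longrightarrow> N \<le> n' \<longrightarrow> d ((\<sigma> \<circ> k) n) ((\<sigma> \<circ> k) n') < e" by auto
    qed (use \<sigma> in auto)
    then show "\<exists>r. strict_mono r \<and> MCauchy (\<sigma> \<circ> r)" using k by blast
  qed auto
  then show ?thesis using r(1) by blast
next
  case False
  then show ?thesis by (intro exI[of _ 1]) (simp add: mball_eq_empty[THEN iffD2])
qed

end

context length_space
begin

text \<open>A Lebesgue number \<open>h\<close> of the cover by coordinate neighbourhoods reduces the small balls to finitely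
  many local families, and \<open>m\<close> is at most each of the finitely many radii below which the local
  results apply. Among the balls of radius at least \<open>m\<close>, finitely many have centres that form an
  \<open>m\<close>-net of the centres of all of them, and these few balls cover the others' centres.\<close>

theorem Besicovitch_covering:
  assumes charts: "\<And>p. p \<in> X \<Longrightarrow> \<exists>(\<phi>::'a \<Rightarrow> 'e::euclidean_space) G \<rho> C lam Lam. infinitesimal_chart X d \<phi> G p \<rho> C lam Lam"
    and F: "\<And>x r. (x, r) \<in> F \<Longrightarrow> 0 < r"
    and a: "a \<in> X" "fst ` F \<subseteq> mball a R"
  shows "coverable F (fst ` F)"
proof -
  have "\<exists>r>0. mtotally_bounded (mball p r)" if p: "p \<in> X" for p
  proof -
    obtain \<phi> :: "'a \<Rightarrow> 'e" and G \<rho> C lam Lam where "infinitesimal_chart X d \<phi> G p \<rho> C lam Lam"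
      using charts[OF p] by blast
    then show ?thesis by (rule infinitesimal_chart.locally_totally_bounded)
  qed
  then have "mtotally_bounded (mball a R)" using Hopf_Rinow a by blast
  then have tbA: "mtotally_bounded B" if "B \<subseteq> fst ` F" for B
    using mtotally_bounded_subset a(2) that by (meson subset_trans)
  have "\<exists>\<rho>>0. \<exists>\<delta>>0. \<forall>F'\<subseteq>F. (\<forall>(x, r)\<in>F'. x \<in> mball p \<rho> \<and> r < \<delta>) \<longrightarrow> coverable F' (fst ` F')" if p: "p \<in> X" for p
  proof -
    obtain \<phi> :: "'a \<Rightarrow> 'e" and G \<rho> C lam Lam where i: "infinitesimal_chart X d \<phi> G p \<rho> C lam Lam"
      using charts[OF p] by blast
    obtain \<delta> where \<delta>: "0 < \<delta>" "\<And>F. (\<forall>(x, r)\<in>F. x \<in> mball p \<rho> \<and> 0 < r \<and> r < \<delta>) \<and> mtotally_bounded (fst ` F) \<Longrightarrow> coverable F (fst ` F)"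
      using infinitesimal_chart.small_balls_coverable[OF i] by blast
    have "coverable F' (fst ` F')" if "F' \<subseteq> F" "\<forall>(x, r)\<in>F'. x \<in> mball p \<rho> \<and> r < \<delta>" for F'
      using \<delta>(2)[of F'] that F tbA[of "fst ` F'"] by blast
    then show ?thesis using \<delta>(1) infinitesimal_chart.pos(1)[OF i] by blast
  qed
  then obtain \<rho> \<delta> where \<rho>: "\<And>p. p \<in> X \<Longrightarrow> 0 < \<rho> p" and \<delta>: "\<And>p. p \<in> X \<Longrightarrow> 0 < \<delta> p"
    and small: "\<And>p F'. p \<in> X \<Longrightarrow> F' \<subseteq> F \<Longrightarrow> (\<forall>(x, r)\<in>F'. x \<in> mball p (\<rho> p) \<and> r < \<delta> p) \<Longrightarrow> coverable F' (fst ` F')"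
    by metis
  obtain h where h: "0 < h" "\<And>x. x \<in> fst ` F \<Longrightarrow> \<exists>p\<in>X. mball x h \<subseteq> mball p (\<rho> p)"
    using Lebesgue_number[OF tbA[OF order_refl], of \<rho>, OF \<rho>] by blast
  then obtain P where P: "\<And>x. x \<in> fst ` F \<Longrightarrow> P x \<in> X \<and> mball x h \<subseteq> mball (P x) (\<rho> (P x))" by metis
  obtain K where K: "finite K" "K \<subseteq> fst ` F" "fst ` F \<subseteq> (\<Union>x\<in>K. mball x h)"
    using tbA[OF order_refl] h(1) unfolding mtotally_bounded_def by meson
  define m where "m = Min (insert 1 (\<delta> ` P ` K))"
  have m: "0 < m" "\<And>x. x \<in> K \<Longrightarrow> m \<le> \<delta> (P x)"
    using K P \<delta> unfolding m_def by (auto simp: subset_iff)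
  define Fs where "Fs x = {b\<in>F. fst b \<in> mball x h \<and> snd b < m}" for x
  have Fs: "coverable F (fst ` Fs x)" if x: "x \<in> K" for x
  proof -
    have "coverable (Fs x) (fst ` Fs x)"
    proof (rule small)
      show "P x \<in> X" using P K(2) x by blast
      show "Fs x \<subseteq> F" unfolding Fs_def by blast
      have "mball x h \<subseteq> mball (P x) (\<rho> (P x))" using P K(2) x by blast
      then show "\<forall>(y, r)\<in>Fs x. y \<in> mball (P x) (\<rho> (P x)) \<and> r < \<delta> (P x)"
        using m(2)[OF x] unfolding Fs_def by (auto simp del: in_mball)
    qed
    then show ?thesis by (rule coverable_mono) (auto simp: Fs_def)
  qed
  define Fb where "Fb = {b\<in>F. m \<le> snd b}"
  obtain Kb where Kb: "finite Kb" "Kb \<subseteq> fst ` Fb" "fst ` Fb \<subseteq> (\<Union>x\<in>Kb. mball x m)"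
    using tbA[of "fst ` Fb"] m(1) unfolding mtotally_bounded_def Fb_def by blast
  have big: "coverable F (mball x m)" if "x \<in> Kb" for x
  proof -
    have "x \<in> fst ` Fb" using Kb(2) \<open>x \<in> Kb\<close> by blast
    then obtain r where r: "(x, r) \<in> F" "m \<le> r" unfolding Fb_def by auto
    show ?thesis using coverable_mono[OF coverable_mball[OF r(1)]] mball_subset_concentric[OF r(2)] by blast
  qed
  have "coverable F ((\<Union>x\<in>K. fst ` Fs x) \<union> (\<Union>x\<in>Kb. mball x m))"
    by (intro coverable_Un coverable_UN K Kb Fs big)
  moreover have "fst ` F \<subseteq> (\<Union>x\<in>K. fst ` Fs x) \<union> (\<Union>x\<in>Kb. mball x m)"
  proof
    fix y assume y: "y \<in> fst ` F"
    then obtain b where b: "b \<in> F" "y = fst b" by blast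
    show "y \<in> (\<Union>x\<in>K. fst ` Fs x) \<union> (\<Union>x\<in>Kb. mball x m)"
    proof (cases "snd b < m")
      case True
      obtain x where "x \<in> K" "y \<in> mball x h" using K(3) y by blast
      then have "b \<in> Fs x" "x \<in> K" using b True unfolding Fs_def by auto
      with b show ?thesis by blast
    next
      case False
      then have "b \<in> Fb" using b unfolding Fb_def by auto
      then show ?thesis using Kb(3) b by blast
    qed
  qed
  ultimately show ?thesis using coverable_mono by blast
qed

end

section \<open>Charts and metric coefficients\<close>

lemma smooth_onD:
  assumes "smooth_on S f"
  shows "open S" and "x \<in> S \<Longrightarrow> f differentiable (at x)"
    and "continuous_on S (\<lambda>x. frechet_derivative f (at x) v)" and "continuous_on S f"
proof -
  have "Ck_on k S f" for k using assms unfolding smooth_on_def by blast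
  from this[of 0] this[of "Suc 0"]
  show "x \<in> S \<Longrightarrow> f differentiable (at x)" "continuous_on S (\<lambda>x. frechet_derivative f (at x) v)"
    "continuous_on S f" by auto
qed (use assms smooth_on_def in blast)

locale riemannian_space =
  fixes M :: "('a, 'e::euclidean_space) riemannian"
  assumes riem: "riemannian_manifold M"
begin

lemma Hausdorff: "Hausdorff_space (mtop M)"
  and atlas: "smooth_atlas (mtop M) (atlas M)"
  and inner_tangent: "p \<in> topspace (mtop M) \<Longrightarrow> inner_product_on_tangent_space M p"
  and metric_coeff_smooth: "c \<in> atlas M \<Longrightarrow> smooth_on (chart_image c) (\<lambda>x. metric_coeff M c x a b)"
  using riem unfolding riemannian_manifold_def by blast+

lemma chart_exists: "p \<in> topspace (mtop M) \<Longrightarrow> \<exists>c\<in>atlas M. p \<in> fst c"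
  using atlas unfolding smooth_atlas_def by blast

context
  fixes c assumes c: "c \<in> atlas M"
begin

lemma chart_open: "openin (mtop M) (fst c)"
  and chart_image_open: "open (chart_image c)"
  and chart_homeo: "homeomorphic_map (subtopology (mtop M) (fst c)) (top_of_set (chart_image c)) (snd c)"
  using atlas c unfolding smooth_atlas_def by blast+

lemma chart_subset: "fst c \<subseteq> topspace (mtop M)"
  using chart_open by (rule openin_subset)

lemma chart_inj: "inj_on (snd c) (fst c)"
  using homeomorphic_imp_injective_map[OF chart_homeo] chart_subset
  by (simp add: inf.absorb2)

lemma chart_inv_chart [simp]: "p \<in> fst c \<Longrightarrow> chart_inv c (snd c p) = p"
  unfolding chart_inv_def by (rule inv_into_f_f[OF chart_inj])

lemma chart_chart_inv [simp]: "x \<in> chart_image c \<Longrightarrow> snd c (chart_inv c x) = x"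
  unfolding chart_inv_def chart_image_def by (rule f_inv_into_f)

lemma chart_inv_in [simp]: "x \<in> chart_image c \<Longrightarrow> chart_inv c x \<in> fst c"
  unfolding chart_inv_def chart_image_def by (rule inv_into_into)

lemma chart_in [simp]: "p \<in> fst c \<Longrightarrow> snd c p \<in> chart_image c"
  unfolding chart_image_def by simp

lemma chart_continuous: "continuous_map (subtopology (mtop M) (fst c)) euclidean (snd c)"
  using homeomorphic_imp_continuous_map[OF chart_homeo] by (simp add: continuous_map_in_subtopology)

lemma chart_inv_continuous: "continuous_map (top_of_set (chart_image c)) (mtop M) (chart_inv c)"
proof -
  obtain h where h: "homeomorphic_maps (subtopology (mtop M) (fst c)) (top_of_set (chart_image c)) (snd c) h"
    using chart_homeo homeomorphic_map_maps by blast
  have "continuous_map (top_of_set (chart_image c)) (mtop M) h"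
    using h unfolding homeomorphic_maps_def continuous_map_in_subtopology by blast
  moreover have "h x = chart_inv c x" if "x \<in> topspace (top_of_set (chart_image c))" for x
  proof -
    have x: "x \<in> chart_image c" using that by simp
    then have "h x \<in> fst c" "snd c (h x) = x"
      using h unfolding homeomorphic_maps_def continuous_map_def by (auto simp: Pi_iff)
    then show ?thesis using chart_inv_chart[of "h x"] by simp
  qed
  ultimately show ?thesis by (rule continuous_map_eq)
qed

end

lemma transition_smooth:
  "\<lbrakk>c \<in> atlas M; d \<in> atlas M\<rbrakk> \<Longrightarrow> smooth_on (snd c ` (fst c \<inter> fst d)) (transition c d)"
  using atlas unfolding smooth_atlas_def by blast

lemma transition_apply [simp]: "\<lbrakk>c \<in> atlas M; p \<in> fst c\<rbrakk> \<Longrightarrow> transition c d (snd c p) = snd d p"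
  unfolding transition_def by simp

lemma transition_has_derivative:
  assumes "c \<in> charts_at M p" "d \<in> charts_at M p"
  shows "(transition c d has_derivative (frechet_derivative (transition c d) (at (snd c p)))) (at (snd c p))"
proof -
  have "snd c p \<in> snd c ` (fst c \<inter> fst d)" using assms unfolding charts_at_def by auto
  then show ?thesis
    using smooth_onD(2)[OF transition_smooth] assms frechet_derivative_works unfolding charts_at_def by blast
qed

lemma transition_self_derivative:
  assumes "c \<in> charts_at M p"
  shows "frechet_derivative (transition c c) (at (snd c p)) = (\<lambda>a. a)"
proof -
  have c: "c \<in> atlas M" "p \<in> fst c" using assms unfolding charts_at_def by auto
  have "(transition c c has_derivative (\<lambda>a. a)) (at (snd c p))"
  proof (rule has_derivative_transform_within_open[OF has_derivative_ident chart_image_open[OF c(1)]])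
    show "snd c p \<in> chart_image c" using c by simp
    show "x = transition c c x" if "x \<in> chart_image c" for x
      using that c unfolding transition_def by simp
  qed
  then show ?thesis by (metis frechet_derivative_at)
qed

text \<open>The chain rule for coordinate changes; it makes \<open>chart_vec\<close> produce genuine tangent vectors.\<close>

lemma transition_cocycle:
  assumes "c \<in> charts_at M p" "d \<in> charts_at M p" "d' \<in> charts_at M p"
  shows "frechet_derivative (transition c d') (at (snd c p)) a =
    frechet_derivative (transition d d') (at (snd d p)) (frechet_derivative (transition c d) (at (snd c p)) a)"
proof -
  have A: "c \<in> atlas M" "d \<in> atlas M" "d' \<in> atlas M" "p \<in> fst c" "p \<in> fst d" "p \<in> fst d'"
    using assms unfolding charts_at_def by auto
  let ?S = "snd c ` (fst c \<inter> fst d) \<inter> snd c ` (fst c \<inter> fst d')"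
  have S: "open ?S"
    using smooth_onD(1)[OF transition_smooth] A by blast
  have 1: "(transition d d' has_derivative (frechet_derivative (transition d d') (at (snd d p)))) (at (transition c d (snd c p)))"
    using transition_has_derivative[OF assms(2,3)] A by simp
  have "(transition d d' \<circ> transition c d has_derivative
     (frechet_derivative (transition d d') (at (snd d p)) \<circ> frechet_derivative (transition c d) (at (snd c p)))) (at (snd c p))"
    by (rule diff_chain_at[OF transition_has_derivative[OF assms(1,2)] 1])
  then have "(transition c d' has_derivative
     (frechet_derivative (transition d d') (at (snd d p)) \<circ> frechet_derivative (transition c d) (at (snd c p)))) (at (snd c p))"
  proof (rule has_derivative_transform_within_open[OF _ S])
    show "snd c p \<in> ?S" using A by blast
    fix x assume "x \<in> ?S"
    then obtain q where q: "q \<in> fst c" "q \<in> fst d" "x = snd c q" by blast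
    then show "(transition d d' \<circ> transition c d) x = transition c d' x" using A by simp
  qed
  then show ?thesis by (metis comp_apply frechet_derivative_at)
qed

lemma chart_vec_tangent:
  assumes "c \<in> charts_at M p"
  shows "chart_vec M c p a \<in> tangent_space M p"
proof -
  have "chart_vec M c p a d' = frechet_derivative (transition d d') (at (snd d p)) (chart_vec M c p a d)"
    if "d \<in> charts_at M p" "d' \<in> charts_at M p" for d d'
    unfolding chart_vec_def using that transition_cocycle[OF assms that, of a] by simp
  moreover have "chart_vec M c p a d = 0" if "d \<notin> charts_at M p" for d
    unfolding chart_vec_def using that by simp
  ultimately show ?thesis unfolding tangent_space_def by blast
qed

lemma chart_vec_self: "c \<in> charts_at M p \<Longrightarrow> chart_vec M c p a c = a"
  unfolding chart_vec_def using transition_self_derivative by simp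

lemma chart_vec_add:
  assumes "c \<in> charts_at M p"
  shows "chart_vec M c p (a + b) = (\<lambda>d. chart_vec M c p a d + chart_vec M c p b d)"
proof
  fix d
  show "chart_vec M c p (a + b) d = chart_vec M c p a d + chart_vec M c p b d"
    using linear_add[OF has_derivative_linear[OF transition_has_derivative[OF assms, of d]]]
    unfolding chart_vec_def by simp
qed

lemma chart_vec_scale:
  assumes "c \<in> charts_at M p"
  shows "chart_vec M c p (r *\<^sub>R a) = (\<lambda>d. r *\<^sub>R chart_vec M c p a d)"
proof
  fix d
  show "chart_vec M c p (r *\<^sub>R a) d = r *\<^sub>R chart_vec M c p a d"
    using linear_scale[OF has_derivative_linear[OF transition_has_derivative[OF assms, of d]]]
    unfolding chart_vec_def by simp
qed

lemma metric_coeff_chart: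
  "\<lbrakk>c \<in> atlas M; p \<in> fst c\<rbrakk> \<Longrightarrow> metric_coeff M c (snd c p) a b = metric M p (chart_vec M c p a) (chart_vec M c p b)"
  unfolding metric_coeff_def by simp

lemma metric_coeff_inner:
  assumes c: "c \<in> atlas M" and x: "x \<in> chart_image c"
  shows "inner_form (metric_coeff M c x)" and "a \<noteq> 0 \<Longrightarrow> 0 < metric_coeff M c x a a"
proof -
  define p where "p = chart_inv c x"
  have p: "p \<in> fst c" "snd c p = x" using c x unfolding p_def by auto
  have ca: "c \<in> charts_at M p" using c p unfolding charts_at_def by simp
  have eq: "metric_coeff M c x a b = metric M p (chart_vec M c p a) (chart_vec M c p b)" for a b
    using metric_coeff_chart[OF c p(1)] p(2) by simp
  have T: "chart_vec M c p a \<in> tangent_space M p" for a using chart_vec_tangent[OF ca] .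
  have "p \<in> topspace (mtop M)" using p chart_subset[OF c] by blast
  note I = inner_tangent[OF this, unfolded inner_product_on_tangent_space_def]
  have sym: "metric_coeff M c x a b = metric_coeff M c x b a" for a b
    unfolding eq using I T by blast
  have add: "metric_coeff M c x (a + b) e = metric_coeff M c x a e + metric_coeff M c x b e" for a b e
    unfolding eq chart_vec_add[OF ca] using I T by blast
  have scale: "metric_coeff M c x (r *\<^sub>R a) b = r * metric_coeff M c x a b" for r a b
    unfolding eq chart_vec_scale[OF ca] using I T by blast
  have pos: "0 < metric_coeff M c x a a" if "a \<noteq> 0" for a
  proof -
    have "chart_vec M c p a \<noteq> (\<lambda>c. 0)" using chart_vec_self[OF ca, of a] that by metis
    then show ?thesis unfolding eq using I T by blast
  qed
  have nonneg: "0 \<le> metric_coeff M c x a a" for a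
    using pos[of a] scale[of 0 0 0] by (cases "a = 0") auto
  show "inner_form (metric_coeff M c x)"
    unfolding inner_form_def using sym add scale nonneg by blast
  show "a \<noteq> 0 \<Longrightarrow> 0 < metric_coeff M c x a a" by (rule pos)
qed

end

lemma inner_form_expand:
  assumes g: "inner_form (g :: 'e::euclidean_space \<Rightarrow> 'e \<Rightarrow> real)"
  shows "g v w = (\<Sum>i\<in>Basis. \<Sum>j\<in>Basis. (v \<bullet> i) * (w \<bullet> j) * g i j)"
proof -
  have lin1: "linear (\<lambda>v. g v w)" for w
    by (intro linearI) (simp_all add: form_add_left[OF g] form_scale_left[OF g])
  have lin2: "linear (\<lambda>w. g v w)" for v
    by (intro linearI) (simp_all add: form_add_right[OF g] form_scale_right[OF g])
  have "g v w = g (\<Sum>i\<in>Basis. (v \<bullet> i) *\<^sub>R i) w" by (simp add: euclidean_representation)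
  also have "\<dots> = (\<Sum>i\<in>Basis. (v \<bullet> i) * g i w)"
    using linear_sum[OF lin1, of "\<lambda>i. (v \<bullet> i) *\<^sub>R i" Basis] by (simp add: form_scale_left[OF g])
  also have "\<dots> = (\<Sum>i\<in>Basis. (v \<bullet> i) * (\<Sum>j\<in>Basis. (w \<bullet> j) * g i j))"
  proof (rule sum.cong[OF refl])
    fix i
    have "g i w = g i (\<Sum>j\<in>Basis. (w \<bullet> j) *\<^sub>R j)" by (simp add: euclidean_representation)
    also have "\<dots> = (\<Sum>j\<in>Basis. (w \<bullet> j) * g i j)"
      using linear_sum[OF lin2, of i "\<lambda>i. (w \<bullet> i) *\<^sub>R i" Basis] by (simp add: form_scale_right[OF g])
    finally show "(v \<bullet> i) * g i w = (v \<bullet> i) * (\<Sum>j\<in>Basis. (w \<bullet> j) * g i j)" by simp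
  qed
  finally show ?thesis by (simp add: sum_distrib_left mult.assoc)
qed

lemma inner_form_pos_lower_bound:
  assumes g: "inner_form (g :: 'e::euclidean_space \<Rightarrow> 'e \<Rightarrow> real)" and pos: "\<And>v. v \<noteq> 0 \<Longrightarrow> 0 < g v v"
  shows "\<exists>m>0. \<forall>v. m * (norm v)\<^sup>2 \<le> g v v"
proof -
  have cont: "continuous_on (sphere 0 1) (\<lambda>v. g v v)"
    by (subst inner_form_expand[OF g]) (intro continuous_intros)
  obtain e :: 'e where "e \<in> Basis" using nonempty_Basis by blast
  then have "sphere (0::'e) 1 \<noteq> {}" by (auto intro!: exI[of _ e])
  then obtain u :: 'e where u: "u \<in> sphere 0 1" "\<And>v. v \<in> sphere 0 1 \<Longrightarrow> g u u \<le> g v v"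
    using continuous_attains_inf[OF compact_sphere _ cont] by blast
  have "u \<noteq> 0" using u(1) by auto
  then have m: "0 < g u u" by (rule pos)
  have "g u u * (norm v)\<^sup>2 \<le> g v v" for v
  proof (cases "v = 0")
    case True
    then show ?thesis using form_nonneg[OF g, of v] by simp
  next
    case False
    then have "g u u \<le> g (v /\<^sub>R norm v) (v /\<^sub>R norm v)" by (intro u(2)) auto
    also have "\<dots> = g v v / (norm v)\<^sup>2"
      by (simp add: form_scale_left[OF g] form_scale_right[OF g] power2_eq_square divide_inverse)
    finally show ?thesis using False by (simp add: field_simps)
  qed
  then show ?thesis using m by blast
qed

lemma smooth_Lipschitz_on_cball:
  fixes f :: "'e::euclidean_space \<Rightarrow> real"
  assumes f: "smooth_on S f" and S: "cball x0 r \<subseteq> S"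
  shows "\<exists>B\<ge>0. \<forall>x\<in>cball x0 r. \<forall>y\<in>cball x0 r. \<bar>f x - f y\<bar> \<le> B * norm (x - y)"
proof -
  define F where "F x = frechet_derivative f (at x)" for x
  have der: "(f has_derivative F x) (at x)" if "x \<in> cball x0 r" for x
    using smooth_onD(2)[OF f] S that frechet_derivative_works unfolding F_def by blast
  have "\<exists>B. \<forall>x\<in>cball x0 r. norm (F x i) \<le> B" for i
  proof -
    have "continuous_on (cball x0 r) (\<lambda>x. F x i)"
      using smooth_onD(3)[OF f] S continuous_on_subset unfolding F_def by blast
    then have "bounded ((\<lambda>x. F x i) ` cball x0 r)"
      using compact_cball compact_continuous_image compact_imp_bounded by blast
    then show ?thesis by (auto simp: bounded_iff)
  qed
  then obtain B where B: "\<And>i x. x \<in> cball x0 r \<Longrightarrow> norm (F x i) \<le> B i" by metis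
  define K where "K = (\<Sum>i\<in>Basis. \<bar>B i\<bar>)"
  have "onorm (F x) \<le> K" if x: "x \<in> cball x0 r" for x
  proof -
    have "onorm (F x) \<le> (\<Sum>i\<in>Basis. norm (F x i))"
      by (rule onorm_componentwise) (rule has_derivative_bounded_linear[OF der[OF x]])
    also have "\<dots> \<le> K" unfolding K_def using B[OF x] by (intro sum_mono) (meson abs_ge_self order_trans)
    finally show ?thesis .
  qed
  then have "norm (f x - f y) \<le> K * norm (x - y)" if "x \<in> cball x0 r" "y \<in> cball x0 r" for x y
    using that der by (intro differentiable_bound[of "cball x0 r" f F]) (auto intro: has_derivative_at_withinI)
  moreover have "0 \<le> K" unfolding K_def by (intro sum_nonneg) auto
  ultimately show ?thesis by auto
qed

context riemannian_space
begin

text \<open>The ball is shrunk until the variation of the coefficients over it is at most half of the lower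
  bound \<open>m\<close> at the centre, so that the metric stays uniformly definite.\<close>

lemma metric_coeff_local:
  assumes c: "c \<in> atlas M" and x0: "x0 \<in> chart_image c"
  obtains r lam Lam K where "0 < r" "0 < lam" "0 < Lam" "0 < K" "cball x0 r \<subseteq> chart_image c"
    "\<forall>x\<in>cball x0 r. \<forall>v. lam * norm v \<le> form_norm (metric_coeff M c x) v"
    "\<forall>x\<in>cball x0 r. \<forall>v. form_norm (metric_coeff M c x) v \<le> Lam * norm v"
    "\<forall>x\<in>cball x0 r. \<forall>y\<in>cball x0 r. \<forall>v.
       \<bar>metric_coeff M c x v v - metric_coeff M c y v v\<bar> \<le> K * norm (x - y) * (norm v)\<^sup>2"
proof -
  let ?g = "metric_coeff M c"
  obtain r0 where r0: "0 < r0" "cball x0 r0 \<subseteq> chart_image c"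
    using chart_image_open[OF c] x0 open_contains_cball by blast
  note inn = metric_coeff_inner(1)[OF c]
  have "\<exists>B\<ge>0. \<forall>x\<in>cball x0 r0. \<forall>y\<in>cball x0 r0. \<bar>?g x i j - ?g y i j\<bar> \<le> B * norm (x - y)" for i j
    by (rule smooth_Lipschitz_on_cball[OF metric_coeff_smooth[OF c] r0(2)])
  then obtain B where B0: "\<And>i j. 0 \<le> B i j" and
    B: "\<And>i j x y. x \<in> cball x0 r0 \<Longrightarrow> y \<in> cball x0 r0 \<Longrightarrow> \<bar>?g x i j - ?g y i j\<bar> \<le> B i j * norm (x - y)"
    by metis
  define K where "K = (\<Sum>i\<in>Basis. \<Sum>j\<in>Basis. B i j) + 1"
  have K: "0 < K" unfolding K_def using B0 by (intro add_nonneg_pos sum_nonneg) auto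
  have Lip: "\<bar>?g x v v - ?g y v v\<bar> \<le> K * norm (x - y) * (norm v)\<^sup>2" if xy: "x \<in> cball x0 r0" "y \<in> cball x0 r0" for x y v
  proof -
    have "?g x v v - ?g y v v = (\<Sum>i\<in>Basis. \<Sum>j\<in>Basis. (v \<bullet> i) * (v \<bullet> j) * (?g x i j - ?g y i j))"
      using inner_form_expand[OF inn, of x v v] inner_form_expand[OF inn, of y v v] xy r0(2)
      by (simp add: subset_iff right_diff_distrib sum_subtractf)
    also have "\<bar>\<dots>\<bar> \<le> (\<Sum>i\<in>Basis. \<Sum>j\<in>Basis. \<bar>(v \<bullet> i) * (v \<bullet> j) * (?g x i j - ?g y i j)\<bar>)"
      by (rule order_trans[OF sum_abs]) (intro sum_mono sum_abs)
    also have "\<dots> \<le> (\<Sum>i\<in>Basis. \<Sum>j\<in>Basis. (norm v * norm v) * (B i j * norm (x - y)))"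
    proof (intro sum_mono)
      fix i j :: 'e assume "i \<in> Basis" "j \<in> Basis"
      then show "\<bar>(v \<bullet> i) * (v \<bullet> j) * (?g x i j - ?g y i j)\<bar> \<le> (norm v * norm v) * (B i j * norm (x - y))"
        unfolding abs_mult using B[OF xy] Basis_le_norm by (intro mult_mono) auto
    qed
    also have "\<dots> = (K - 1) * norm (x - y) * (norm v)\<^sup>2"
      unfolding K_def by (simp add: sum_distrib_left sum_distrib_right power2_eq_square mult_ac)
    also have "\<dots> \<le> K * norm (x - y) * (norm v)\<^sup>2"
      by (intro mult_right_mono) auto
    finally show ?thesis .
  qed
  obtain m where m: "0 < m" "\<And>v. m * (norm v)\<^sup>2 \<le> ?g x0 v v"
    using inner_form_pos_lower_bound[OF inn[OF x0] metric_coeff_inner(2)[OF c x0]] by blast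
  define r where "r = min r0 (m / (2 * K))"
  have r: "0 < r" "r \<le> r0" "K * r \<le> m / 2"
  proof -
    show "0 < r" "r \<le> r0" using r0 m K unfolding r_def by auto
    have "r \<le> m / (2 * K)" unfolding r_def by simp
    then show "K * r \<le> m / 2" using K by (simp add: field_simps)
  qed
  define U where "U = (\<Sum>i\<in>Basis. \<Sum>j\<in>Basis. \<bar>?g x0 i j\<bar>) + m / 2"
  have U: "0 < U" unfolding U_def using m by (intro add_nonneg_pos sum_nonneg) auto
  have up0: "?g x0 v v \<le> (U - m/2) * (norm v)\<^sup>2" for v
  proof -
    have "?g x0 v v \<le> (\<Sum>i\<in>Basis. \<Sum>j\<in>Basis. (norm v * norm v) * \<bar>?g x0 i j\<bar>)"
    proof (subst inner_form_expand[OF inn[OF x0]], intro sum_mono)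
      fix i j :: 'e assume ij: "i \<in> Basis" "j \<in> Basis"
      have "(v \<bullet> i) * (v \<bullet> j) * ?g x0 i j \<le> \<bar>(v \<bullet> i) * (v \<bullet> j) * ?g x0 i j\<bar>" by (rule abs_ge_self)
      also have "\<dots> \<le> (norm v * norm v) * \<bar>?g x0 i j\<bar>"
        unfolding abs_mult using Basis_le_norm ij by (intro mult_mono) auto
      finally show "(v \<bullet> i) * (v \<bullet> j) * ?g x0 i j \<le> (norm v * norm v) * \<bar>?g x0 i j\<bar>" .
    qed
    also have "\<dots> = (U - m/2) * (norm v)\<^sup>2"
      unfolding U_def by (simp add: sum_distrib_left sum_distrib_right power2_eq_square mult_ac)
    finally show ?thesis .
  qed
  have near: "\<bar>?g x v v - ?g x0 v v\<bar> \<le> m / 2 * (norm v)\<^sup>2" if x: "x \<in> cball x0 r" for x v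
  proof -
    have "\<bar>?g x v v - ?g x0 v v\<bar> \<le> K * norm (x - x0) * (norm v)\<^sup>2"
      using Lip[of x x0] x r r0 by auto
    also have "\<dots> \<le> m / 2 * (norm v)\<^sup>2"
    proof (rule mult_right_mono)
      have "K * norm (x - x0) \<le> K * r" using x K by (intro mult_left_mono) (auto simp: dist_norm norm_minus_commute)
      then show "K * norm (x - x0) \<le> m / 2" using r(3) by linarith
    qed simp
    finally show ?thesis .
  qed
  show thesis
  proof (intro that[of r "sqrt (m/2)" "sqrt U" K] ballI allI)
    show "cball x0 r \<subseteq> chart_image c" using r r0(2) by (meson subset_cball subset_trans)
    show "sqrt (m / 2) * norm v \<le> form_norm (?g x) v" if x: "x \<in> cball x0 r" for x v
    proof -
      have "m / 2 * (norm v)\<^sup>2 \<le> ?g x v v" using abs_le_D2[OF near[OF x, of v]] m(2)[of v] by (simp add: algebra_simps)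
      then have "sqrt (m / 2 * (norm v)\<^sup>2) \<le> sqrt (?g x v v)" by (rule real_sqrt_le_mono)
      then show ?thesis unfolding form_norm_def real_sqrt_mult by simp
    qed
    show "form_norm (?g x) v \<le> sqrt U * norm v" if x: "x \<in> cball x0 r" for x v
    proof -
      have "?g x v v \<le> U * (norm v)\<^sup>2"
        using abs_le_D1[OF near[OF x, of v]] up0[of v] by (simp add: algebra_simps)
      then have "sqrt (?g x v v) \<le> sqrt (U * (norm v)\<^sup>2)" by (rule real_sqrt_le_mono)
      then show ?thesis unfolding form_norm_def real_sqrt_mult by simp
    qed
    show "\<bar>?g x v v - ?g y v v\<bar> \<le> K * norm (x - y) * (norm v)\<^sup>2" if "x \<in> cball x0 r" "y \<in> cball x0 r" for x y v
      using Lip[of x y v] that r(2) by auto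
  qed (use r m U K in auto)
qed

end

section \<open>Piecewise smooth curves and their length\<close>

text \<open>Properties that pass to concatenations of intervals need only be checked between break points.\<close>

lemma interval_induct_finite:
  fixes P :: "real \<Rightarrow> real \<Rightarrow> bool"
  assumes S: "finite S" and ab: "a < b"
    and base: "\<And>u v. \<lbrakk>a \<le> u; u < v; v \<le> b; {u<..<v} \<inter> S = {}\<rbrakk> \<Longrightarrow> P u v"
    and step: "\<And>u v w. \<lbrakk>a \<le> u; u < v; v < w; w \<le> b; P u v; P v w\<rbrakk> \<Longrightarrow> P u w"
  shows "P a b"
proof -
  have "\<lbrakk>a \<le> u; u < v; v \<le> b; card ({u<..<v} \<inter> S) = n\<rbrakk> \<Longrightarrow> P u v" for n u v
  proof (induction n arbitrary: u v rule: less_induct)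
    case (less n)
    show ?case
    proof (cases "{u<..<v} \<inter> S = {}")
      case True
      with less.prems base show ?thesis by blast
    next
      case False
      then obtain s where s: "s \<in> S" "u < s" "s < v" by auto
      have "card ({u<..<s} \<inter> S) < card ({u<..<v} \<inter> S)"
        using s S by (intro psubset_card_mono) auto
      then have "P u s" using less.IH less.prems s by auto
      moreover have "card ({s<..<v} \<inter> S) < card ({u<..<v} \<inter> S)"
        using s S by (intro psubset_card_mono) auto
      then have "P s v" using less.IH less.prems s by auto
      ultimately show ?thesis using step s less.prems by blast
    qed
  qed
  then show ?thesis using ab by blast
qed

context riemannian_space
begin

abbreviation coeff_norm :: "('a, 'e) chart \<Rightarrow> 'e \<Rightarrow> 'e \<Rightarrow> real" where
  "coeff_norm c x \<equiv> form_norm (metric_coeff M c x)"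

text \<open>The two-sided derivative makes the speed independent of the parameter interval. In the interior
  of the interval it agrees with the integrand in \<open>curve_length\<close>.\<close>

definition speed :: "(real \<Rightarrow> 'a) \<Rightarrow> real \<Rightarrow> real" where
  "speed \<gamma> t = tnorm M (\<gamma> t) (velocity M UNIV \<gamma> t)"

definition arc_length :: "real \<Rightarrow> real \<Rightarrow> (real \<Rightarrow> 'a) \<Rightarrow> real" where
  "arc_length a b \<gamma> = integral {a..b} (speed \<gamma>)"

text \<open>Arbitrary parameter intervals and an explicit set of break points make restriction,
  reparametrisation and concatenation of curves straightforward.\<close>

definition pw_C1 :: "real \<Rightarrow> real \<Rightarrow> real set \<Rightarrow> (real \<Rightarrow> 'a) \<Rightarrow> bool" where
  "pw_C1 a b S \<gamma> \<longleftrightarrow> finite S \<and>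
     (\<forall>u v. a \<le> u \<and> u < v \<and> v \<le> b \<and> {u<..<v} \<inter> S = {} \<longrightarrow> C1_curve M {u..v} \<gamma>)"

lemma piecewise_C1_curve_iff: "piecewise_C1_curve M \<gamma> \<longleftrightarrow> (\<exists>S. pw_C1 0 1 S \<gamma>)"
  unfolding piecewise_C1_curve_def pw_C1_def by blast

lemma velocity_interior:
  "t \<in> {u<..<v} \<Longrightarrow> velocity M {u..v} \<gamma> t = velocity M UNIV \<gamma> t"
  using at_within_Icc_at[of u t v] unfolding velocity_def by (simp cong: if_cong)

lemma curve_length_eq: "curve_length M \<gamma> = arc_length 0 1 \<gamma>"
  unfolding curve_length_def arc_length_def
proof (rule integral_spike[of "{0, 1}"])
  show "speed \<gamma> t = tnorm M (\<gamma> t) (velocity M {0..1} \<gamma> t)" if "t \<in> {0..1} - {0, 1}" for t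
    using that velocity_interior[of t 0 1 \<gamma>] unfolding speed_def by (auto simp: less_le)
qed simp

lemma curve_stays_near:
  assumes "continuous_map (top_of_set I) (mtop M) \<gamma>" "openin (mtop M) W" "t \<in> I" "\<gamma> t \<in> W"
  obtains \<delta> :: real where "0 < \<delta>" "\<And>s. s \<in> I \<Longrightarrow> dist s t < \<delta> \<Longrightarrow> \<gamma> s \<in> W"
proof -
  have "openin (top_of_set I) {s \<in> I. \<gamma> s \<in> W}"
    using openin_continuous_map_preimage[OF assms(1,2)] by simp
  then obtain \<delta> where "0 < \<delta>" "\<forall>s\<in>I. dist s t < \<delta> \<longrightarrow> s \<in> {s \<in> I. \<gamma> s \<in> W}"
    using assms(3,4) unfolding openin_euclidean_subtopology_iff by blast
  then show thesis by (intro that[of \<delta>]) auto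
qed

text \<open>A curve that is differentiable in one chart is differentiable in all charts around the point, and
  its velocities there are related by the transition maps.\<close>

lemma velocity_eq_chart_vec:
  assumes c: "c \<in> charts_at M (\<gamma> t)" and t: "t \<in> I" "at t within I \<noteq> bot"
    and cont: "continuous_map (top_of_set I) (mtop M) \<gamma>"
    and der: "(snd c \<circ> \<gamma> has_vector_derivative x') (at t within I)"
  shows "velocity M I \<gamma> t = chart_vec M c (\<gamma> t) x'"
proof
  fix d
  show "velocity M I \<gamma> t d = chart_vec M c (\<gamma> t) x' d"
  proof (cases "d \<in> charts_at M (\<gamma> t)")
    case False
    then show ?thesis unfolding velocity_def chart_vec_def by simp
  next
    case True
    let ?D = "frechet_derivative (transition c d) (at (snd c (\<gamma> t)))"
    have cd: "c \<in> atlas M" "d \<in> atlas M" "\<gamma> t \<in> fst c" "\<gamma> t \<in> fst d"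
      using c True unfolding charts_at_def by auto
    have lin: "linear ?D" using has_derivative_linear transition_has_derivative[OF c True] by blast
    have D: "(transition c d has_derivative ?D) (at ((snd c \<circ> \<gamma>) t) within (snd c \<circ> \<gamma>) ` I)"
      using transition_has_derivative[OF c True] by (simp add: has_derivative_at_withinI)
    have "(transition c d \<circ> (snd c \<circ> \<gamma>) has_derivative ?D \<circ> (\<lambda>h. h *\<^sub>R x')) (at t within I)"
      using diff_chain_within[OF der[unfolded has_vector_derivative_def] D] .
    also have "?D \<circ> (\<lambda>h. h *\<^sub>R x') = (\<lambda>h. h *\<^sub>R ?D x')"
      using linear_scale[OF lin] by auto
    finally have 1: "(transition c d \<circ> (snd c \<circ> \<gamma>) has_derivative (\<lambda>h. h *\<^sub>R ?D x')) (at t within I)" .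
    have W: "openin (mtop M) (fst c \<inter> fst d)" using chart_open cd by blast
    obtain \<delta> where \<delta>: "0 < \<delta>" "\<And>s. s \<in> I \<Longrightarrow> dist s t < \<delta> \<Longrightarrow> \<gamma> s \<in> fst c \<inter> fst d"
      using curve_stays_near[OF cont W t(1)] cd by blast
    have "(snd d \<circ> \<gamma> has_derivative (\<lambda>h. h *\<^sub>R ?D x')) (at t within I)"
      by (rule has_derivative_transform_within[OF 1 \<delta>(1) t(1)]) (use \<delta>(2) cd in auto)
    then have "vector_derivative (snd d \<circ> \<gamma>) (at t within I) = ?D x'"
      by (intro vector_derivative_within t) (simp add: has_vector_derivative_def)
    then show ?thesis unfolding velocity_def chart_vec_def using True by simp
  qed
qed

lemma tnorm_velocity:
  assumes c: "c \<in> atlas M" "\<gamma> t \<in> fst c" and t: "t \<in> I" "at t within I \<noteq> bot"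
    and cont: "continuous_map (top_of_set I) (mtop M) \<gamma>"
    and der: "(snd c \<circ> \<gamma> has_vector_derivative x') (at t within I)"
  shows "tnorm M (\<gamma> t) (velocity M I \<gamma> t) = coeff_norm c (snd c (\<gamma> t)) x'"
  using velocity_eq_chart_vec[of c \<gamma> t I x'] assms metric_coeff_chart[OF c]
  unfolding tnorm_def form_norm_def charts_at_def by simp

lemma Icc_at_within_nonbot: "u < v \<Longrightarrow> t \<in> {u..v} \<Longrightarrow> at t within {u..v::real} \<noteq> bot"
  by (simp add: trivial_limit_within)

lemma C1_curveD:
  assumes "C1_curve M I \<gamma>"
  shows "continuous_map (top_of_set I) (mtop M) \<gamma>"
    and "\<lbrakk>c \<in> atlas M; t \<in> I; \<gamma> t \<in> fst c\<rbrakk> \<Longrightarrow>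
      (snd c \<circ> \<gamma> has_vector_derivative vector_derivative (snd c \<circ> \<gamma>) (at t within I)) (at t within I)"
    and "c \<in> atlas M \<Longrightarrow> continuous_on {t\<in>I. \<gamma> t \<in> fst c} (\<lambda>t. vector_derivative (snd c \<circ> \<gamma>) (at t within I))"
  using assms unfolding C1_curve_def Let_def by (auto simp flip: vector_derivative_works)

lemma continuous_on_form_norm:
  assumes c: "c \<in> atlas M" and y: "continuous_on J y" "y ` J \<subseteq> chart_image c" and v: "continuous_on J v"
  shows "continuous_on J (\<lambda>t. coeff_norm c (y t) (v t))"
proof -
  have g: "continuous_on J (\<lambda>t. metric_coeff M c (y t) i j)" for i j
    using continuous_on_compose2[OF smooth_onD(4)[OF metric_coeff_smooth[OF c]] y] .
  have "continuous_on J (\<lambda>t. sqrt (\<Sum>i\<in>Basis. \<Sum>j\<in>Basis. (v t \<bullet> i) * (v t \<bullet> j) * metric_coeff M c (y t) i j))"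
    by (intro continuous_intros g v)
  then show ?thesis
  proof (rule continuous_on_eq)
    fix t assume "t \<in> J"
    then have "inner_form (metric_coeff M c (y t))" using y(2) by (intro metric_coeff_inner(1)[OF c]) auto
    then show "sqrt (\<Sum>i\<in>Basis. \<Sum>j\<in>Basis. (v t \<bullet> i) * (v t \<bullet> j) * metric_coeff M c (y t) i j) = coeff_norm c (y t) (v t)"
      unfolding form_norm_def using inner_form_expand[of "metric_coeff M c (y t)" "v t" "v t"] by simp
  qed
qed

lemma chart_curve_continuous:
  assumes c: "c \<in> atlas M" and cont: "continuous_map (top_of_set I) (mtop M) \<gamma>"
    and J: "J \<subseteq> I" "\<gamma> ` J \<subseteq> fst c"
  shows "continuous_on J (snd c \<circ> \<gamma>)"
proof -
  have "continuous_map (top_of_set J) (mtop M) \<gamma>"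
    using continuous_map_from_subtopology_mono[OF cont J(1)] .
  then have "continuous_map (top_of_set J) (subtopology (mtop M) (fst c)) \<gamma>"
    using J(2) by (intro continuous_map_into_subtopology) auto
  then have "continuous_map (top_of_set J) euclidean (snd c \<circ> \<gamma>)"
    by (rule continuous_map_compose[OF _ chart_continuous[OF c]])
  then show ?thesis by simp
qed

text \<open>With one-sided derivatives the speed is continuous up to the end points of a smooth piece; this
  bounds it and yields integrability of the speed on the whole curve.\<close>

lemma C1_curve_speed_continuous:
  assumes C1: "C1_curve M {u..v} \<gamma>" and uv: "u < v"
  shows "continuous_on {u..v} (\<lambda>t. tnorm M (\<gamma> t) (velocity M {u..v} \<gamma> t))"
  unfolding continuous_on_eq_continuous_within
proof
  let ?h = "\<lambda>t. tnorm M (\<gamma> t) (velocity M {u..v} \<gamma> t)"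
  fix t assume t: "t \<in> {u..v}"
  note cont = C1_curveD(1)[OF C1]
  have "\<gamma> t \<in> topspace (mtop M)" using cont t unfolding continuous_map_def by auto
  then obtain c where c: "c \<in> atlas M" "\<gamma> t \<in> fst c" using chart_exists by blast
  define J where "J = {s\<in>{u..v}. \<gamma> s \<in> fst c}"
  let ?x' = "\<lambda>s. vector_derivative (snd c \<circ> \<gamma>) (at s within {u..v})"
  have J: "J \<subseteq> {u..v}" "\<gamma> ` J \<subseteq> fst c" unfolding J_def by auto
  have cx: "continuous_on J (snd c \<circ> \<gamma>)" by (rule chart_curve_continuous[OF c(1) cont J])
  have "continuous_on J (\<lambda>s. coeff_norm c ((snd c \<circ> \<gamma>) s) (?x' s))"
    using J C1_curveD(3)[OF C1 c(1)] c(1) unfolding J_def[symmetric]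
    by (intro continuous_on_form_norm c cx) auto
  then have "continuous_on J ?h"
  proof (rule continuous_on_eq)
    fix s assume "s \<in> J"
    then have s: "s \<in> {u..v}" "\<gamma> s \<in> fst c" unfolding J_def by auto
    then show "coeff_norm c ((snd c \<circ> \<gamma>) s) (?x' s) = ?h s"
      using tnorm_velocity[of c \<gamma> s "{u..v}" "?x' s"] c Icc_at_within_nonbot[OF uv s(1)] cont
        C1_curveD(2)[OF C1 c(1) s] by simp
  qed
  moreover have tJ: "t \<in> J" using t c unfolding J_def by simp
  ultimately have "continuous (at t within J) ?h" by (simp add: continuous_on_eq_continuous_within)
  moreover have "at t within J = at t within {u..v}"
  proof -
    obtain \<delta> where \<delta>: "0 < \<delta>" "\<And>s. s \<in> {u..v} \<Longrightarrow> dist s t < \<delta> \<Longrightarrow> \<gamma> s \<in> fst c"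
      using curve_stays_near[OF cont chart_open[OF c(1)] t c(2)] by blast
    show ?thesis
    proof (rule at_within_nhd[of _ "ball t \<delta>"])
      show "J \<inter> ball t \<delta> - {t} = {u..v} \<inter> ball t \<delta> - {t}"
        unfolding J_def using \<delta>(2) by (auto simp: dist_commute)
    qed (use \<delta> in auto)
  qed
  ultimately show "continuous (at t within {u..v}) ?h" by simp
qed

lemma pw_C1_subinterval: "\<lbrakk>pw_C1 a b S \<gamma>; a \<le> u; v \<le> b\<rbrakk> \<Longrightarrow> pw_C1 u v S \<gamma>"
  unfolding pw_C1_def by (meson order_trans)

lemma pw_C1_integrable:
  assumes pw: "pw_C1 a b S \<gamma>"
  shows "speed \<gamma> integrable_on {a..b}"
proof (cases "a < b")
  case False
  then show ?thesis
    using integrable_on_refl[of "speed \<gamma>" a] by (cases "a = b") (auto simp: integrable_on_empty)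
next
  case True
  have fin: "finite S" using pw unfolding pw_C1_def by blast
  show ?thesis
  proof (rule interval_induct_finite[OF fin True])
    fix u v assume uv: "a \<le> u" "u < v" "v \<le> b" "{u<..<v} \<inter> S = {}"
    then have C1: "C1_curve M {u..v} \<gamma>" using pw unfolding pw_C1_def by blast
    have "(\<lambda>t. tnorm M (\<gamma> t) (velocity M {u..v} \<gamma> t)) integrable_on {u..v}"
      by (rule integrable_continuous_real[OF C1_curve_speed_continuous[OF C1 uv(2)]])
    then show "speed \<gamma> integrable_on {u..v}"
    proof (rule integrable_spike_finite[of "{u, v}", rotated 2])
      show "speed \<gamma> t = tnorm M (\<gamma> t) (velocity M {u..v} \<gamma> t)" if "t \<in> {u..v} - {u, v}" for t
        using that velocity_interior[of t u v \<gamma>] unfolding speed_def by (auto simp: less_le)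
    qed simp
  next
    show "speed \<gamma> integrable_on {u..w}" if "u < v" "v < w" "speed \<gamma> integrable_on {u..v}" "speed \<gamma> integrable_on {v..w}" for u v w
      using that by (intro Henstock_Kurzweil_Integration.integrable_combine[of u v w]) auto
  qed
qed

lemma pw_C1_continuous:
  assumes pw: "pw_C1 a b S \<gamma>" and ab: "a < b"
  shows "continuous_map (top_of_set {a..b}) (mtop M) \<gamma>"
proof -
  have fin: "finite S" using pw unfolding pw_C1_def by blast
  show ?thesis
  proof (rule interval_induct_finite[OF fin ab])
    fix u v assume uv: "a \<le> u" "u < v" "v \<le> b" "{u<..<v} \<inter> S = {}"
    then have C1: "C1_curve M {u..v} \<gamma>" using pw unfolding pw_C1_def by blast
    then show "continuous_map (top_of_set {u..v}) (mtop M) \<gamma>" by (rule C1_curveD)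
  next
    fix u v w :: real
    assume uvw: "u < v" "v < w"
      and 1: "continuous_map (top_of_set {u..v}) (mtop M) \<gamma>" and 2: "continuous_map (top_of_set {v..w}) (mtop M) \<gamma>"
    have "continuous_map (top_of_set {u..w}) (mtop M) (\<lambda>x. if x \<le> v then \<gamma> x else \<gamma> x)"
    proof (rule continuous_map_cases_le)
      have "{u..w} \<inter> {x \<in> topspace (top_of_set {u..w}). x \<le> v} = {u..v}" using uvw by auto
      then show "continuous_map (subtopology (top_of_set {u..w}) {x \<in> topspace (top_of_set {u..w}). x \<le> v}) (mtop M) \<gamma>"
        using 1 by (simp only: subtopology_subtopology)
      have "{u..w} \<inter> {x \<in> topspace (top_of_set {u..w}). v \<le> x} = {v..w}" using uvw by auto
      then show "continuous_map (subtopology (top_of_set {u..w}) {x \<in> topspace (top_of_set {u..w}). v \<le> x}) (mtop M) \<gamma>"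
        using 2 by (simp only: subtopology_subtopology)
    qed auto
    then show "continuous_map (top_of_set {u..w}) (mtop M) \<gamma>" by simp
  qed
qed

lemma pw_C1_in_topspace: "\<lbrakk>pw_C1 a b S \<gamma>; a < b; t \<in> {a..b}\<rbrakk> \<Longrightarrow> \<gamma> t \<in> topspace (mtop M)"
  using pw_C1_continuous unfolding continuous_map_def by fastforce

lemma regular_point:
  assumes pw: "pw_C1 a b S \<gamma>" and t: "t \<in> {a<..<b} - S"
  obtains u v where "a \<le> u" "u < t" "t < v" "v \<le> b" "C1_curve M {u..v} \<gamma>"
proof -
  have "open ({a<..<b} - S)"
    using pw unfolding pw_C1_def by (intro open_Diff) (auto simp: finite_imp_closed)
  then obtain e where e: "0 < e" "cball t e \<subseteq> {a<..<b} - S" using t open_contains_cball by blast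
  then have sub: "{t - e..t + e} \<subseteq> {a<..<b} - S" by (simp add: cball_eq_atLeastAtMost)
  have "t - e \<in> {t - e..t + e}" "t + e \<in> {t - e..t + e}" using e(1) by auto
  then have "t - e \<in> {a<..<b} - S" "t + e \<in> {a<..<b} - S" using sub by blast+
  then have uv: "a \<le> t - e" "t + e \<le> b" by auto
  have "{t - e<..<t + e} \<inter> S = {}" using sub by (auto simp: subset_iff)
  then have "C1_curve M {t - e..t + e} \<gamma>" using pw uv e(1) unfolding pw_C1_def by auto
  then show thesis using that[of "t - e" "t + e"] uv e(1) by simp
qed

lemma pw_C1_speed:
  assumes pw: "pw_C1 a b S \<gamma>" and t: "t \<in> {a<..<b} - S" and c: "c \<in> atlas M" "\<gamma> t \<in> fst c"
  shows "(snd c \<circ> \<gamma> has_vector_derivative vector_derivative (snd c \<circ> \<gamma>) (at t)) (at t)"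
    and "speed \<gamma> t = coeff_norm c (snd c (\<gamma> t)) (vector_derivative (snd c \<circ> \<gamma>) (at t))"
proof -
  obtain u v where uv: "a \<le> u" "u < t" "t < v" "v \<le> b" and C1: "C1_curve M {u..v} \<gamma>"
    using regular_point[OF pw t] .
  have at: "at t within {u..v} = at t" using uv by (intro at_within_Icc_at)
  have tuv: "t \<in> {u..v}" "u < v" using uv by auto
  note der = C1_curveD(2)[OF C1 c(1) tuv(1) c(2)]
  show "(snd c \<circ> \<gamma> has_vector_derivative vector_derivative (snd c \<circ> \<gamma>) (at t)) (at t)"
    using der unfolding at .
  have "velocity M {u..v} \<gamma> t = velocity M UNIV \<gamma> t" using uv by (intro velocity_interior) auto
  then show "speed \<gamma> t = coeff_norm c (snd c (\<gamma> t)) (vector_derivative (snd c \<circ> \<gamma>) (at t))"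
    using tnorm_velocity[OF c tuv(1) Icc_at_within_nonbot[OF tuv(2,1)] C1_curveD(1)[OF C1] der]
    unfolding speed_def at by simp
qed

lemma speed_nonneg:
  assumes pw: "pw_C1 a b S \<gamma>" and t: "t \<in> {a<..<b} - S"
  shows "0 \<le> speed \<gamma> t"
proof -
  have "\<gamma> t \<in> topspace (mtop M)" using pw_C1_in_topspace[OF pw] t by auto
  then obtain c where c: "c \<in> atlas M" "\<gamma> t \<in> fst c" using chart_exists by blast
  show ?thesis
    unfolding pw_C1_speed(2)[OF pw t c] using c by (intro form_norm_nonneg metric_coeff_inner) auto
qed

lemma arc_length_nonneg:
  assumes pw: "pw_C1 a b S \<gamma>"
  shows "0 \<le> arc_length a b \<gamma>"
proof -
  have fin: "finite (S \<union> {a, b})" using pw unfolding pw_C1_def by blast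
  have "arc_length a b \<gamma> = integral {a..b} (\<lambda>t. if t \<in> {a<..<b} - S then speed \<gamma> t else 0)"
    unfolding arc_length_def by (rule integral_spike[OF negligible_finite[OF fin]]) (auto simp: less_le)
  also have "0 \<le> \<dots>"
  proof (rule integral_nonneg)
    show "(\<lambda>t. if t \<in> {a<..<b} - S then speed \<gamma> t else 0) integrable_on {a..b}"
      by (rule integrable_spike_finite[OF fin _ pw_C1_integrable[OF pw]]) (auto simp: less_le)
  qed (use speed_nonneg[OF pw] in auto)
  finally show ?thesis .
qed

lemma arc_length_add:
  assumes "pw_C1 a c S \<gamma>" "a \<le> b" "b \<le> c"
  shows "arc_length a c \<gamma> = arc_length a b \<gamma> + arc_length b c \<gamma>"
  unfolding arc_length_def
  using Henstock_Kurzweil_Integration.integral_combine[OF assms(2,3) pw_C1_integrable[OF assms(1)]] by simp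

lemma arc_length_mono:
  assumes "pw_C1 a b S \<gamma>" "a \<le> u" "u \<le> b"
  shows "arc_length a u \<gamma> \<le> arc_length a b \<gamma>"
  using arc_length_add[OF assms] arc_length_nonneg[OF pw_C1_subinterval[OF assms(1,2) order_refl]] by simp

text \<open>Pairing the coordinate curve with its total displacement \<open>w\<close> reduces the claim to the fundamental
  theorem of calculus for a real function: its derivative is at most \<open>k\<close> times the speed times the norm
  of \<open>w\<close> by the Cauchy--Schwarz inequality, and its increment is the squared norm of \<open>w\<close>.\<close>

lemma arc_length_ge_chart_distance:
  assumes pw: "pw_C1 a b S \<gamma>" and ab: "a < b" and c: "c \<in> atlas M"
    and inB: "\<And>t. t \<in> {a..b} \<Longrightarrow> \<gamma> t \<in> fst c"
    and g: "inner_form g" and k: "0 \<le> k"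
    and cmp: "\<And>t v. t \<in> {a..b} \<Longrightarrow> form_norm g v \<le> k * coeff_norm c (snd c (\<gamma> t)) v"
  shows "form_norm g (snd c (\<gamma> b) - snd c (\<gamma> a)) \<le> k * arc_length a b \<gamma>"
proof -
  let ?y = "snd c \<circ> \<gamma>"
  define w where "w = ?y b - ?y a"
  have fin: "finite (S \<union> {a, b})" and finS: "finite S" using pw unfolding pw_C1_def by auto
  have bl: "bounded_linear (\<lambda>v. g v w)"
    by (rule linear_conv_bounded_linear[THEN iffD1], rule linearI) (simp_all add: form_add_left[OF g] form_scale_left[OF g])
  let ?y' = "\<lambda>t. vector_derivative ?y (at t)"
  have 1: "((\<lambda>t. g (?y' t) w) has_integral (g (?y b) w - g (?y a) w)) {a..b}"
  proof (rule fundamental_theorem_of_calculus_interior_strong[OF finS])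
    show "((\<lambda>t. g (?y t) w) has_vector_derivative g (?y' t) w) (at t)" if t: "t \<in> {a<..<b} - S" for t
      using bounded_linear.has_vector_derivative[OF bl pw_C1_speed(1)[OF pw t c]] inB t by auto
    have "continuous_on {a..b} ?y"
      by (rule chart_curve_continuous[OF c pw_C1_continuous[OF pw ab]]) (use inB in auto)
    then show "continuous_on {a..b} (\<lambda>t. g (?y t) w)"
      by (rule bounded_linear.continuous_on[OF bl])
  qed (use ab in simp)
  define R where "R = {a<..<b} - S"
  (* off the regular points the speed has no sign, so both integrands are set to 0 there *)
  have 2: "((\<lambda>t. if t \<in> R then g (?y' t) w else 0) has_integral (form_norm g w)\<^sup>2) {a..b}"
  proof (rule has_integral_spike_finite[OF fin])
    show "((\<lambda>t. g (?y' t) w) has_integral (form_norm g w)\<^sup>2) {a..b}"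
      using 1 unfolding form_norm_square[OF g] w_def by (simp add: form_diff_left[OF g])
  qed (auto simp: less_le R_def)
  have "(speed \<gamma> has_integral arc_length a b \<gamma>) {a..b}"
    unfolding arc_length_def using pw_C1_integrable[OF pw] by (rule integrable_integral)
  then have "((\<lambda>t. (k * form_norm g w) * speed \<gamma> t) has_integral (k * form_norm g w) * arc_length a b \<gamma>) {a..b}"
    by (rule has_integral_mult_right)
  then have 3: "((\<lambda>t. if t \<in> R then (k * form_norm g w) * speed \<gamma> t else 0) has_integral (k * form_norm g w) * arc_length a b \<gamma>) {a..b}"
    by (rule has_integral_spike_finite[OF fin, rotated]) (auto simp: less_le R_def)
  have "(form_norm g w)\<^sup>2 \<le> (k * form_norm g w) * arc_length a b \<gamma>"
  proof (rule has_integral_le[OF 2 3])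
    fix t assume "t \<in> {a..b}"
    show "(if t \<in> R then g (?y' t) w else 0) \<le> (if t \<in> R then (k * form_norm g w) * speed \<gamma> t else 0)"
    proof (cases "t \<in> R")
      case True
      then have tc: "\<gamma> t \<in> fst c" and t: "t \<in> {a..b}" using inB unfolding R_def by auto
      have "g (?y' t) w \<le> form_norm g (?y' t) * form_norm g w" by (rule form_Cauchy_Schwarz[OF g])
      also have "\<dots> \<le> (k * speed \<gamma> t) * form_norm g w"
        unfolding pw_C1_speed(2)[OF pw True[unfolded R_def] c tc]
        by (intro mult_right_mono cmp[OF t] form_norm_nonneg[OF g])
      finally show ?thesis using True by (simp add: mult_ac)
    qed simp
  qed
  then have "form_norm g w * form_norm g w \<le> form_norm g w * (k * arc_length a b \<gamma>)"
    by (simp add: power2_eq_square mult_ac)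
  then have "form_norm g w \<le> k * arc_length a b \<gamma>"
    using form_norm_nonneg[OF g, of w] arc_length_nonneg[OF pw] k
    by (cases "form_norm g w = 0") (auto simp: mult_le_cancel_left)
  then show ?thesis unfolding w_def by simp
qed

lemma inner_form_inner: "inner_form (inner :: 'e \<Rightarrow> 'e \<Rightarrow> real)"
  unfolding inner_form_def by (auto simp: inner_commute inner_add_left inner_add_right)

lemma form_norm_inner: "form_norm (inner :: 'e \<Rightarrow> 'e \<Rightarrow> real) v = norm v"
  unfolding form_norm_def by (simp add: norm_eq_sqrt_inner)

text \<open>Compact subsets of a chart are closed in the manifold, as it is a Hausdorff space. This excludes
  that a curve leaves the chart without crossing a coordinate sphere.\<close>

lemma chart_compact_closedin:
  assumes c: "c \<in> atlas M" and B: "compact B" "B \<subseteq> chart_image c"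
  shows "closedin (mtop M) {p \<in> fst c. snd c p \<in> B}"
proof -
  have "compactin (top_of_set (chart_image c)) B"
    using B by (simp add: compactin_subtopology)
  then have "compactin (mtop M) (chart_inv c ` B)"
    by (rule image_compactin[OF _ chart_inv_continuous[OF c]])
  moreover have "chart_inv c ` B = {p \<in> fst c. snd c p \<in> B}"
  proof
    show "chart_inv c ` B \<subseteq> {p \<in> fst c. snd c p \<in> B}" using B(2) c by (auto simp: subset_iff)
    show "{p \<in> fst c. snd c p \<in> B} \<subseteq> chart_inv c ` B"
    proof
      fix p assume "p \<in> {p \<in> fst c. snd c p \<in> B}"
      then show "p \<in> chart_inv c ` B" using c by (intro image_eqI[of _ _ "snd c p"]) auto
    qed
  qed
  ultimately show ?thesis using compactin_imp_closedin[OF Hausdorff] by simp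
qed

text \<open>At the first time \<open>t1\<close> at which the curve leaves the open coordinate ball it is still in the closed
  one, hence on its boundary; but the length up to \<open>t1\<close> is too small for such a displacement.\<close>

lemma short_curve_stays_in_chart:
  assumes c: "c \<in> atlas M" and B: "B \<subseteq> chart_image c" "0 < lam"
    "\<And>x v. x \<in> B \<Longrightarrow> lam * norm v \<le> coeff_norm c x v"
    and pw: "pw_C1 a b S \<gamma>" and ab: "a < b" and p: "\<gamma> a \<in> fst c"
    and sub: "cball (snd c (\<gamma> a)) \<rho> \<subseteq> B" and len: "arc_length a b \<gamma> < lam * \<rho>"
    and t: "t \<in> {a..b}"
  shows "\<gamma> t \<in> fst c \<and> norm (snd c (\<gamma> t) - snd c (\<gamma> a)) < \<rho>"
proof (rule ccontr)
  let ?x = "snd c (\<gamma> a)"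
  define U where "U = {q \<in> fst c. snd c q \<in> ball ?x \<rho>}"
  define V where "V = {q \<in> fst c. snd c q \<in> cball ?x \<rho>}"
  note cont = pw_C1_continuous[OF pw ab]
  assume "\<not> ?thesis"
  then have tU: "\<gamma> t \<notin> U" unfolding U_def by (auto simp: dist_norm norm_minus_commute)
  have "0 \<le> arc_length a b \<gamma>" by (rule arc_length_nonneg[OF pw])
  then have \<rho>: "0 < \<rho>" using len B(2) by (metis le_less_trans zero_less_mult_pos)
  have "openin (subtopology (mtop M) (fst c)) U"
    using openin_continuous_map_preimage[OF chart_continuous[OF c], of "ball ?x \<rho>"] chart_subset[OF c]
    unfolding U_def by (simp add: inf.absorb2 open_openin[symmetric])
  then have "openin (mtop M) U" using chart_open[OF c] openin_trans_full by blast
  then have "openin (top_of_set {a..b}) {s \<in> {a..b}. \<gamma> s \<in> U}"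
    using openin_continuous_map_preimage[OF cont] by simp
  then have "closedin (top_of_set {a..b}) ({a..b} - {s \<in> {a..b}. \<gamma> s \<in> U})"
    by (intro closedin_diff) simp_all
  moreover define P where "P = {s \<in> {a..b}. \<gamma> s \<notin> U}"
  moreover have "{a..b} - {s \<in> {a..b}. \<gamma> s \<in> U} = P" unfolding P_def by auto
  ultimately have "closed P" using closedin_closed_trans[of "{a..b}" P] by simp
  moreover have "P \<noteq> {}" "bdd_below P" using t tU unfolding P_def by (auto intro!: bdd_belowI[of _ a])
  ultimately have "Inf P \<in> P" by (rule closed_contains_Inf[rotated 2])
  then obtain t1 where t1: "t1 = Inf P" "t1 \<in> P" by blast
  have before: "\<gamma> s \<in> U" if "s \<in> {a..b}" "s < t1" for s
    using cInf_lower[OF _ \<open>bdd_below P\<close>, of s] that unfolding t1(1) P_def by force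
  have aU: "\<gamma> a \<in> U" using p \<rho> unfolding U_def by simp
  have t1ab: "a < t1" "t1 \<le> b" using t1(2) aU unfolding P_def by (auto simp: less_le)
  have "compact (cball ?x \<rho>)" by simp
  then have "closedin (mtop M) V"
    unfolding V_def using chart_compact_closedin[OF c] sub B(1) by blast
  then have "closedin (top_of_set {a..b}) {s \<in> {a..b}. \<gamma> s \<in> V}"
    using closedin_continuous_map_preimage[OF cont] by simp
  then have Vclosed: "closed {s \<in> {a..b}. \<gamma> s \<in> V}"
    using closedin_closed_trans by blast
  have "{a..<t1} \<subseteq> {s \<in> {a..b}. \<gamma> s \<in> V}"
    using before t1ab unfolding U_def V_def by (auto intro: less_imp_le)
  then have "closure {a..<t1} \<subseteq> {s \<in> {a..b}. \<gamma> s \<in> V}"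
    by (rule closure_minimal[OF _ Vclosed])
  then have inV: "\<gamma> s \<in> V" if "s \<in> {a..t1}" for s
    using t1ab that by (auto simp: closure_atLeastLessThan subset_iff)
  have pw1: "pw_C1 a t1 S \<gamma>" using pw_C1_subinterval[OF pw] t1ab by simp
  have "form_norm inner (snd c (\<gamma> t1) - snd c (\<gamma> a)) \<le> (1 / lam) * arc_length a t1 \<gamma>"
  proof (rule arc_length_ge_chart_distance[OF pw1 t1ab(1) c _ inner_form_inner])
    show "form_norm inner v \<le> 1 / lam * coeff_norm c (snd c (\<gamma> s)) v" if "s \<in> {a..t1}" for s v
      using B(3)[of "snd c (\<gamma> s)" v] inV[OF that] sub B(2) unfolding form_norm_inner V_def
      by (auto simp: field_simps)
  qed (use inV B(2) in \<open>auto simp: V_def\<close>)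
  then have "norm (snd c (\<gamma> t1) - ?x) \<le> arc_length a t1 \<gamma> / lam" unfolding form_norm_inner by simp
  also have "\<dots> \<le> arc_length a b \<gamma> / lam"
    using arc_length_mono[OF pw] t1ab B(2) by (intro divide_right_mono) auto
  also have "\<dots> < \<rho>" using len B(2) by (simp add: field_simps)
  finally have "\<gamma> t1 \<in> U"
    using inV[of t1] t1ab unfolding U_def V_def by (auto simp: dist_norm norm_minus_commute)
  then show False using t1(2) unfolding P_def by simp
qed

lemma C1_curveI:
  assumes uv: "u < v" and cont: "continuous_map (top_of_set {u..v}) (mtop M) \<gamma>"
    and der: "\<And>c t. \<lbrakk>c \<in> atlas M; t \<in> {u..v}; \<gamma> t \<in> fst c\<rbrakk> \<Longrightarrow> (snd c \<circ> \<gamma> has_vector_derivative D c t) (at t within {u..v})"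
    and contD: "\<And>c. c \<in> atlas M \<Longrightarrow> continuous_on {t\<in>{u..v}. \<gamma> t \<in> fst c} (D c)"
  shows "C1_curve M {u..v} \<gamma>"
  unfolding C1_curve_def Let_def
proof (intro conjI ballI cont)
  fix c assume c: "c \<in> atlas M"
  show "(snd c \<circ> \<gamma>) differentiable (at t within {u..v})" if "t \<in> {t\<in>{u..v}. \<gamma> t \<in> fst c}" for t
    using der[OF c, of t] that by (auto intro: differentiableI_vector)
  show "continuous_on {t\<in>{u..v}. \<gamma> t \<in> fst c} (\<lambda>t. vector_derivative (snd c \<circ> \<gamma>) (at t within {u..v}))"
  proof (rule continuous_on_eq[OF contD[OF c]])
    fix t assume t: "t \<in> {t\<in>{u..v}. \<gamma> t \<in> fst c}"
    then show "D c t = vector_derivative (snd c \<circ> \<gamma>) (at t within {u..v})"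
      using vector_derivative_within_closed_interval[OF uv _ der[OF c, of t]] by simp
  qed
qed

lemma C1_curve_cong:
  assumes uv: "u < v" and C1: "C1_curve M {u..v} \<gamma>" and eq: "\<And>t. t \<in> {u..v} \<Longrightarrow> \<gamma>' t = \<gamma> t"
  shows "C1_curve M {u..v} \<gamma>'"
proof (rule C1_curveI[OF uv])
  show "continuous_map (top_of_set {u..v}) (mtop M) \<gamma>'"
    by (rule continuous_map_eq[OF C1_curveD(1)[OF C1]]) (use eq in auto)
  fix c assume c: "c \<in> atlas M"
  let ?D = "\<lambda>c t. vector_derivative (snd c \<circ> \<gamma>) (at t within {u..v})"
  show "(snd c \<circ> \<gamma>' has_vector_derivative ?D c t) (at t within {u..v})" if "t \<in> {u..v}" "\<gamma>' t \<in> fst c" for t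
    by (rule has_vector_derivative_transform[OF that(1) _ C1_curveD(2)[OF C1 c that(1)]]) (use eq that in auto)
  have "{t\<in>{u..v}. \<gamma>' t \<in> fst c} = {t\<in>{u..v}. \<gamma> t \<in> fst c}" using eq by auto
  then show "continuous_on {t\<in>{u..v}. \<gamma>' t \<in> fst c} (?D c)"
    using C1_curveD(3)[OF C1 c] by simp
qed

lemma C1_curve_affine:
  assumes C1: "C1_curve M {u'..v'} \<gamma>" and uv: "u < v"
    and h: "h = (\<lambda>t. k * t + m)" and img: "h ` {u..v} = {u'..v'}"
  shows "C1_curve M {u..v} (\<gamma> \<circ> h)"
proof (rule C1_curveI[OF uv])
  have ch: "continuous_on A h" for A unfolding h by (intro continuous_intros)
  have "continuous_map (top_of_set {u..v}) (top_of_set {u'..v'}) h"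
    using ch img by (simp add: continuous_map_in_subtopology image_subset_iff_funcset[symmetric])
  then show "continuous_map (top_of_set {u..v}) (mtop M) (\<gamma> \<circ> h)"
    by (rule continuous_map_compose[OF _ C1_curveD(1)[OF C1]])
  fix c assume c: "c \<in> atlas M"
  let ?D = "\<lambda>c t. k *\<^sub>R vector_derivative (snd c \<circ> \<gamma>) (at (h t) within {u'..v'})"
  show "(snd c \<circ> (\<gamma> \<circ> h) has_vector_derivative ?D c t) (at t within {u..v})"
    if t: "t \<in> {u..v}" "(\<gamma> \<circ> h) t \<in> fst c" for t
  proof -
    have ht: "h t \<in> {u'..v'}" using img t(1) by blast
    have hd: "(h has_vector_derivative k) (at t within {u..v})"
      unfolding h by (auto intro!: derivative_eq_intros)
    have gd: "(snd c \<circ> \<gamma> has_vector_derivative vector_derivative (snd c \<circ> \<gamma>) (at (h t) within {u'..v'})) (at (h t) within h ` {u..v})"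
      unfolding img by (rule C1_curveD(2)[OF C1 c ht]) (use t in simp)
    show ?thesis using vector_diff_chain_within[OF hd gd] unfolding o_assoc .
  qed
  show "continuous_on {t\<in>{u..v}. (\<gamma> \<circ> h) t \<in> fst c} (?D c)"
  proof (intro continuous_on_scaleR continuous_on_const)
    show "continuous_on {t\<in>{u..v}. (\<gamma> \<circ> h) t \<in> fst c} (\<lambda>t. vector_derivative (snd c \<circ> \<gamma>) (at (h t) within {u'..v'}))"
      by (rule continuous_on_compose2[OF C1_curveD(3)[OF C1 c] ch]) (use img in auto)
  qed
qed

text \<open>Negative \<open>k\<close> is included; it reverses the curve.\<close>

lemma pw_C1_affine:
  assumes pw: "pw_C1 a b S \<gamma>" and k: "k \<noteq> 0" and pq: "p < q" and ab: "a < b"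
    and h: "h = (\<lambda>t. k * t + m)" and img: "h ` {p..q} = {a..b}"
  shows "pw_C1 p q (h -` S) (\<gamma> \<circ> h)" and "arc_length p q (\<gamma> \<circ> h) = arc_length a b \<gamma>"
proof -
  have inj: "inj h" unfolding h using k by (auto intro: injI)
  have fin: "finite (h -` S)" "finite (h -` (S \<union> {a, b}))"
    using pw inj unfolding pw_C1_def by (auto intro: finite_vimageI)
  show pw': "pw_C1 p q (h -` S) (\<gamma> \<circ> h)"
    unfolding pw_C1_def
  proof (intro conjI allI impI fin)
    fix u v assume uv: "p \<le> u \<and> u < v \<and> v \<le> q \<and> {u<..<v} \<inter> h -` S = {}"
    define u' where "u' = min (h u) (h v)"
    define v' where "v' = max (h u) (h v)"
    have i: "h ` {u..v} = {u'..v'}"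
      using uv k mult_strict_left_mono[of u v k] mult_strict_left_mono_neg[of u v k]
      unfolding h u'_def v'_def image_affinity_atLeastAtMost by (auto simp: min_def max_def)
    have "{u'..v'} \<subseteq> {a..b}" unfolding i[symmetric] img[symmetric] using uv by (intro image_mono) auto
    moreover have u'v': "u' < v'"
      using injD[OF inj, of u v] uv unfolding u'_def v'_def by (auto simp: min_def max_def)
    ultimately have sub: "a \<le> u'" "v' \<le> b" by auto
    have "{u'<..<v'} \<inter> S = {}"
    proof (rule ccontr)
      assume "\<not> ?thesis"
      then obtain s where s: "s \<in> S" "u' < s" "s < v'" by auto
      then have "s \<in> h ` {u..v}" unfolding i by simp
      then obtain t where t: "t \<in> {u..v}" "s = h t" by blast
      then have "t \<noteq> u" "t \<noteq> v" using s unfolding u'_def v'_def by auto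
      then have "t \<in> {u<..<v} \<inter> h -` S" using t s by auto
      then show False using uv by blast
    qed
    then have "C1_curve M {u'..v'} \<gamma>" using pw sub u'v' unfolding pw_C1_def by blast
    then show "C1_curve M {u..v} (\<gamma> \<circ> h)" using C1_curve_affine[OF _ _ h i] uv by blast
  qed
  have "(speed \<gamma> has_integral arc_length a b \<gamma>) (cbox a b)"
    unfolding arc_length_def using pw_C1_integrable[OF pw] by (simp add: integrable_integral)
  from has_integral_affinity[OF this k, of m]
  have "((\<lambda>t. speed \<gamma> (h t)) has_integral (1 / \<bar>k\<bar>) * arc_length a b \<gamma>) ((\<lambda>x. (1 / k) * x + - ((1 / k) * m)) ` {a..b})"
    unfolding h by simp
  also have "(\<lambda>x. (1 / k) * x + - ((1 / k) * m)) ` {a..b} = {p..q}"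
    unfolding img[symmetric] image_image h using k by (simp add: field_simps)
  finally have "((\<lambda>t. \<bar>k\<bar> * speed \<gamma> (h t)) has_integral \<bar>k\<bar> * ((1 / \<bar>k\<bar>) * arc_length a b \<gamma>)) {p..q}"
    by (rule has_integral_mult_right)
  then have I: "((\<lambda>t. \<bar>k\<bar> * speed \<gamma> (h t)) has_integral arc_length a b \<gamma>) {p..q}"
    using k by simp
  have "(speed (\<gamma> \<circ> h) has_integral arc_length a b \<gamma>) {p..q}"
  proof (rule has_integral_spike_finite[OF _ _ I])
    show "finite (h -` (S \<union> {a, b}) \<union> {p, q})" using fin by simp
    fix t assume t: "t \<in> {p..q} - (h -` (S \<union> {a, b}) \<union> {p, q})"
    then have t1: "t \<in> {p<..<q} - h -` S" by auto
    have "h t \<in> {a..b}" using t img by blast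
    then have ht: "h t \<in> {a<..<b} - S" using t by (auto simp: less_le)
    then have "\<gamma> (h t) \<in> topspace (mtop M)" using pw_C1_in_topspace[OF pw ab] by auto
    then obtain c where c: "c \<in> atlas M" "\<gamma> (h t) \<in> fst c" using chart_exists by blast
    have c': "(\<gamma> \<circ> h) t \<in> fst c" using c by simp
    have hd: "(h has_vector_derivative k) (at t)" unfolding h by (auto intro!: derivative_eq_intros)
    have "(snd c \<circ> \<gamma> \<circ> h has_vector_derivative k *\<^sub>R vector_derivative (snd c \<circ> \<gamma>) (at (h t))) (at t)"
      by (rule vector_diff_chain_at[OF hd pw_C1_speed(1)[OF pw ht c]])
    then have vd: "vector_derivative (snd c \<circ> (\<gamma> \<circ> h)) (at t) = k *\<^sub>R vector_derivative (snd c \<circ> \<gamma>) (at (h t))"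
      using vector_derivative_at by (simp add: o_assoc)
    have "inner_form (metric_coeff M c (snd c (\<gamma> (h t))))" using c by (intro metric_coeff_inner) auto
    then show "speed (\<gamma> \<circ> h) t = \<bar>k\<bar> * speed \<gamma> (h t)"
      unfolding pw_C1_speed(2)[OF pw' t1 c(1) c'] pw_C1_speed(2)[OF pw ht c] vd
      by (simp add: form_norm_scale)
  qed
  then show "arc_length p q (\<gamma> \<circ> h) = arc_length a b \<gamma>"
    unfolding arc_length_def[of p q] by (rule integral_unique)
qed

lemma pw_C1_join:
  assumes 1: "pw_C1 a b S1 \<gamma>1" and 2: "pw_C1 b c S2 \<gamma>2" and abc: "a < b" "b < c" and eq: "\<gamma>1 b = \<gamma>2 b"
  defines "\<gamma> \<equiv> \<lambda>t. if t \<le> b then \<gamma>1 t else \<gamma>2 t"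
  shows "pw_C1 a c (S1 \<union> S2 \<union> {b}) \<gamma>" and "arc_length a c \<gamma> = arc_length a b \<gamma>1 + arc_length b c \<gamma>2"
proof -
  show pw: "pw_C1 a c (S1 \<union> S2 \<union> {b}) \<gamma>"
    unfolding pw_C1_def
  proof (intro conjI allI impI)
    show "finite (S1 \<union> S2 \<union> {b})" using 1 2 unfolding pw_C1_def by simp
    fix u v assume uv: "a \<le> u \<and> u < v \<and> v \<le> c \<and> {u<..<v} \<inter> (S1 \<union> S2 \<union> {b}) = {}"
    then have "b \<notin> {u<..<v}" by blast
    then consider "v \<le> b" | "b \<le> u" by force
    then show "C1_curve M {u..v} \<gamma>"
    proof cases
      case 1
      then have "C1_curve M {u..v} \<gamma>1" using uv assms(1) unfolding pw_C1_def by blast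
      then show ?thesis
        by (rule C1_curve_cong[rotated]) (use 1 uv in \<open>auto simp: \<gamma>_def\<close>)
    next
      case 2
      then have "C1_curve M {u..v} \<gamma>2" using uv assms(2) unfolding pw_C1_def by blast
      then show ?thesis
      proof (rule C1_curve_cong[rotated])
        show "\<gamma> t = \<gamma>2 t" if "t \<in> {u..v}" for t
          using 2 that eq by (cases "t = b") (auto simp: \<gamma>_def)
      qed (use uv in simp)
    qed
  qed
  have local: "speed \<gamma> t = speed \<gamma>' t" if "open T" "t \<in> T" "\<And>s. s \<in> T \<Longrightarrow> \<gamma> s = \<gamma>' s" for t T \<gamma>'
  proof -
    have "eventually (\<lambda>s. s \<in> T) (nhds t)" using that by (simp add: eventually_nhds_in_open)
    then have "vector_derivative (snd e \<circ> \<gamma>) (at t) = vector_derivative (snd e \<circ> \<gamma>') (at t)" for e :: "('a, 'e) chart"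
      by (intro vector_derivative_cong_eq) (auto elim!: eventually_mono simp: that(3))
    then show ?thesis unfolding speed_def velocity_def using that by (simp cong: if_cong)
  qed
  have "arc_length a b \<gamma> = arc_length a b \<gamma>1"
    unfolding arc_length_def
  proof (rule integral_spike[of "{a, b}"])
    show "speed \<gamma>1 t = speed \<gamma> t" if "t \<in> {a..b} - {a, b}" for t
      using that by (intro local[symmetric, of "{..<b}"]) (auto simp: \<gamma>_def)
  qed simp
  moreover have "arc_length b c \<gamma> = arc_length b c \<gamma>2"
    unfolding arc_length_def
  proof (rule integral_spike[of "{b, c}"])
    show "speed \<gamma>2 t = speed \<gamma> t" if "t \<in> {b..c} - {b, c}" for t
      using that by (intro local[symmetric, of "{b<..}"]) (auto simp: \<gamma>_def)
  qed simp
  ultimately show "arc_length a c \<gamma> = arc_length a b \<gamma>1 + arc_length b c \<gamma>2"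
    using arc_length_add[OF pw, of b] abc by simp
qed

section \<open>The Riemannian distance\<close>

lemma rdist_le:
  assumes pw: "pw_C1 a b S \<gamma>" and ab: "a < b"
  shows "rdist M (\<gamma> a) (\<gamma> b) \<le> ereal (arc_length a b \<gamma>)" "rdist M (\<gamma> b) (\<gamma> a) \<le> ereal (arc_length a b \<gamma>)"
proof -
  define h where "h = (\<lambda>t. (b - a) * t + a)"
  have "h ` {0..1} = {a..b}" unfolding h_def image_affinity_atLeastAtMost using ab by simp
  note H = pw_C1_affine[OF pw _ _ ab h_def this]
  have "piecewise_C1_curve M (\<gamma> \<circ> h)" "curve_length M (\<gamma> \<circ> h) = arc_length a b \<gamma>"
    using H ab unfolding piecewise_C1_curve_iff curve_length_eq by auto
  then show "rdist M (\<gamma> a) (\<gamma> b) \<le> ereal (arc_length a b \<gamma>)"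
    unfolding rdist_def by (intro Inf_lower CollectI exI[of _ "\<gamma> \<circ> h"]) (auto simp: h_def)
  define h' where "h' = (\<lambda>t. (a - b) * t + b)"
  have "h' ` {0..1} = {a..b}" unfolding h'_def image_affinity_atLeastAtMost using ab by simp
  note H' = pw_C1_affine[OF pw _ _ ab h'_def this]
  have "piecewise_C1_curve M (\<gamma> \<circ> h')" "curve_length M (\<gamma> \<circ> h') = arc_length a b \<gamma>"
    using H' ab unfolding piecewise_C1_curve_iff curve_length_eq by auto
  then show "rdist M (\<gamma> b) (\<gamma> a) \<le> ereal (arc_length a b \<gamma>)"
    unfolding rdist_def by (intro Inf_lower CollectI exI[of _ "\<gamma> \<circ> h'"]) (auto simp: h'_def)
qed

lemma rdist_less_curve:
  assumes "rdist M x y < ereal L"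
  obtains \<gamma> S where "pw_C1 0 1 S \<gamma>" "\<gamma> 0 = x" "\<gamma> 1 = y" "arc_length 0 1 \<gamma> < L"
  using assms unfolding rdist_def Inf_less_iff piecewise_C1_curve_iff curve_length_eq by auto

lemma rdist_nonneg: "0 \<le> rdist M x y"
  unfolding rdist_def
  by (intro Inf_greatest) (auto simp: piecewise_C1_curve_iff curve_length_eq arc_length_nonneg)

lemma rdist_commute: "rdist M x y = rdist M y x"
proof -
  have "rdist M y x \<le> rdist M x y" for x y
  proof (subst (2) rdist_def, intro Inf_greatest)
    fix l assume "l \<in> {ereal (curve_length M \<gamma>) |\<gamma>. piecewise_C1_curve M \<gamma> \<and> \<gamma> 0 = x \<and> \<gamma> 1 = y}"
    then obtain \<gamma> S where "pw_C1 0 1 S \<gamma>" "\<gamma> 0 = x" "\<gamma> 1 = y" "l = ereal (arc_length 0 1 \<gamma>)"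
      unfolding piecewise_C1_curve_iff curve_length_eq by blast
    then show "rdist M y x \<le> l" using rdist_le(2)[of 0 1 S \<gamma>] by simp
  qed
  then show ?thesis by (simp add: antisym)
qed

lemma rdist_triangle: "rdist M x z \<le> rdist M x y + rdist M y z"
proof (rule ccontr)
  assume neg: "\<not> ?thesis"
  then have fin: "rdist M x y \<noteq> \<infinity>" "rdist M y z \<noteq> \<infinity>" by auto
  then obtain d1 d2 where d: "rdist M x y = ereal d1" "rdist M y z = ereal d2"
    using rdist_nonneg[of x y] rdist_nonneg[of y z] by (metis ereal_cases ereal_less_eq(2) less_eq_ereal_def zero_ereal_def MInfty_neq_ereal(1) ereal_infty_less_eq2(2))
  have "ereal (d1 + d2) < rdist M x z" using neg d by simp
  then obtain e where e: "0 < e" "ereal (d1 + d2 + e) < rdist M x z"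
  proof -
    assume *: "ereal (d1 + d2) < rdist M x z"
    then obtain r where r: "d1 + d2 < r" "ereal r < rdist M x z"
      using ereal_dense2 by (metis ereal_less(4) ereal_less_eq(3) less_ereal.simps(1))
    show thesis by (rule that[of "r - (d1 + d2)"]) (use r in auto)
  qed
  obtain \<gamma>1 S1 where 1: "pw_C1 0 1 S1 \<gamma>1" "\<gamma>1 0 = x" "\<gamma>1 1 = y" "arc_length 0 1 \<gamma>1 < d1 + e/2"
  proof (rule rdist_less_curve)
    show "rdist M x y < ereal (d1 + e/2)" using d e by simp
  qed
  obtain \<gamma>2 S2 where 2: "pw_C1 0 1 S2 \<gamma>2" "\<gamma>2 0 = y" "\<gamma>2 1 = z" "arc_length 0 1 \<gamma>2 < d2 + e/2"
  proof (rule rdist_less_curve)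
    show "rdist M y z < ereal (d2 + e/2)" using d e by simp
  qed
  define h :: "real \<Rightarrow> real" where "h = (\<lambda>t. 1 * t + -1)"
  have "h ` {1..2} = {0..1}" unfolding h_def image_affinity_atLeastAtMost by simp
  note H = pw_C1_affine[OF 2(1) _ _ _ h_def this, simplified]
  note J = pw_C1_join[OF 1(1) H(1)]
  define \<gamma> where "\<gamma> = (\<lambda>t. if t \<le> 1 then \<gamma>1 t else (\<gamma>2 \<circ> h) t)"
  have eq: "\<gamma>1 1 = (\<gamma>2 \<circ> h) 1" using 1 2 unfolding h_def by simp
  have "rdist M (\<gamma> 0) (\<gamma> 2) \<le> ereal (arc_length 0 2 \<gamma>)"
    unfolding \<gamma>_def by (rule rdist_le(1)[OF J(1)[OF _ _ eq]]) auto
  also have "arc_length 0 2 \<gamma> = arc_length 0 1 \<gamma>1 + arc_length 0 1 \<gamma>2"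
    unfolding \<gamma>_def using J(2)[OF _ _ eq] H(2) by simp
  finally have "rdist M x z \<le> ereal (arc_length 0 1 \<gamma>1 + arc_length 0 1 \<gamma>2)"
    using 1 2 unfolding \<gamma>_def h_def by simp
  also have "\<dots> \<le> ereal (d1 + d2 + e)" using 1 2 by simp
  finally show False using e by simp
qed

lemma rdist_le_segment:
  assumes c: "c \<in> atlas M" and x: "x \<in> fst c" and y: "y \<in> fst c"
    and seg: "closed_segment (snd c x) (snd c y) \<subseteq> chart_image c"
    and K: "\<And>z. z \<in> closed_segment (snd c x) (snd c y) \<Longrightarrow> coeff_norm c z (snd c y - snd c x) \<le> K"
  shows "rdist M x y \<le> ereal K"
proof -
  define w where "w = snd c y - snd c x"
  define l where "l t = snd c x + t *\<^sub>R w" for t :: real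
  define \<gamma> where "\<gamma> = chart_inv c \<circ> l"
  have l_seg: "l t \<in> closed_segment (snd c x) (snd c y)" if "t \<in> {0..1}" for t
    unfolding closed_segment_def l_def w_def using that by (auto simp: algebra_simps intro!: exI[of _ t])
  then have l_img: "l t \<in> chart_image c" if "t \<in> {0..1}" for t using that seg by blast
  have gc: "\<gamma> t \<in> fst c" "snd c (\<gamma> t) = l t" if "t \<in> {0..1}" for t
    using l_img[OF that] c unfolding \<gamma>_def by auto
  have lc: "continuous_on A l" for A unfolding l_def by (intro continuous_intros)
  have ld: "(l has_vector_derivative w) (at t within A)" for t A
    unfolding l_def by (auto intro!: derivative_eq_intros)
  have C1: "C1_curve M {u..v} \<gamma>" if uv: "0 \<le> u" "u < v" "v \<le> 1" for u v
  proof (rule C1_curveI[OF uv(2)])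
    have "continuous_map (top_of_set {u..v}) (top_of_set (chart_image c)) l"
      using lc l_img uv by (auto simp: continuous_map_in_subtopology)
    then show "continuous_map (top_of_set {u..v}) (mtop M) \<gamma>"
      unfolding \<gamma>_def by (rule continuous_map_compose[OF _ chart_inv_continuous[OF c]])
    fix d assume d: "d \<in> atlas M"
    let ?D = "\<lambda>d t. frechet_derivative (transition c d) (at (l t)) w"
    show "(snd d \<circ> \<gamma> has_vector_derivative ?D d t) (at t within {u..v})"
      if t: "t \<in> {u..v}" "\<gamma> t \<in> fst d" for t
    proof -
      have t01: "t \<in> {0..1}" using t uv by auto
      have ca: "c \<in> charts_at M (\<gamma> t)" "d \<in> charts_at M (\<gamma> t)"
        using c d t gc[OF t01] unfolding charts_at_def by auto
      let ?F = "frechet_derivative (transition c d) (at (l t))"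
      have F: "(transition c d has_derivative ?F) (at (l t))"
        using transition_has_derivative[OF ca] gc(2)[OF t01] by simp
      have lin: "linear ?F" using F by (rule has_derivative_linear)
      have "(transition c d \<circ> l has_derivative ?F \<circ> (\<lambda>h. h *\<^sub>R w)) (at t within {u..v})"
        by (rule diff_chain_within[OF ld[unfolded has_vector_derivative_def] has_derivative_at_withinI[OF F]])
      also have "?F \<circ> (\<lambda>h. h *\<^sub>R w) = (\<lambda>h. h *\<^sub>R ?F w)" using linear_scale[OF lin] by auto
      also have "transition c d \<circ> l = snd d \<circ> \<gamma>" unfolding \<gamma>_def transition_def by (simp add: o_assoc)
      finally show ?thesis unfolding has_vector_derivative_def .
    qed
    show "continuous_on {t\<in>{u..v}. \<gamma> t \<in> fst d} (?D d)"
    proof (rule continuous_on_compose2[OF smooth_onD(3)[OF transition_smooth[OF c d]] lc])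
      show "l ` {t\<in>{u..v}. \<gamma> t \<in> fst d} \<subseteq> snd c ` (fst c \<inter> fst d)"
      proof
        fix z assume "z \<in> l ` {t\<in>{u..v}. \<gamma> t \<in> fst d}"
        then obtain t where t: "t \<in> {u..v}" "\<gamma> t \<in> fst d" "z = l t" by blast
        then have "t \<in> {0..1}" using uv by auto
        then show "z \<in> snd c ` (fst c \<inter> fst d)" using t gc[of t] by (intro image_eqI[of _ _ "\<gamma> t"]) auto
      qed
    qed
  qed
  then have pw: "pw_C1 0 1 {} \<gamma>" unfolding pw_C1_def by auto
  have speed_le: "speed \<gamma> t \<le> K" if t: "t \<in> {0<..<1}" for t
  proof -
    have t': "t \<in> {0<..<1} - {}" "t \<in> {0..1}" using t by auto
    have "(snd c \<circ> \<gamma> has_vector_derivative w) (at t)"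
    proof (rule has_vector_derivative_transform_within_open[OF ld])
      show "open {0<..<1::real}" "t \<in> {0<..<1}" using t by auto
      show "l s = (snd c \<circ> \<gamma>) s" if "s \<in> {0<..<1}" for s using gc(2)[of s] that by simp
    qed
    then have "vector_derivative (snd c \<circ> \<gamma>) (at t) = w" by (rule vector_derivative_at)
    then show ?thesis
      using pw_C1_speed(2)[OF pw t'(1) c gc(1)[OF t'(2)]] K[OF l_seg[OF t'(2)]] gc(2)[OF t'(2)]
      unfolding w_def by simp
  qed
  have "arc_length 0 1 \<gamma> \<le> K"
  proof -
    have A: "(speed \<gamma> has_integral arc_length 0 1 \<gamma>) {0..1}"
      unfolding arc_length_def using pw_C1_integrable[OF pw] by (rule integrable_integral)
    have "((\<lambda>t. if t \<in> {0<..<1} then speed \<gamma> t else K) has_integral arc_length 0 1 \<gamma>) {0..1}"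
      by (rule has_integral_spike_finite[of "{0,1}", OF _ _ A]) (auto simp: less_le)
    moreover have "((\<lambda>t. K) has_integral K) {0..1::real}"
      using has_integral_const_real[of K 0 1] by simp
    ultimately show ?thesis
      by (rule has_integral_le) (use speed_le in auto)
  qed
  moreover have "\<gamma> 0 = x" "\<gamma> 1 = y" using c x y unfolding \<gamma>_def l_def w_def by auto
  ultimately show ?thesis using rdist_le(1)[OF pw] order_trans by fastforce
qed

lemma rdist_self: "x \<in> topspace (mtop M) \<Longrightarrow> rdist M x x = 0"
proof -
  assume "x \<in> topspace (mtop M)"
  then obtain c where c: "c \<in> atlas M" "x \<in> fst c" using chart_exists by blast
  have "inner_form (metric_coeff M c (snd c x))" using c by (intro metric_coeff_inner) auto
  then have "coeff_norm c (snd c x) 0 = 0" using form_norm_scale[of _ 0 0] by fastforce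
  then have "rdist M x x \<le> ereal 0" using c by (intro rdist_le_segment[of c]) auto
  then show ?thesis using rdist_nonneg[of x x] by (simp add: antisym zero_ereal_def)
qed

text \<open>On a curve whose length exceeds the distance by less than \<open>e\<close>, the point at arc length \<open>t\<close> is as
  desired.\<close>

lemma rdist_between:
  assumes x: "x \<in> topspace (mtop M)" and y: "y \<in> topspace (mtop M)"
    and d: "rdist M x y = ereal D" and t: "0 \<le> t" "t \<le> D" and e: "0 < e"
  shows "\<exists>z\<in>topspace (mtop M). rdist M x z \<le> ereal (t + e) \<and> rdist M z y \<le> ereal (D - t + e)"
proof -
  obtain \<gamma> S where g: "pw_C1 0 1 S \<gamma>" "\<gamma> 0 = x" "\<gamma> 1 = y" "arc_length 0 1 \<gamma> < D + e"
  proof (rule rdist_less_curve)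
    show "rdist M x y < ereal (D + e)" using d e by simp
  qed
  have "rdist M x y \<le> ereal (arc_length 0 1 \<gamma>)" using rdist_le(1)[OF g(1)] g by simp
  then have tL: "t \<le> arc_length 0 1 \<gamma>" using d t by simp
  have "continuous_on {0..1} (\<lambda>s. arc_length 0 s \<gamma>)"
    unfolding arc_length_def by (rule indefinite_integral_continuous_1[OF pw_C1_integrable[OF g(1)]])
  moreover have "arc_length 0 0 \<gamma> = 0" unfolding arc_length_def by simp
  ultimately obtain \<tau> where \<tau>: "0 \<le> \<tau>" "\<tau> \<le> 1" "arc_length 0 \<tau> \<gamma> = t"
    using IVT'[of "\<lambda>s. arc_length 0 s \<gamma>" 0 t 1] t tL by auto
  have z: "\<gamma> \<tau> \<in> topspace (mtop M)" using pw_C1_in_topspace[OF g(1)] \<tau> by simp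
  have "rdist M x (\<gamma> \<tau>) \<le> ereal t"
  proof (cases "\<tau> = 0")
    case True
    then show ?thesis using g(2) rdist_self[OF x] t by (simp add: zero_ereal_def)
  next
    case False
    then show ?thesis
      using rdist_le(1)[OF pw_C1_subinterval[OF g(1), of 0 \<tau>]] g(2) \<tau> by simp
  qed
  moreover have "rdist M (\<gamma> \<tau>) y \<le> ereal (arc_length \<tau> 1 \<gamma>)"
  proof (cases "\<tau> = 1")
    case True
    then show ?thesis using g(3) rdist_self[OF y] by (simp add: zero_ereal_def arc_length_def)
  next
    case False
    then show ?thesis
      using rdist_le(1)[OF pw_C1_subinterval[OF g(1), of \<tau> 1]] g(3) \<tau> by simp
  qed
  moreover have "arc_length \<tau> 1 \<gamma> \<le> D - t + e"
    using arc_length_add[OF g(1) \<tau>(1,2)] \<tau>(3) g(4) by simp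
  ultimately show ?thesis
    using z e by (intro bexI[of _ "\<gamma> \<tau>"] conjI) (auto elim!: order_trans)
qed

section \<open>First order approximation of the Riemannian distance\<close>

text \<open>All constants depend on \<open>p\<close> only, whereas the inner product is the one at the moving base point
  \<open>a\<close>; this is what makes the relative error proportional to the distance \<open>s\<close> from \<open>a\<close>. The radius
  \<open>\<rho>\<close> is so small that curves of length less than \<open>3 * s\<close> that start within distance \<open>s\<close> of \<open>a\<close> remain in
  the coordinate ball on which the metric coefficients are controlled, and longer curves do
  not affect the distance of points for which it is at most \<open>2 * s\<close>.\<close>

lemma rdist_near_inner_norm:
  assumes p: "p \<in> topspace (mtop M)"
  obtains c \<rho> C lam Lam where "c \<in> atlas M" "0 < \<rho>" "0 < C" "0 < lam" "0 < Lam"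
    "\<forall>a. rdist M p a < ereal \<rho> \<longrightarrow> a \<in> fst c \<and>
       (\<forall>v. lam * norm v \<le> coeff_norm c (snd c a) v \<and> coeff_norm c (snd c a) v \<le> Lam * norm v)"
    "\<forall>a s x y. rdist M p a < ereal \<rho> \<and> 0 < s \<and> s \<le> \<rho> \<and> rdist M a x \<le> ereal s \<and> rdist M a y \<le> ereal s \<longrightarrow>
       ereal ((1 - C * s) * coeff_norm c (snd c a) (snd c x - snd c y)) \<le> rdist M x y \<and>
       rdist M x y \<le> ereal ((1 + C * s) * coeff_norm c (snd c a) (snd c x - snd c y))"
proof -
  obtain c where c: "c \<in> atlas M" "p \<in> fst c" using chart_exists[OF p] by blast
  define x0 where "x0 = snd c p"
  have x0: "x0 \<in> chart_image c" unfolding x0_def using c by simp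
  obtain r lam Lam K where pos: "0 < r" "0 < lam" "0 < Lam" "0 < K" and B: "cball x0 r \<subseteq> chart_image c"
    and low': "\<forall>x\<in>cball x0 r. \<forall>v. lam * norm v \<le> coeff_norm c x v"
    and up: "\<forall>x\<in>cball x0 r. \<forall>v. coeff_norm c x v \<le> Lam * norm v"
    and Lip: "\<forall>x\<in>cball x0 r. \<forall>y\<in>cball x0 r. \<forall>v.
       \<bar>metric_coeff M c x v v - metric_coeff M c y v v\<bar> \<le> K * norm (x - y) * (norm v)\<^sup>2"
    using metric_coeff_local[OF c(1) x0] .
  have low: "lam * norm v \<le> coeff_norm c x v" if "x \<in> cball x0 r" for x v using low' that by blast
  define \<rho> where "\<rho> = lam * r / 8"
  define C where "C = 5 * K / lam ^ 3"
  have \<rho>: "0 < \<rho>" "\<rho> / lam = r / 8" using pos unfolding \<rho>_def by auto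
  have C: "0 < C" using pos unfolding C_def by auto
  have stay: "z \<in> fst c \<and> norm (snd c z - snd c q) < R / lam"
    if q: "q \<in> fst c" and R: "rdist M q z < ereal R" and sub: "cball (snd c q) (R / lam) \<subseteq> cball x0 r" for q z R
  proof -
    obtain \<gamma> S where g: "pw_C1 0 1 S \<gamma>" "\<gamma> 0 = q" "\<gamma> 1 = z" "arc_length 0 1 \<gamma> < R"
      using rdist_less_curve[OF R] .
    have "\<gamma> 1 \<in> fst c \<and> norm (snd c (\<gamma> 1) - snd c (\<gamma> 0)) < R / lam"
      by (rule short_curve_stays_in_chart[OF c(1) B pos(2) low g(1)]) (use q g sub pos in auto)
    then show ?thesis using g by simp
  qed
  have centre: "a \<in> fst c \<and> norm (snd c a - x0) < r / 8" if "rdist M p a < ereal \<rho>" for a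
  proof -
    have "cball (snd c p) (\<rho> / lam) \<subseteq> cball x0 r"
      unfolding x0_def \<rho>(2) using pos by (intro subset_cball) simp
    from stay[OF c(2) that this] show ?thesis unfolding \<rho>(2) x0_def .
  qed
  have sub: "cball z R \<subseteq> cball x0 r" if "norm (z - x0) + R \<le> r" for z R
  proof
    fix t assume "t \<in> cball z R"
    then have "norm (t - z) \<le> R" by (simp add: dist_norm norm_minus_commute)
    then show "t \<in> cball x0 r"
      using norm_triangle_ineq[of "t - z" "z - x0"] that by (simp add: dist_norm norm_minus_commute[of x0])
  qed
  have point: "x \<in> fst c \<and> norm (snd c x - snd c a) < 2 * s / lam"
    if a: "rdist M p a < ereal \<rho>" and s: "0 < s" "s \<le> \<rho>" and x: "rdist M a x \<le> ereal s" for a s x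
  proof (rule stay)
    show "a \<in> fst c" using centre[OF a] by blast
    show "rdist M a x < ereal (2 * s)" using x s(1) by (rule_tac le_less_trans) auto
    have "s / lam \<le> r / 8" using s pos \<rho>(2) by (metis divide_right_mono less_imp_le)
    moreover have "2 * s / lam = 2 * (s / lam)" by simp
    moreover have "norm (snd c a - x0) < r / 8" using centre[OF a] by blast
    ultimately show "cball (snd c a) (2 * s / lam) \<subseteq> cball x0 r"
      using pos(1) by (intro sub) linarith
  qed
  have cmp: "(1 - C * s) * (coeff_norm c (snd c a) v)\<^sup>2 \<le> (coeff_norm c z v)\<^sup>2"
    "(coeff_norm c z v)\<^sup>2 \<le> (1 + C * s) * (coeff_norm c (snd c a) v)\<^sup>2"
    if a: "rdist M p a < ereal \<rho>" and s: "0 < s" and z: "z \<in> cball x0 r" "norm (z - snd c a) \<le> 5 * s / lam" for a s z v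
  proof -
    have aB: "snd c a \<in> cball x0 r" using centre[OF a] pos by (auto simp: dist_norm norm_minus_commute)
    have g: "inner_form (metric_coeff M c (snd c a))" "inner_form (metric_coeff M c z)"
      using metric_coeff_inner(1)[OF c(1)] aB z(1) B by auto
    have "(lam * norm v)\<^sup>2 \<le> (coeff_norm c (snd c a) v)\<^sup>2"
      using low[OF aB, of v] pos by (intro power_mono) auto
    then have n: "(norm v)\<^sup>2 \<le> (coeff_norm c (snd c a) v)\<^sup>2 / lam\<^sup>2"
      using pos by (simp add: field_simps)
    have "\<bar>metric_coeff M c z v v - metric_coeff M c (snd c a) v v\<bar> \<le> K * norm (z - snd c a) * (norm v)\<^sup>2"
      using Lip z(1) aB by blast
    also have "\<dots> \<le> K * (5 * s / lam) * ((coeff_norm c (snd c a) v)\<^sup>2 / lam\<^sup>2)"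
      using z(2) n pos s by (intro mult_mono) auto
    also have "\<dots> = C * s * (coeff_norm c (snd c a) v)\<^sup>2"
      unfolding C_def using pos by (simp add: power2_eq_square power3_eq_cube mult_ac)
    finally have *: "\<bar>(coeff_norm c z v)\<^sup>2 - (coeff_norm c (snd c a) v)\<^sup>2\<bar> \<le> C * s * (coeff_norm c (snd c a) v)\<^sup>2"
      unfolding form_norm_square[OF g(1)] form_norm_square[OF g(2)] .
    show "(1 - C * s) * (coeff_norm c (snd c a) v)\<^sup>2 \<le> (coeff_norm c z v)\<^sup>2"
      using abs_le_D2[OF *] by (simp add: algebra_simps)
    show "(coeff_norm c z v)\<^sup>2 \<le> (1 + C * s) * (coeff_norm c (snd c a) v)\<^sup>2"
      using abs_le_D1[OF *] by (simp add: algebra_simps)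
  qed
  have lower: "ereal ((1 - C * s) * coeff_norm c (snd c a) (snd c x - snd c y)) \<le> rdist M x y"
    if a: "rdist M p a < ereal \<rho>" and s: "0 < s" "s \<le> \<rho>" and x: "rdist M a x \<le> ereal s" and y: "rdist M a y \<le> ereal s" for a s x y
  proof (rule ccontr)
    assume neg: "\<not> ?thesis"
    let ?n = "coeff_norm c (snd c a)"
    let ?L = "(1 - C * s) * ?n (snd c x - snd c y)"
    have ga: "inner_form (metric_coeff M c (snd c a))"
      using centre[OF a] c(1) by (intro metric_coeff_inner) auto
    have n0: "0 \<le> ?n v" for v by (rule form_norm_nonneg[OF ga])
    have "rdist M x y < ereal ?L" using neg by simp
    moreover have "0 \<le> rdist M x y" by (rule rdist_nonneg)
    ultimately have "0 < ?L" by (metis ereal_less(2) le_less_trans)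
    then have Cs: "0 < 1 - C * s" using n0 by (metis zero_less_mult_pos2 less_le mult_zero_right)
    have "rdist M x y \<le> rdist M a x + rdist M a y"
      using rdist_triangle[of x y a] rdist_commute[of x a] by simp
    also have "\<dots> \<le> ereal s + ereal s" by (rule add_mono[OF x y])
    also have "\<dots> < ereal (3 * s)" using s by simp
    finally have "rdist M x y < ereal (min ?L (3 * s))" using neg unfolding not_le by (simp add: min_def)
    then obtain \<gamma> S where g: "pw_C1 0 1 S \<gamma>" "\<gamma> 0 = x" "\<gamma> 1 = y" "arc_length 0 1 \<gamma> < min ?L (3 * s)"
      by (rule rdist_less_curve)
    have sr: "s / lam \<le> r / 8" using s pos \<rho>(2) by (metis divide_right_mono less_imp_le)
    have px: "x \<in> fst c" "norm (snd c x - snd c a) < 2 * s / lam" using point[OF a s x] by auto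
    have divs: "2 * s / lam = 2 * (s / lam)" "3 * s / lam = 3 * (s / lam)" "5 * s / lam = 5 * (s / lam)"
      by simp_all
    have nx: "norm (snd c x - x0) \<le> 3 * r / 8"
      using norm_triangle_ineq[of "snd c x - snd c a" "snd c a - x0"] px(2) centre[OF a] sr by simp
    have near: "\<gamma> t \<in> fst c \<and> norm (snd c (\<gamma> t) - snd c (\<gamma> 0)) < 3 * s / lam" if t: "t \<in> {0..1}" for t
    proof (rule short_curve_stays_in_chart[OF c(1) B pos(2) low g(1) _ _ _ _ t])
      show "cball (snd c (\<gamma> 0)) (3 * s / lam) \<subseteq> cball x0 r"
        using nx sr divs pos(1) unfolding g(2) by (intro sub) linarith
      show "arc_length 0 1 \<gamma> < lam * (3 * s / lam)" using g(4) pos by simp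
    qed (use px g in auto)
    have "?n (snd c (\<gamma> 1) - snd c (\<gamma> 0)) \<le> (1 / (1 - C * s)) * arc_length 0 1 \<gamma>"
    proof (rule arc_length_ge_chart_distance[OF g(1) _ c(1) _ ga])
      fix t :: real and v assume t: "t \<in> {0..1}"
      let ?z = "snd c (\<gamma> t)"
      have "norm (?z - snd c a) \<le> 5 * s / lam"
        using norm_triangle_ineq[of "?z - snd c x" "snd c x - snd c a"] near[OF t] px(2) unfolding g(2) divs
        by simp
      moreover have "norm (?z - x0) \<le> r"
        using norm_triangle_ineq[of "?z - snd c x" "snd c x - x0"] near[OF t] nx sr pos(1) unfolding g(2) divs
        by simp
      then have "?z \<in> cball x0 r" by (simp add: dist_norm norm_minus_commute)
      ultimately have "(1 - C * s) * (?n v)\<^sup>2 \<le> (coeff_norm c ?z v)\<^sup>2" by (intro cmp(1)[OF a s(1)])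
      moreover have "((1 - C * s) * ?n v)\<^sup>2 \<le> (1 - C * s) * (?n v)\<^sup>2"
      proof -
        have "(1 - C * s) * (1 - C * s) \<le> (1 - C * s) * 1" using Cs C s by (intro mult_left_mono) auto
        then have "((1 - C * s) * (1 - C * s)) * (?n v)\<^sup>2 \<le> ((1 - C * s) * 1) * (?n v)\<^sup>2" by (intro mult_right_mono) auto
        then show ?thesis by (simp add: power_mult_distrib power2_eq_square[of "1 - C * s"])
      qed
      ultimately have "((1 - C * s) * ?n v)\<^sup>2 \<le> (coeff_norm c ?z v)\<^sup>2" by linarith
      then have "(1 - C * s) * ?n v \<le> coeff_norm c ?z v"
        by (rule power2_le_imp_le) (use near[OF t] c(1) in \<open>auto intro!: form_norm_nonneg metric_coeff_inner\<close>)
      then show "?n v \<le> 1 / (1 - C * s) * coeff_norm c ?z v" using Cs by (simp add: pos_le_divide_eq mult.commute)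
    qed (use near Cs in auto)
    then have "?L \<le> arc_length 0 1 \<gamma>"
      using Cs form_norm_minus_commute[OF ga, of "snd c x" "snd c y"] unfolding g(2,3)
      by (simp add: pos_le_divide_eq mult.commute)
    then show False using g(4) by simp
  qed
  have upper: "rdist M x y \<le> ereal ((1 + C * s) * coeff_norm c (snd c a) (snd c x - snd c y))"
    if a: "rdist M p a < ereal \<rho>" and s: "0 < s" "s \<le> \<rho>" and x: "rdist M a x \<le> ereal s" and y: "rdist M a y \<le> ereal s" for a s x y
  proof -
    let ?n = "coeff_norm c (snd c a)"
    have ga: "inner_form (metric_coeff M c (snd c a))"
      using centre[OF a] c(1) by (intro metric_coeff_inner) auto
    have sr: "s / lam \<le> r / 8" using s pos \<rho>(2) by (metis divide_right_mono less_imp_le)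
    have "2 * s / lam = 2 * (s / lam)" by simp
    moreover have "norm (snd c a - x0) < r / 8" using centre[OF a] by blast
    ultimately have sB: "cball (snd c a) (2 * s / lam) \<subseteq> cball x0 r"
      using sr pos(1) by (intro sub) linarith
    have "snd c x \<in> cball (snd c a) (2 * s / lam)" "snd c y \<in> cball (snd c a) (2 * s / lam)"
      using point[OF a s x] point[OF a s y] by (auto simp: dist_norm norm_minus_commute)
    then have seg: "closed_segment (snd c x) (snd c y) \<subseteq> cball (snd c a) (2 * s / lam)"
      by (intro closed_segment_subset convex_cball)
    have "rdist M x y \<le> ereal ((1 + C * s) * ?n (snd c y - snd c x))"
    proof (rule rdist_le_segment[OF c(1)])
      show "closed_segment (snd c x) (snd c y) \<subseteq> chart_image c" using seg sB B by blast
      fix z assume "z \<in> closed_segment (snd c x) (snd c y)"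
      then have z: "z \<in> cball x0 r" "norm (z - snd c a) \<le> 2 * s / lam"
        using seg sB by (auto simp: dist_norm norm_minus_commute subset_iff)
      then have "norm (z - snd c a) \<le> 5 * s / lam" using s pos divide_right_mono[of "2 * s" "5 * s" lam] by linarith
      then have "(coeff_norm c z (snd c y - snd c x))\<^sup>2 \<le> (1 + C * s) * (?n (snd c y - snd c x))\<^sup>2"
        by (rule cmp(2)[OF a s(1) z(1)])
      also have "\<dots> \<le> (1 + C * s)\<^sup>2 * (?n (snd c y - snd c x))\<^sup>2"
        using C s by (intro mult_right_mono) (auto simp: power2_eq_square algebra_simps)
      finally have "(coeff_norm c z (snd c y - snd c x))\<^sup>2 \<le> ((1 + C * s) * ?n (snd c y - snd c x))\<^sup>2"
        by (simp add: power_mult_distrib)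
      then show "coeff_norm c z (snd c y - snd c x) \<le> (1 + C * s) * ?n (snd c y - snd c x)"
        by (rule power2_le_imp_le) (use C s form_norm_nonneg[OF ga] in auto)
    qed (use point[OF a s x] point[OF a s y] in auto)
    then show ?thesis using form_norm_minus_commute[OF ga, of "snd c x" "snd c y"] by simp
  qed
  have inB: "snd c a \<in> cball x0 r" if "rdist M p a < ereal \<rho>" for a
    using centre[OF that] pos by (auto simp: dist_norm norm_minus_commute)
  show thesis
  proof (rule that[OF c(1) \<rho>(1) C pos(2,3)]; intro allI impI)
    fix a assume a: "rdist M p a < ereal \<rho>"
    show "a \<in> fst c \<and> (\<forall>v. lam * norm v \<le> coeff_norm c (snd c a) v \<and> coeff_norm c (snd c a) v \<le> Lam * norm v)"
      using centre[OF a] low' up inB[OF a] by blast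
  next
    fix a s x y
    assume *: "rdist M p a < ereal \<rho> \<and> 0 < s \<and> s \<le> \<rho> \<and> rdist M a x \<le> ereal s \<and> rdist M a y \<le> ereal s"
    then show "ereal ((1 - C * s) * coeff_norm c (snd c a) (snd c x - snd c y)) \<le> rdist M x y \<and>
       rdist M x y \<le> ereal ((1 + C * s) * coeff_norm c (snd c a) (snd c x - snd c y))"
      using lower[of a s x y] upper[of a s x y] by blast
  qed
qed

text \<open>The first order approximation at \<open>x\<close> shows that \<open>x\<close> and \<open>y\<close> have the same coordinates.\<close>

lemma rdist_eq_0:
  assumes x: "x \<in> topspace (mtop M)" and d: "rdist M x y = 0"
  shows "x = y"
proof -
  obtain c \<rho> C lam Lam where c: "c \<in> atlas M" and pos: "0 < \<rho>" "0 < C" "0 < lam" "0 < Lam"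
    and pt: "\<forall>a. rdist M x a < ereal \<rho> \<longrightarrow> a \<in> fst c \<and>
       (\<forall>v. lam * norm v \<le> coeff_norm c (snd c a) v \<and> coeff_norm c (snd c a) v \<le> Lam * norm v)"
    and close: "\<forall>a s x' y'. rdist M x a < ereal \<rho> \<and> 0 < s \<and> s \<le> \<rho> \<and> rdist M a x' \<le> ereal s \<and> rdist M a y' \<le> ereal s \<longrightarrow>
       ereal ((1 - C * s) * coeff_norm c (snd c a) (snd c x' - snd c y')) \<le> rdist M x' y' \<and>
       rdist M x' y' \<le> ereal ((1 + C * s) * coeff_norm c (snd c a) (snd c x' - snd c y'))"
    using rdist_near_inner_norm[OF x] .
  define s where "s = min \<rho> (1 / (2 * C))"
  have s: "0 < s" "s \<le> \<rho>" "C * s \<le> 1/2"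
  proof -
    show "0 < s" "s \<le> \<rho>" using pos unfolding s_def by auto
    have "s \<le> 1 / (2 * C)" unfolding s_def by simp
    then show "C * s \<le> 1/2" using pos by (simp add: field_simps)
  qed
  have xx: "rdist M x x < ereal \<rho>" "rdist M x y < ereal \<rho>" using rdist_self[OF x] d pos by (auto simp: zero_ereal_def)
  have "ereal ((1 - C * s) * coeff_norm c (snd c x) (snd c x - snd c y)) \<le> rdist M x y"
  proof -
    have "rdist M x x \<le> ereal s" "rdist M x y \<le> ereal s"
      using rdist_self[OF x] d s by (auto simp: zero_ereal_def)
    then show ?thesis using close xx(1) s by blast
  qed
  then have "(1 - C * s) * coeff_norm c (snd c x) (snd c x - snd c y) \<le> 0" using d by (simp add: zero_ereal_def)
  then have "coeff_norm c (snd c x) (snd c x - snd c y) \<le> 0" using s by (simp add: mult_le_0_iff)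
  then have "lam * norm (snd c x - snd c y) \<le> 0" using pt xx(1) order_trans by blast
  then have "snd c x = snd c y" using pos by (simp add: mult_le_0_iff)
  then show ?thesis using inj_onD[OF chart_inj[OF c]] pt xx by blast
qed

text \<open>The points at finite distance from \<open>a\<close>; on this set the distance is real-valued.\<close>

definition component :: "'a \<Rightarrow> 'a set" where
  "component a = {y \<in> topspace (mtop M). rdist M a y < \<infinity>}"

definition real_rdist :: "'a \<Rightarrow> 'a \<Rightarrow> real" where
  "real_rdist x y = real_of_ereal (rdist M x y)"

lemma rdist_eq_real_rdist:
  assumes "x \<in> component a" "y \<in> component a"
  shows "rdist M x y = ereal (real_rdist x y)"
proof -
  have "rdist M x y \<le> rdist M a x + rdist M a y"
    using rdist_triangle[of x y a] rdist_commute[of x a] by simp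
  also have "\<dots> < \<infinity>" using assms unfolding component_def by simp
  finally have "rdist M x y \<noteq> \<infinity>" by simp
  then show ?thesis using rdist_nonneg[of x y] unfolding real_rdist_def by (auto simp: ereal_real)
qed

lemma component_step: "x \<in> component a \<Longrightarrow> rdist M x y < \<infinity> \<Longrightarrow> y \<in> topspace (mtop M) \<Longrightarrow> y \<in> component a"
  using rdist_triangle[of a y x] unfolding component_def by (auto simp: le_less_trans)

lemma component_Metric_space: "Metric_space (component a) real_rdist"
proof
  show "0 \<le> real_rdist x y" for x y unfolding real_rdist_def using rdist_nonneg by (simp add: real_of_ereal_pos)
  show "real_rdist x y = real_rdist y x" for x y unfolding real_rdist_def by (simp add: rdist_commute)
  show "real_rdist x y = 0 \<longleftrightarrow> x = y" if xy: "x \<in> component a" "y \<in> component a" for x y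
    using rdist_eq_real_rdist[OF xy] rdist_eq_0[of x y] rdist_self[of x] xy
    unfolding component_def by (auto simp: zero_ereal_def)
  show "real_rdist x z \<le> real_rdist x y + real_rdist y z" if "x \<in> component a" "y \<in> component a" "z \<in> component a" for x y z
    using rdist_triangle[of x z y] that by (simp add: rdist_eq_real_rdist)
qed

lemma component_length_space:
  assumes compl: "complete_riemannian M"
  shows "length_space (component a) real_rdist"
proof -
  interpret Metric_space "component a" real_rdist by (rule component_Metric_space)
  show ?thesis
  proof
    fix x y :: 'a and t e :: real
    assume x: "x \<in> component a" and y: "y \<in> component a" and t: "0 \<le> t" "t \<le> real_rdist x y" "0 < e"
    have "x \<in> topspace (mtop M)" "y \<in> topspace (mtop M)" using x y unfolding component_def by auto
    then obtain z where z: "z \<in> topspace (mtop M)" "rdist M x z \<le> ereal (t + e)" "rdist M z y \<le> ereal (real_rdist x y - t + e)"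
      using rdist_between[OF _ _ rdist_eq_real_rdist[OF x y] t] by blast
    have "rdist M x z < \<infinity>" using z(2) by (auto simp: le_less_trans)
    then have "z \<in> component a" using component_step[OF x _ z(1)] by simp
    then show "\<exists>z\<in>component a. real_rdist x z \<le> t + e \<and> real_rdist z y \<le> real_rdist x y - t + e"
      using z x y by (intro bexI[of _ z]) (auto simp: rdist_eq_real_rdist)
  next
    show mcomplete
      unfolding mcomplete_def
    proof (intro allI impI)
      fix s assume s: "MCauchy s"
      then have sX: "s n \<in> component a" for n unfolding MCauchy_def by auto
      have "\<exists>K. \<forall>m\<ge>K. \<forall>n\<ge>K. rdist M (s m) (s n) < ereal e" if "e > 0" for e
        using s that unfolding MCauchy_def by (simp add: rdist_eq_real_rdist[OF sX sX])
      moreover have "range s \<subseteq> topspace (mtop M)" using sX unfolding component_def by auto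
      ultimately obtain x where x: "x \<in> topspace (mtop M)" and lim: "(\<lambda>n. rdist M (s n) x) \<longlonglongrightarrow> 0"
        using compl unfolding complete_riemannian_def by blast
      have ev: "\<forall>\<^sub>F n in sequentially. rdist M (s n) x < ereal e" if "e > 0" for e
        using order_tendstoD(2)[OF lim] that by (simp add: zero_ereal_def)
      have "\<exists>n. rdist M (s n) x < ereal 1"
        using eventually_happens'[OF sequentially_bot ev[of 1]] by simp
      then obtain n where n: "rdist M (s n) x < ereal 1" ..
      then have "rdist M (s n) x < \<infinity>" by (rule less_trans) simp
      then have xX: "x \<in> component a" by (rule component_step[OF sX _ x])
      have "limitin mtopology s x sequentially"
        unfolding limitin_metric using xX sX ev by (auto simp: rdist_eq_real_rdist[OF sX xX])
      then show "\<exists>x. limitin mtopology s x sequentially" ..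
    qed
  qed
qed

text \<open>The metric tensor in a chart around \<open>p\<close> provides the inner products.\<close>

lemma component_chart:
  assumes compl: "complete_riemannian M" and p: "p \<in> component a"
  shows "\<exists>(\<phi>::'a \<Rightarrow> 'e) G \<rho> C lam Lam. infinitesimal_chart (component a) real_rdist \<phi> G p \<rho> C lam Lam"
proof -
  interpret length_space "component a" real_rdist by (rule component_length_space[OF compl])
  have pt: "p \<in> topspace (mtop M)" using p unfolding component_def by simp
  obtain c \<rho> C lam Lam where c: "c \<in> atlas M" and pos: "0 < \<rho>" "0 < C" "0 < lam" "0 < Lam"
    and at_pt: "\<forall>a. rdist M p a < ereal \<rho> \<longrightarrow> a \<in> fst c \<and>
       (\<forall>v. lam * norm v \<le> coeff_norm c (snd c a) v \<and> coeff_norm c (snd c a) v \<le> Lam * norm v)"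
    and close: "\<forall>a s x' y'. rdist M p a < ereal \<rho> \<and> 0 < s \<and> s \<le> \<rho> \<and> rdist M a x' \<le> ereal s \<and> rdist M a y' \<le> ereal s \<longrightarrow>
       ereal ((1 - C * s) * coeff_norm c (snd c a) (snd c x' - snd c y')) \<le> rdist M x' y' \<and>
       rdist M x' y' \<le> ereal ((1 + C * s) * coeff_norm c (snd c a) (snd c x' - snd c y'))"
    using rdist_near_inner_norm[OF pt] .
  have ball: "q \<in> component a \<and> rdist M p q < ereal \<rho>" if "q \<in> mball p \<rho>" for q
    using that p by (auto simp: rdist_eq_real_rdist)
  have "infinitesimal_chart (component a) real_rdist (snd c) (\<lambda>q. metric_coeff M c (snd c q)) p \<rho> C lam Lam"
  proof
    fix q assume q: "q \<in> mball p \<rho>"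
    note b = ball[OF q]
    show "inner_form (metric_coeff M c (snd c q))"
      using at_pt b c by (intro metric_coeff_inner) auto
    show "lam * norm v \<le> coeff_norm c (snd c q) v" "coeff_norm c (snd c q) v \<le> Lam * norm v" for v
      using at_pt b by blast+
    fix s x y assume s: "0 < s" "s \<le> \<rho>" and xy: "x \<in> component a" "y \<in> component a" "real_rdist q x \<le> s" "real_rdist q y \<le> s"
    have "rdist M q x \<le> ereal s" "rdist M q y \<le> ereal s" using xy rdist_eq_real_rdist[of q a] b by simp_all
    then have "ereal ((1 - C * s) * coeff_norm c (snd c q) (snd c x - snd c y)) \<le> rdist M x y \<and>
       rdist M x y \<le> ereal ((1 + C * s) * coeff_norm c (snd c q) (snd c x - snd c y))"
      using close b s by blast
    then show "(1 - C * s) * coeff_norm c (snd c q) (snd c x - snd c y) \<le> real_rdist x y"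
      "real_rdist x y \<le> (1 + C * s) * coeff_norm c (snd c q) (snd c x - snd c y)"
      using xy by (simp_all add: rdist_eq_real_rdist)
  qed (use pos in auto)
  then show ?thesis by blast
qed

lemma mball_geodesic_ball:
  assumes "x \<in> component a"
  shows "Metric_space.mball (component a) real_rdist x r = geodesic_ball M x r"
proof -
  interpret Metric_space "component a" real_rdist by (rule component_Metric_space)
  have "y \<in> component a" if "y \<in> geodesic_ball M x r" for y
  proof (rule component_step[OF assms])
    show "y \<in> topspace (mtop M)" using that unfolding geodesic_ball_def by simp
    have "rdist M x y < ereal r" using that unfolding geodesic_ball_def by simp
    then show "rdist M x y < \<infinity>" by (rule less_trans) simp
  qed
  moreover have "y \<in> mball x r \<longleftrightarrow> y \<in> geodesic_ball M x r" if "y \<in> component a" for y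
  proof -
    have "y \<in> topspace (mtop M)" using that unfolding component_def by blast
    then show ?thesis
      using that assms rdist_eq_real_rdist[OF assms that] unfolding geodesic_ball_def by simp
  qed
  ultimately show ?thesis by (meson in_mball subsetI subset_antisym)
qed

end

section \<open>The covering theorem for Riemannian manifolds\<close>

text \<open>As the set of centres is bounded, all centres lie in one component, which is a complete length space
  with infinitesimally Euclidean charts and in which the metric balls are the geodesic balls.\<close>

theorem theorem1p1:
  fixes M :: "('a, 'e::euclidean_space) riemannian"
    and \<F> :: "('a \<times> real) set"
    and A :: "'a set"
  assumes "riemannian_manifold M"
    and "complete_riemannian M"
    and "\<forall>D\<in>\<F>. four_proper M D"
    and "A = fst ` \<F>"
    and "rbounded M A"
  shows "\<exists>(N::nat)\<ge>1. \<exists>\<G> :: nat \<Rightarrow> ('a \<times> real) set.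
           (\<forall>j\<in>{1..N}. \<G> j \<subseteq> \<F> \<and> countable (\<G> j) \<and>
              disjoint_family_on (\<lambda>(x, r). geodesic_ball M x r) (\<G> j)) \<and>
           A \<subseteq> (\<Union>j\<in>{1..N}. \<Union>(x, r)\<in>\<G> j. geodesic_ball M x r)"
proof (cases "A = {}")
  case True
  then show ?thesis
    by (intro exI[of _ 1] conjI exI[of _ "\<lambda>_. {}"]) (auto simp: disjoint_family_on_def)
next
  case False
  interpret riemannian_space M by (rule riemannian_space.intro[OF assms(1)])
  obtain a where a: "a \<in> A" using False by blast
  obtain R where At: "A \<subseteq> topspace (mtop M)" and R: "\<And>y. y \<in> A \<Longrightarrow> rdist M a y \<le> ereal R"
    using assms(5) a unfolding rbounded_def by blast
  have "rdist M a y < \<infinity>" if "y \<in> A" for y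
    using R[OF that] by (rule le_less_trans) simp
  then have AX: "A \<subseteq> component a"
    using At unfolding component_def by blast
  have aX: "a \<in> component a" using a AX by blast
  interpret length_space "component a" real_rdist by (rule component_length_space[OF assms(2)])
  have "coverable \<F> (fst ` \<F>)"
  proof (rule Besicovitch_covering[OF component_chart[OF assms(2)]])
    show "0 < r" if "(x, r) \<in> \<F>" for x r using assms(3) that unfolding four_proper_def by auto
    have "real_rdist a y < R + 1" if "y \<in> A" for y
      using R[OF that] rdist_eq_real_rdist[OF aX, of y] AX that by auto
    then have "y \<in> mball a (R + 1)" if "y \<in> A" for y using AX aX that by auto
    then show "fst ` \<F> \<subseteq> mball a (R + 1)" unfolding assms(4) by blast
  qed (use aX in auto)
  then obtain N :: nat and G where N: "N \<ge> 1"
    and G: "\<forall>j\<in>{1..N}. G j \<subseteq> \<F> \<and> countable (G j) \<and> disjoint_family_on (\<lambda>(x, r). mball x r) (G j)"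
    and cov: "fst ` \<F> \<subseteq> (\<Union>j\<in>{1..N}. \<Union>(x, r)\<in>G j. mball x r)"
    unfolding coverable_def by blast
  have ball: "(case b of (x, r) \<Rightarrow> mball x r) = (case b of (x, r) \<Rightarrow> geodesic_ball M x r)" if "b \<in> \<F>" for b
  proof -
    have "fst b \<in> component a" using that AX assms(4) by auto
    then show ?thesis by (simp add: split_beta mball_geodesic_ball)
  qed
  have "disjoint_family_on (\<lambda>(x, r). geodesic_ball M x r) (G j)" if j: "j \<in> {1..N}" for j
  proof -
    have "G j \<subseteq> \<F>" "disjoint_family_on (\<lambda>(x, r). mball x r) (G j)" using G j by auto
    then show ?thesis unfolding disjoint_family_on_def by (metis ball subsetD)
  qed
  moreover have "(\<Union>j\<in>{1..N}. \<Union>(x, r)\<in>G j. mball x r) = (\<Union>j\<in>{1..N}. \<Union>(x, r)\<in>G j. geodesic_ball M x r)"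
    by (intro SUP_cong refl ball) (use G in blast)
  ultimately show ?thesis using N G cov assms(4) by (intro exI[of _ N] conjI exI[of _ G]) auto
qed

end
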